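(* Let $A_1,\dots,A_d$ be constant complex $N\times N$ matrices and $L=\partial_t+\sum_{l=1}^dA_l\partial_l$. If the Cauchy problem for $L$ is strongly well posed and $L(0,\partial_x)=\sum_lA_l\partial_l$ is elliptic (that is, $\det\big(\sum_l\xi_lA_l\big)\neq0$ for all $\xi\in\mathbb R^d\setminus\{0\}$), then the Cauchy problem for the Bérenger split operator $\widetilde L$ is strongly well posed for any absorptions $(\sigma_1(x_1),\dots,\sigma_d(x_d))\in(L^\infty(\mathbb R))^d$.
   Context: Bérenger split operator: for $\widetilde U=(U^1,\dots,U^d)$ with $U^l$ valued in $\mathbb C^N$, $(\widetilde L\widetilde U)_l:=\partial_tU^l+A_l\partial_l\big(\sum_{j=1}^dU^j\big)+\sigma_l(x_l)U^l$, $1\le l\le d$. Strong well posedness: the Cauchy problem for $\mathcal L=\partial_t+\sum_l\mathcal A_l\partial_l+\mathcal B(x)$ is strongly well posed if there exist $K>0$, $\alpha\in\mathbb R$ such that for any initial value in $L^2(\mathbb R^d)$ there is a unique solution $U\in C^0([0,\infty[;L^2(\mathbb R^d))$ of $\mathcal LU=0$, and $\|U(t,\cdot)\|_{L^2}\le Ke^{\alpha t}\|U(0,\cdot)\|_{L^2}$ for all $t\ge0$. *)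

theory Defs
  imports "HOL-Analysis.Analysis"
begin

section \<open>Function spaces\<close>

text \<open>Elements of \<open>L\<^sup>2\<close> and \<open>L\<^sup>\<infinity>\<close> are represented by Borel functions; every class of Lebesgue
  measurable functions modulo null sets has such a representative.  Equality in these spaces is
  equality almost everywhere.\<close>

definition L2 :: "('a::euclidean_space \<Rightarrow> 'b::euclidean_space) \<Rightarrow> bool" where
  "L2 f \<longleftrightarrow> f \<in> borel_measurable lborel \<and> integrable lborel (\<lambda>x. (norm (f x))\<^sup>2)"

definition L2_norm :: "('a::euclidean_space \<Rightarrow> 'b::euclidean_space) \<Rightarrow> real" where
  "L2_norm f = sqrt (\<integral>x. (norm (f x))\<^sup>2 \<partial>lborel)"

definition Linfty :: "('a::euclidean_space \<Rightarrow> 'b::euclidean_space) \<Rightarrow> bool" where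
  "Linfty f \<longleftrightarrow> f \<in> borel_measurable lborel \<and> (\<exists>C. AE x in lborel. norm (f x) \<le> C)"

text \<open>\<open>C\<^sup>0([0,\<infinity>[; L\<^sup>2)\<close>; the values of \<open>U\<close> at negative times are irrelevant.\<close>

definition C0_L2 :: "(real \<Rightarrow> 'a::euclidean_space \<Rightarrow> 'b::euclidean_space) \<Rightarrow> bool" where
  "C0_L2 U \<longleftrightarrow> (\<forall>t\<ge>0. L2 (U t)) \<and>
     (\<forall>t\<ge>0. ((\<lambda>s. L2_norm (\<lambda>x. U s x - U t x)) \<longlongrightarrow> 0) (at t within {0..}))"

primrec Ck :: "nat \<Rightarrow> ('a::euclidean_space \<Rightarrow> 'b::real_normed_vector) \<Rightarrow> bool" where
  "Ck 0 f \<longleftrightarrow> continuous_on UNIV f"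
| "Ck (Suc k) f \<longleftrightarrow> f differentiable_on UNIV \<and>
     (\<forall>b\<in>Basis. Ck k (\<lambda>z. frechet_derivative f (at z) b))"

text \<open>\<open>C\<^sub>c\<^sup>\<infinity>(]0,\<infinity>[ \<times> \<real>\<^sup>d)\<close>, extended by zero to all of \<open>\<real> \<times> \<real>\<^sup>d\<close>.\<close>

definition test_function :: "(real \<times> (real ^ 'd::finite) \<Rightarrow> complex) \<Rightarrow> bool" where
  "test_function \<phi> \<longleftrightarrow> (\<forall>k. Ck k \<phi>) \<and>
     compact (closure {z. \<phi> z \<noteq> 0}) \<and> closure {z. \<phi> z \<noteq> 0} \<subseteq> {0<..} \<times> UNIV"

definition dt :: "(real \<times> (real ^ 'd::finite) \<Rightarrow> complex) \<Rightarrow> real \<times> (real ^ 'd) \<Rightarrow> complex" where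
  "dt \<phi> z = frechet_derivative \<phi> (at z) (1, 0)"

definition dx :: "'d::finite \<Rightarrow> (real \<times> (real ^ 'd) \<Rightarrow> complex) \<Rightarrow> real \<times> (real ^ 'd) \<Rightarrow> complex" where
  "dx l \<phi> z = frechet_derivative \<phi> (at z) (0, axis l 1)"


section \<open>First-order systems and strong well-posedness\<close>

text \<open>The operator \<open>\<partial>\<^sub>t + \<Sum>\<^sub>l \<A>\<^sub>l \<partial>\<^sub>l + \<B>(x)\<close> is given by its coefficients \<open>\<A>\<close> and \<open>\<B>\<close>.
  \<open>dist_solution \<A> \<B> U\<close> says that it annihilates \<open>U\<close> in the sense of distributions on
  \<open>]0,\<infinity>[ \<times> \<real>\<^sup>d\<close>; integration by parts has been used to move all derivatives to the test function.
  The pairing integrates in \<open>x\<close> first, because an element of \<open>C\<^sup>0([0,\<infinity>[; L\<^sup>2)\<close> is given by one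
  representative for each time, so that it need not be jointly measurable in \<open>(t, x)\<close>.
  For \<open>U\<close> in that space and \<open>\<B>\<close> bounded all integrands are integrable.\<close>

definition dist_solution ::
  "('d::finite \<Rightarrow> complex ^ 'm ^ 'm) \<Rightarrow> (real ^ 'd \<Rightarrow> complex ^ 'm ^ 'm)
    \<Rightarrow> (real \<Rightarrow> real ^ 'd \<Rightarrow> complex ^ 'm) \<Rightarrow> bool" where
  "dist_solution \<A> \<B> U \<longleftrightarrow>
     (\<forall>\<phi>. test_function \<phi> \<longrightarrow>
        (LINT t:{0<..}|lborel. (\<integral>x.
             - (dt \<phi> (t, x) *s U t x)
             - (\<Sum>l\<in>UNIV. dx l \<phi> (t, x) *s (\<A> l *v U t x))
             + \<phi> (t, x) *s (\<B> x *v U t x) \<partial>lborel)) = 0)"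

definition cauchy_solution ::
  "('d::finite \<Rightarrow> complex ^ 'm ^ 'm) \<Rightarrow> (real ^ 'd \<Rightarrow> complex ^ 'm ^ 'm)
    \<Rightarrow> (real ^ 'd \<Rightarrow> complex ^ 'm) \<Rightarrow> (real \<Rightarrow> real ^ 'd \<Rightarrow> complex ^ 'm) \<Rightarrow> bool" where
  "cauchy_solution \<A> \<B> u0 U \<longleftrightarrow>
     C0_L2 U \<and> (AE x in lborel. U 0 x = u0 x) \<and> dist_solution \<A> \<B> U"

definition strongly_well_posed ::
  "('d::finite \<Rightarrow> complex ^ 'm ^ 'm) \<Rightarrow> (real ^ 'd \<Rightarrow> complex ^ 'm ^ 'm) \<Rightarrow> bool" where
  "strongly_well_posed \<A> \<B> \<longleftrightarrow>
     (\<exists>K>0. \<exists>\<alpha>::real. \<forall>u0. L2 u0 \<longrightarrow>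
        (\<exists>U. cauchy_solution \<A> \<B> u0 U \<and>
             (\<forall>V. cauchy_solution \<A> \<B> u0 V \<longrightarrow> (\<forall>t\<ge>0. AE x in lborel. V t x = U t x)) \<and>
             (\<forall>t\<ge>0. L2_norm (U t) \<le> K * exp (\<alpha> * t) * L2_norm (U 0))))"

definition elliptic :: "('d::finite \<Rightarrow> complex ^ 'n ^ 'n) \<Rightarrow> bool" where
  "elliptic A \<longleftrightarrow> (\<forall>\<xi>::real ^ 'd. \<xi> \<noteq> 0 \<longrightarrow> det (\<Sum>l\<in>UNIV. (\<xi> $ l) *\<^sub>R A l) \<noteq> 0)"


section \<open>The split operator\<close>

text \<open>The unknown \<open>(U\<^sup>1, \<dots>, U\<^sup>d)\<close> is stored as one vector indexed by pairs, the entry \<open>(k, a)\<close> being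
  the \<open>a\<close>-th component of \<open>U\<^sup>k\<close>.  The coefficient of \<open>\<partial>\<^sub>l\<close> is the block matrix whose \<open>l\<close>-th block
  row is \<open>(A\<^sub>l, \<dots>, A\<^sub>l)\<close> and whose other block rows vanish.\<close>

definition split_coeff :: "('d::finite \<Rightarrow> complex ^ 'n::finite ^ 'n) \<Rightarrow> 'd \<Rightarrow> complex ^ ('d \<times> 'n) ^ ('d \<times> 'n)" where
  "split_coeff A l = (\<chi> p q. if fst p = l then A l $ snd p $ snd q else 0)"

definition split_absorption ::
  "('d::finite \<Rightarrow> real \<Rightarrow> complex) \<Rightarrow> real ^ 'd \<Rightarrow> complex ^ ('d \<times> 'n::finite) ^ ('d \<times> 'n)" where
  "split_absorption \<sigma> x = (\<chi> p q. if p = q then \<sigma> (fst p) (x $ fst p) else 0)"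

definition block :: "complex ^ ('d::finite \<times> 'n::finite) \<Rightarrow> 'd \<Rightarrow> complex ^ 'n" where
  "block U k = (\<chi> a. U $ (k, a))"

text \<open>In terms of blocks, the \<open>k\<close>-th component of the operator with these coefficients is
  \<open>\<partial>\<^sub>t U\<^sup>k + A\<^sub>k \<partial>\<^sub>k (\<Sum>\<^sub>j U\<^sup>j) + \<sigma>\<^sub>k(x\<^sub>k) U\<^sup>k\<close>.\<close>

lemma block_split_coeff:
  "block (split_coeff A l *v U) k = (if k = l then A l *v (\<Sum>j\<in>UNIV. block U j) else 0)"
proof -
  have "(\<Sum>q\<in>UNIV. A l $ a $ snd q * U $ q) = (\<Sum>b\<in>UNIV. A l $ a $ b * (\<Sum>j\<in>UNIV. U $ (j, b)))"
    for a
  proof -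
    have "(\<Sum>q\<in>UNIV. A l $ a $ snd q * U $ q) = (\<Sum>j\<in>UNIV. \<Sum>b\<in>UNIV. A l $ a $ b * U $ (j, b))"
      by (simp add: sum.cartesian_product case_prod_beta flip: UNIV_Times_UNIV)
    also have "\<dots> = (\<Sum>b\<in>UNIV. \<Sum>j\<in>UNIV. A l $ a $ b * U $ (j, b))"
      by (rule sum.swap)
    finally show ?thesis by (simp add: sum_distrib_left)
  qed
  then show ?thesis
    by (auto simp: vec_eq_iff block_def split_coeff_def matrix_vector_mult_def)
qed

lemma block_split_absorption:
  "block (split_absorption \<sigma> x *v U) k = \<sigma> k (x $ k) *s block U k"
proof -
  have "(\<Sum>q\<in>UNIV. (if p = q then c else 0) * U $ q) = c * U $ p" for p c
    by (simp add: if_distrib [where f = "\<lambda>y. y * _"] cong: if_cong)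
  then show ?thesis
    by (simp add: vec_eq_iff block_def split_absorption_def matrix_vector_mult_def)
qed

end

theory Submission
  imports Defs "HOL-Probability.Characteristic_Functions"
begin

text \<open>Integrating the split system with \<open>\<sigma> = 0\<close> once in time, the sum \<open>V\<close> of the components solves
  \<open>L V = 0\<close>, and \<open>U\<^sup>l(t) = U\<^sup>l(0) - A\<^sub>l \<partial>\<^sub>l W(t)\<close> with \<open>W(t) = \<integral>\<^sub>0\<^sup>t V\<close>.  Since
  \<open>\<Sum>\<^sub>l A\<^sub>l \<partial>\<^sub>l W(t) = V(0) - V(t)\<close> lies in \<open>L\<^sup>2\<close>, ellipticity gives
  \<open>\<parallel>\<partial>\<^sub>l W(t)\<parallel> \<le> C \<parallel>V(0) - V(t)\<parallel>\<close>, so that no derivative is lost.  Uniqueness follows from uniqueness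
  for \<open>L\<close>, applied to the sum first.  The bounded term \<open>\<sigma>\<close> is then added by Duhamel's formula and a
  contraction in an exponentially weighted supremum norm.

  The elliptic estimate rests on a Plancherel identity regularised by a Gaussian; it is applied to cut-off
  functions, whose Fourier integrals converge, and the cut-off is then removed.  The derivatives
  \<open>\<partial>\<^sub>l W\<close> are obtained as limits of difference quotients, which are exactly the derivatives of averages of
  translates of \<open>W\<close>.\<close>

section \<open>The Hilbert space of square-integrable functions\<close>

text \<open>Without ellipticity the equation for the sum controls only the combination of the
  derivatives \<partial>_l W with the matrices in L^2, while the components of the split unknown
  contain the derivatives one by one; this is the loss to be excluded. A solution is merely
  continuous in time with values in L^2 and its values need not lie in the domain of the spatial
  operator. Equations are therefore stated for time integrals: the pair of
  \<open>integral {0..t} U\<close> and \<open>u - U t\<close> (minus the integrated lower order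
  term) has to lie in a closed graph. Closedness lets the operator pass under integrals, and the
  perturbation argument can be carried out in an arbitrary Banach space. The elliptic estimate is an
  inequality between two L^2 norms, and Fourier transforms are taken of integrable functions only.
  The Gaussian weight makes the double integrals converge absolutely, and L^2 continuity of
  translations removes it again. Values of solutions are classes modulo null sets, without joint
  measurability in time and space; so L^2 is built as a Banach space and solutions are curves in
  it.\<close>

lemma L2_borel [measurable_dest]: "L2 f \<Longrightarrow> f \<in> borel_measurable borel"
  by (simp add: L2_def)

lemma L2_integrable: "L2 f \<Longrightarrow> integrable lborel (\<lambda>x. (norm (f x))\<^sup>2)"
  by (simp add: L2_def)

lemma L2_dominated:
  assumes g: "L2 g" and f: "f \<in> borel_measurable borel"
    and le: "AE x in lborel. norm (f x) \<le> C * norm (g x)"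
  shows "L2 f"
proof -
  have "integrable lborel (\<lambda>x. C\<^sup>2 * (norm (g x))\<^sup>2)"
    using L2_integrable[OF g] by simp
  then have "integrable lborel (\<lambda>x. (norm (f x))\<^sup>2)"
  proof (rule Bochner_Integration.integrable_bound)
    show "AE x in lborel. norm ((norm (f x))\<^sup>2) \<le> norm (C\<^sup>2 * (norm (g x))\<^sup>2)"
      using le
    proof eventually_elim
      case (elim x)
      then have "(norm (f x))\<^sup>2 \<le> (C * norm (g x))\<^sup>2" by (intro power_mono) auto
      then show ?case by (simp add: power_mult_distrib)
    qed
  qed (use f in measurable)
  then show ?thesis using f by (simp add: L2_def)
qed

lemma L2_zero [simp]: "L2 (\<lambda>x. 0)"
  by (simp add: L2_def)

lemma L2_add:
  assumes f: "L2 f" and g: "L2 g"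
  shows "L2 (\<lambda>x. f x + g x)"
proof -
  have [measurable]: "f \<in> borel_measurable borel" "g \<in> borel_measurable borel"
    using f g by (auto dest: L2_borel)
  have "integrable lborel (\<lambda>x. 2 * (norm (f x))\<^sup>2 + 2 * (norm (g x))\<^sup>2)"
    using L2_integrable[OF f] L2_integrable[OF g] by simp
  then have "integrable lborel (\<lambda>x. (norm (f x + g x))\<^sup>2)"
  proof (rule Bochner_Integration.integrable_bound)
    have "(norm (f x + g x))\<^sup>2 \<le> 2 * (norm (f x))\<^sup>2 + 2 * (norm (g x))\<^sup>2" for x
    proof -
      have "(norm (f x + g x))\<^sup>2 \<le> (norm (f x) + norm (g x))\<^sup>2"
        by (intro power_mono norm_triangle_ineq) auto
      also have "\<dots> \<le> 2 * (norm (f x))\<^sup>2 + 2 * (norm (g x))\<^sup>2"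
        using sum_squares_bound[of "norm (f x)" "norm (g x)"] by (simp add: power2_sum)
      finally show ?thesis .
    qed
    then show "AE x in lborel. norm ((norm (f x + g x))\<^sup>2) \<le> norm (2 * (norm (f x))\<^sup>2 + 2 * (norm (g x))\<^sup>2)"
      by simp
  qed measurable
  then show ?thesis by (simp add: L2_def)
qed

lemma L2_scaleR: "L2 f \<Longrightarrow> L2 (\<lambda>x. c *\<^sub>R f x)"
  by (rule L2_dominated[of f _ "\<bar>c\<bar>"]) (auto dest: L2_borel)

lemma L2_minus: "L2 f \<Longrightarrow> L2 (\<lambda>x. - f x)"
  using L2_scaleR[of f "-1"] by simp

lemma L2_diff: "L2 f \<Longrightarrow> L2 g \<Longrightarrow> L2 (\<lambda>x. f x - g x)"
  using L2_add[of f "\<lambda>x. - g x"] L2_minus[of g] by simp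

lemma L2_norm_fun: "L2 f \<Longrightarrow> L2 (\<lambda>x. norm (f x))"
  by (rule L2_dominated[of f _ 1]) (auto dest: L2_borel)

lemma L2_integrable_mult:
  assumes f: "L2 f" and g: "L2 g"
  shows "integrable lborel (\<lambda>x. norm (f x) * norm (g x))"
proof -
  have [measurable]: "f \<in> borel_measurable borel" "g \<in> borel_measurable borel"
    using f g by (auto dest: L2_borel)
  have "integrable lborel (\<lambda>x. (norm (f x))\<^sup>2 + (norm (g x))\<^sup>2)"
    using L2_integrable[OF f] L2_integrable[OF g] by simp
  then show ?thesis
  proof (rule Bochner_Integration.integrable_bound)
    have "norm (f x) * norm (g x) \<le> (norm (f x))\<^sup>2 + (norm (g x))\<^sup>2" for x
    proof -
      have "norm (f x) * norm (g x) \<le> 2 * norm (f x) * norm (g x)" by (simp add: mult.assoc)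
      also have "\<dots> \<le> (norm (f x))\<^sup>2 + (norm (g x))\<^sup>2" by (rule sum_squares_bound)
      finally show ?thesis .
    qed
    then show "AE x in lborel. norm (norm (f x) * norm (g x)) \<le> norm ((norm (f x))\<^sup>2 + (norm (g x))\<^sup>2)"
      by simp
  qed measurable
qed

lemma L2_integrable_inner:
  assumes f: "L2 f" and g: "L2 g"
  shows "integrable lborel (\<lambda>x. inner (f x) (g x))"
proof (rule Bochner_Integration.integrable_bound[OF L2_integrable_mult[OF f g]])
  show "(\<lambda>x. inner (f x) (g x)) \<in> borel_measurable lborel"
    using f g by (auto dest!: L2_borel)
qed (simp add: Cauchy_Schwarz_ineq2)

\<comment> \<open>The relation is a partial equivalence: a function is related to itself exactly
  when it is square integrable. Membership in L^2 is thus built into the type, and equality in the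
  type is equality almost everywhere.\<close>
quotient_type (overloaded) ('a, 'b) lsq = "'a::euclidean_space \<Rightarrow> 'b::euclidean_space" /
  partial: "\<lambda>f g. L2 f \<and> L2 g \<and> (AE x in lborel. f x = g x)"
  morphisms rep lsq
proof (rule part_equivpI)
  show "\<exists>f::'a\<Rightarrow>'b. L2 f \<and> L2 f \<and> (AE x in lborel. f x = f x)"
    by (rule exI[of _ "\<lambda>_. 0"]) simp
  show "symp (\<lambda>f g::'a\<Rightarrow>'b. L2 f \<and> L2 g \<and> (AE x in lborel. f x = g x))"
    by (auto simp: symp_def elim!: eventually_mono)
  show "transp (\<lambda>f g::'a\<Rightarrow>'b. L2 f \<and> L2 g \<and> (AE x in lborel. f x = g x))"
  proof (rule transpI)
    fix f g h :: "'a \<Rightarrow> 'b"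
    assume fg: "L2 f \<and> L2 g \<and> (AE x in lborel. f x = g x)"
      and gh: "L2 g \<and> L2 h \<and> (AE x in lborel. g x = h x)"
    have "AE x in lborel. f x = h x"
      using fg[THEN conjunct2, THEN conjunct2] gh[THEN conjunct2, THEN conjunct2]
      by eventually_elim simp
    then show "L2 f \<and> L2 h \<and> (AE x in lborel. f x = h x)" using fg gh by simp
  qed
qed

lemma L2_rep [simp]: "L2 (rep u)"
  using Quotient_rep_reflp[OF Quotient_lsq] by blast

lemma rep_borel [measurable]: "rep u \<in> borel_measurable borel"
  by (rule L2_borel) simp

lemma AE_rep_lsq: "L2 f \<Longrightarrow> AE x in lborel. rep (lsq f) x = f x"
  using Quotient_rep_abs[OF Quotient_lsq, of f] by simp

lemma lsq_eqI: "AE x in lborel. rep u x = rep v x \<Longrightarrow> u = v"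
  using Quotient_rel_rep[OF Quotient_lsq, of u v] by simp

lemma lsq_cong: "L2 f \<Longrightarrow> L2 g \<Longrightarrow> AE x in lborel. f x = g x \<Longrightarrow> lsq f = lsq g"
  using Quotient_rel_abs[OF Quotient_lsq, of f g] by simp

lemma lsq_rep [simp]: "lsq (rep u) = u"
  by (rule Quotient_abs_rep[OF Quotient_lsq])

lemma lsq_eq_iff: "L2 f \<Longrightarrow> L2 g \<Longrightarrow> lsq f = lsq g \<longleftrightarrow> (AE x in lborel. f x = g x)"
  using Quotient_rel[OF Quotient_lsq, of f g] by auto

text \<open>Operations act on chosen representatives and pass back to classes, so on
  \<open>rep\<close> they are known only almost everywhere. The \<open>AE_rep\<close> facts are the
  interface: each vector space law becomes a pointwise identity on a set of full measure.\<close>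

instantiation lsq :: (euclidean_space, euclidean_space) real_inner
begin

definition "0 = lsq (\<lambda>x. 0)"
definition "u + v = lsq (\<lambda>x. rep u x + rep v x)"
definition "u - v = lsq (\<lambda>x. rep u x - rep v x)"
definition "- u = lsq (\<lambda>x. - rep u x)"
definition "c *\<^sub>R u = lsq (\<lambda>x. c *\<^sub>R rep u x)"
definition "inner u v = (\<integral>x. inner (rep u x) (rep v x) \<partial>lborel)"
definition "norm (u::('a,'b) lsq) = sqrt (inner u u)"
definition "sgn (u::('a,'b) lsq) = inverse (norm u) *\<^sub>R u"
definition "dist (u::('a,'b) lsq) v = norm (u - v)"
definition "uniformity = (INF e\<in>{0 <..}. principal {(u::('a,'b) lsq, v). dist u v < e})"
definition "open (U :: ('a,'b) lsq set) \<longleftrightarrow> (\<forall>x\<in>U. eventually (\<lambda>(x', y). x' = x \<longrightarrow> y \<in> U) uniformity)"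

lemma AE_rep_zero: "AE x in lborel. rep (0::('a,'b) lsq) x = 0"
  unfolding zero_lsq_def by (rule AE_rep_lsq) simp

lemma AE_rep_add: "AE x in lborel. rep (u + v :: ('a,'b) lsq) x = rep u x + rep v x"
  unfolding plus_lsq_def by (rule AE_rep_lsq) (simp add: L2_add)

lemma AE_rep_diff: "AE x in lborel. rep (u - v :: ('a,'b) lsq) x = rep u x - rep v x"
  unfolding minus_lsq_def by (rule AE_rep_lsq) (simp add: L2_diff)

lemma AE_rep_uminus: "AE x in lborel. rep (- u :: ('a,'b) lsq) x = - rep u x"
  unfolding uminus_lsq_def by (rule AE_rep_lsq) (simp add: L2_minus)

lemma AE_rep_scaleR: "AE x in lborel. rep (c *\<^sub>R u :: ('a,'b) lsq) x = c *\<^sub>R rep u x"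
  unfolding scaleR_lsq_def by (rule AE_rep_lsq) (simp add: L2_scaleR)

instance
proof
  fix u v w :: "('a,'b) lsq" and a b :: real
  show "u + v + w = u + (v + w)"
    by (rule lsq_eqI) (use AE_rep_add[of "u+v" w] AE_rep_add[of u v] AE_rep_add[of u "v+w"] AE_rep_add[of v w] in
      \<open>eventually_elim, simp\<close>)
  show "u + v = v + u"
    by (simp add: plus_lsq_def add.commute)
  show "0 + u = u"
    by (rule lsq_eqI) (use AE_rep_add[of 0 u] AE_rep_zero in \<open>eventually_elim, simp\<close>)
  show "- u + u = 0"
    by (rule lsq_eqI) (use AE_rep_add[of "-u" u] AE_rep_uminus[of u] AE_rep_zero in \<open>eventually_elim, simp\<close>)
  show "u - v = u + - v"
    by (rule lsq_eqI) (use AE_rep_add[of u "-v"] AE_rep_uminus[of v] AE_rep_diff[of u v] in \<open>eventually_elim, simp\<close>)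
  show "a *\<^sub>R (u + v) = a *\<^sub>R u + a *\<^sub>R v"
    by (rule lsq_eqI) (use AE_rep_add[of u v] AE_rep_scaleR[of a "u+v"] AE_rep_scaleR[of a u] AE_rep_scaleR[of a v]
      AE_rep_add[of "a *\<^sub>R u" "a *\<^sub>R v"] in \<open>eventually_elim, simp add: algebra_simps\<close>)
  show "(a + b) *\<^sub>R u = a *\<^sub>R u + b *\<^sub>R u"
    by (rule lsq_eqI) (use AE_rep_scaleR[of "a+b" u] AE_rep_scaleR[of a u] AE_rep_scaleR[of b u]
      AE_rep_add[of "a *\<^sub>R u" "b *\<^sub>R u"] in \<open>eventually_elim, simp add: algebra_simps\<close>)
  show "a *\<^sub>R b *\<^sub>R u = (a * b) *\<^sub>R u"
    by (rule lsq_eqI) (use AE_rep_scaleR[of a "b *\<^sub>R u"] AE_rep_scaleR[of b u] AE_rep_scaleR[of "a*b" u]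
       in \<open>eventually_elim, simp\<close>)
  show "1 *\<^sub>R u = u"
    by (rule lsq_eqI) (use AE_rep_scaleR[of 1 u] in \<open>eventually_elim, simp\<close>)
  show "inner u v = inner v u"
    by (simp add: inner_lsq_def inner_commute)
  show "inner (u + v) w = inner u w + inner v w"
  proof -
    have "inner (u + v) w = (\<integral>x. inner (rep u x) (rep w x) + inner (rep v x) (rep w x) \<partial>lborel)"
      unfolding inner_lsq_def
      by (rule integral_cong_AE, measurable)
        (use AE_rep_add[of u v] in \<open>eventually_elim, simp add: inner_add_left\<close>)
    then show ?thesis
      by (simp add: inner_lsq_def L2_integrable_inner)
  qed
  show "inner (a *\<^sub>R u) v = a * inner u v"
  proof -
    have "inner (a *\<^sub>R u) v = (\<integral>x. a * inner (rep u x) (rep v x) \<partial>lborel)"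
      unfolding inner_lsq_def
      by (rule integral_cong_AE, measurable)
        (use AE_rep_scaleR[of a u] in \<open>eventually_elim, simp\<close>)
    then show ?thesis
      by (simp add: inner_lsq_def)
  qed
  show "0 \<le> inner u u"
    unfolding inner_lsq_def by (rule integral_nonneg_AE) simp
  show "inner u u = 0 \<longleftrightarrow> u = 0"
  proof -
    have "inner u u = 0 \<longleftrightarrow> (AE x in lborel. inner (rep u x) (rep u x) = 0)"
      unfolding inner_lsq_def by (rule integral_nonneg_eq_0_iff_AE) (simp_all add: L2_integrable_inner)
    also have "\<dots> \<longleftrightarrow> (AE x in lborel. rep u x = 0)" by simp
    also have "\<dots> \<longleftrightarrow> u = 0"
      unfolding zero_lsq_def using lsq_eq_iff[of "rep u" "\<lambda>x. 0"] by simp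
    finally show ?thesis .
  qed
qed (simp_all add: norm_lsq_def sgn_lsq_def dist_lsq_def uniformity_lsq_def open_lsq_def)

end

lemma norm_lsq_eq: "norm u = L2_norm (rep u)"
  by (simp add: norm_lsq_def inner_lsq_def L2_norm_def power2_norm_eq_inner)

lemma L2_norm_cong_AE:
  assumes "L2 f" "L2 g" "AE x in lborel. f x = g x"
  shows "L2_norm f = L2_norm g"
  unfolding L2_norm_def
  by (intro arg_cong[where f=sqrt] integral_cong_AE) (use assms in \<open>auto dest: L2_borel\<close>)

lemma norm_lsq: "L2 f \<Longrightarrow> norm (lsq f) = L2_norm f"
  unfolding norm_lsq_eq by (rule L2_norm_cong_AE) (auto simp: AE_rep_lsq)

lemma lsq_add: "L2 f \<Longrightarrow> L2 g \<Longrightarrow> lsq f + lsq g = lsq (\<lambda>x. f x + g x)"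
  unfolding plus_lsq_def
proof (rule lsq_cong)
  assume f: "L2 f" and g: "L2 g"
  show "AE x in lborel. rep (lsq f) x + rep (lsq g) x = f x + g x"
    using AE_rep_lsq[OF f] AE_rep_lsq[OF g] by eventually_elim simp
qed (simp_all add: L2_add)

lemma lsq_diff: "L2 f \<Longrightarrow> L2 g \<Longrightarrow> lsq f - lsq g = lsq (\<lambda>x. f x - g x)"
  unfolding minus_lsq_def
proof (rule lsq_cong)
  assume f: "L2 f" and g: "L2 g"
  show "AE x in lborel. rep (lsq f) x - rep (lsq g) x = f x - g x"
    using AE_rep_lsq[OF f] AE_rep_lsq[OF g] by eventually_elim simp
qed (simp_all add: L2_diff)

lemma lsq_scaleR: "L2 f \<Longrightarrow> c *\<^sub>R lsq f = lsq (\<lambda>x. c *\<^sub>R f x)"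
  unfolding scaleR_lsq_def
proof (rule lsq_cong)
  assume f: "L2 f"
  show "AE x in lborel. c *\<^sub>R rep (lsq f) x = c *\<^sub>R f x"
    using AE_rep_lsq[OF f] by eventually_elim simp
qed (simp_all add: L2_scaleR)

lemma L2_norm_nonneg [simp]: "0 \<le> L2_norm f"
  by (simp add: L2_norm_def)

lemma L2_norm_mono:
  assumes g: "L2 g" and f: "f \<in> borel_measurable borel" and C: "0 \<le> C"
    and le: "AE x in lborel. norm (f x) \<le> C * norm (g x)"
  shows "L2_norm f \<le> C * L2_norm g"
proof -
  have "(\<integral>x. (norm (f x))\<^sup>2 \<partial>lborel) \<le> (\<integral>x. C\<^sup>2 * (norm (g x))\<^sup>2 \<partial>lborel)"
  proof (rule integral_mono_AE)
    show "AE x in lborel. (norm (f x))\<^sup>2 \<le> C\<^sup>2 * (norm (g x))\<^sup>2"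
      using le
    proof eventually_elim
      case (elim x)
      then have "(norm (f x))\<^sup>2 \<le> (C * norm (g x))\<^sup>2" by (intro power_mono) auto
      then show ?case by (simp add: power_mult_distrib)
    qed
  qed (use L2_integrable[OF g] L2_integrable[OF L2_dominated[OF g f le]] in auto)
  then have "L2_norm f \<le> sqrt (C\<^sup>2 * (\<integral>x. (norm (g x))\<^sup>2 \<partial>lborel))"
    unfolding L2_norm_def by simp
  then show ?thesis
    using C by (simp add: L2_norm_def real_sqrt_mult)
qed

section \<open>Cauchy-Schwarz, Fatou and completeness of L^2\<close>

lemma L2_norm_power2: "(L2_norm f)\<^sup>2 = (\<integral>x. (norm (f x))\<^sup>2 \<partial>lborel)"
  by (simp add: L2_norm_def)

lemma L2_nn_integral:
  assumes "L2 f" shows "(\<integral>\<^sup>+x. ennreal ((norm (f x))\<^sup>2) \<partial>lborel) = ennreal ((L2_norm f)\<^sup>2)"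
  unfolding L2_norm_power2 by (rule nn_integral_eq_integral) (auto simp: L2_integrable assms)

text \<open>The abstract inequality is applied to the classes of the real functions
  \<open>norm (f x)\<close> and \<open>norm (g x)\<close>, so \<open>f\<close> and \<open>g\<close>
  may take values in different spaces.\<close>

lemma L2_Cauchy_Schwarz:
  assumes f: "L2 f" and g: "L2 g"
  shows "(\<integral>x. norm (f x) * norm (g x) \<partial>lborel) \<le> L2_norm f * L2_norm g"
proof -
  let ?f = "lsq (\<lambda>x. norm (f x))" and ?g = "lsq (\<lambda>x. norm (g x))"
  have [measurable]: "f \<in> borel_measurable borel" "g \<in> borel_measurable borel"
    using f g by (auto dest: L2_borel)
  have "(\<integral>x. norm (f x) * norm (g x) \<partial>lborel) = inner ?f ?g"
    unfolding inner_lsq_def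
    by (rule integral_cong_AE, measurable)
      (use AE_rep_lsq[OF L2_norm_fun[OF f]] AE_rep_lsq[OF L2_norm_fun[OF g]] in
        \<open>eventually_elim, simp add: mult.commute\<close>)
  also have "\<dots> \<le> norm ?f * norm ?g" by (rule norm_cauchy_schwarz)
  also have "\<dots> = L2_norm f * L2_norm g"
    by (simp add: norm_lsq L2_norm_fun f g L2_norm_def)
  finally show ?thesis .
qed

text \<open>Fatou's lemma for squared norms. Square integrability and the bound come out together,
  as completeness requires: the limit is at first known only pointwise.\<close>

lemma L2_pointwise_limit:
  fixes y :: "nat \<Rightarrow> 'a::euclidean_space \<Rightarrow> 'b::euclidean_space"
  assumes y: "\<And>n. L2 (y n)" and f: "f \<in> borel_measurable borel"
    and lim: "AE x in lborel. (\<lambda>n. y n x) \<longlonglongrightarrow> f x"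
    and e: "\<forall>\<^sub>F n in sequentially. L2_norm (y n) \<le> e"
  shows "L2 f \<and> L2_norm f \<le> e"
proof -
  have [measurable]: "y n \<in> borel_measurable borel" "f \<in> borel_measurable borel" for n
    using y f by (auto dest: L2_borel)
  have e0: "0 \<le> e"
    using eventually_happens'[OF sequentially_bot e] L2_norm_nonneg order_trans by blast
  have "(\<integral>\<^sup>+x. ennreal ((norm (f x))\<^sup>2) \<partial>lborel)
      = (\<integral>\<^sup>+x. liminf (\<lambda>n. ennreal ((norm (y n x))\<^sup>2)) \<partial>lborel)"
  proof (rule nn_integral_cong_AE)
    show "AE x in lborel. ennreal ((norm (f x))\<^sup>2) = liminf (\<lambda>n. ennreal ((norm (y n x))\<^sup>2))"
      using lim
    proof eventually_elim
      case (elim x)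
      then have "(\<lambda>n. ennreal ((norm (y n x))\<^sup>2)) \<longlonglongrightarrow> ennreal ((norm (f x))\<^sup>2)"
        by (intro tendsto_ennrealI tendsto_intros)
      then show ?case by (rule lim_imp_Liminf[symmetric, rotated]) simp
    qed
  qed
  also have "\<dots> \<le> liminf (\<lambda>n. \<integral>\<^sup>+x. ennreal ((norm (y n x))\<^sup>2) \<partial>lborel)"
    by (rule nn_integral_liminf) measurable
  also have "\<dots> = liminf (\<lambda>n. ennreal ((L2_norm (y n))\<^sup>2))"
    by (simp add: L2_nn_integral y)
  also have "\<dots> \<le> liminf (\<lambda>n::nat. ennreal (e\<^sup>2))"
    by (rule Liminf_mono) (use e in \<open>auto elim!: eventually_mono intro!: ennreal_leI power_mono\<close>)
  also have "\<dots> = ennreal (e\<^sup>2)" by (simp add: Liminf_const)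
  finally have le: "(\<integral>\<^sup>+x. ennreal ((norm (f x))\<^sup>2) \<partial>lborel) \<le> ennreal (e\<^sup>2)" .
  have "integrable lborel (\<lambda>x. (norm (f x))\<^sup>2)"
    by (rule integrableI_bounded) (use le in \<open>auto simp: order.strict_trans1\<close>)
  then have L: "L2 f" by (simp add: L2_def)
  have "(L2_norm f)\<^sup>2 \<le> e\<^sup>2"
    using le by (simp add: L2_nn_integral L)
  then show ?thesis using L e0 by (simp add: power2_le_iff_abs_le)
qed

text \<open>Riesz-Fischer: a subsequence whose increments have norm at most (1/2)^k converges at
  almost every point, because the series of its increments converges absolutely there; Fatou's lemma
  upgrades this to convergence in norm.\<close>

instance lsq :: (euclidean_space, euclidean_space) banach
proof
  fix X :: "nat \<Rightarrow> ('a, 'b) lsq"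
  assume X: "Cauchy X"
  define P where "P k M \<longleftrightarrow> (\<forall>m\<ge>M. \<forall>n\<ge>M. norm (X m - X n) < (1/2)^k)" for k and M :: nat
  have exP: "\<exists>M. P k M" for k
    using X unfolding Cauchy_iff P_def by (meson zero_less_power half_gt_zero zero_less_one)
  have "\<exists>r. \<forall>k. P k (r k) \<and> r k < r (Suc k)"
  proof (rule dependent_nat_choice)
    fix x k
    obtain M where M: "P (Suc k) M" using exP by blast
    then have "P (Suc k) (max M (Suc x))" by (simp add: P_def)
    then show "\<exists>y. P (Suc k) y \<and> x < y" by (intro exI[of _ "max M (Suc x)"]) auto
  qed (rule exP)
  then obtain r where r: "\<And>k. r k < r (Suc k)"
    and rX: "\<And>k m n. m \<ge> r k \<Longrightarrow> n \<ge> r k \<Longrightarrow> norm (X m - X n) < (1/2)^k"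
    unfolding P_def by blast
  have mono: "strict_mono r" using r by (simp add: strict_mono_Suc_iff)
  define y where "y k = rep (X (r k))" for k
  have [measurable]: "y k \<in> borel_measurable borel" for k by (simp add: y_def)
  define d where "d k x = norm (y (Suc k) x - y k x)" for k x
  have L2d: "L2 (d k)" for k unfolding d_def y_def by (intro L2_norm_fun L2_diff) auto
  have [measurable]: "d k \<in> borel_measurable borel" for k using L2d by (rule L2_borel)
  have nd: "norm (lsq (d k)) \<le> (1/2)^k" for k
  proof -
    have "norm (lsq (d k)) = L2_norm (\<lambda>x. y (Suc k) x - y k x)"
      by (subst norm_lsq[OF L2d]) (simp add: L2_norm_def d_def)
    also have "\<dots> = norm (lsq (y (Suc k)) - lsq (y k))"
      by (subst lsq_diff) (auto simp: y_def norm_lsq L2_diff)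
    also have "\<dots> \<le> (1/2)^k"
      using rX[of k "r (Suc k)" "r k"] r[of k] by (simp add: y_def)
    finally show ?thesis .
  qed
  have L2sum: "L2 (\<lambda>x. \<Sum>k<N. d k x) \<and> L2_norm (\<lambda>x. \<Sum>k<N. d k x) \<le> 2" for N
  proof -
    have *: "L2 (\<lambda>x. \<Sum>k<N. d k x) \<and> lsq (\<lambda>x. \<Sum>k<N. d k x) = (\<Sum>k<N. lsq (d k))"
    proof (induction N)
      case (Suc N)
      then have "(\<Sum>k<Suc N. lsq (d k)) = lsq (\<lambda>x. \<Sum>k<N. d k x) + lsq (d N)" by simp
      also have "\<dots> = lsq (\<lambda>x. \<Sum>k<Suc N. d k x)"
        using Suc by (subst lsq_add) (simp_all add: L2d)
      finally show ?case using Suc by (simp add: L2_add L2d)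
    qed (simp add: zero_lsq_def)
    have "norm (\<Sum>k<N. lsq (d k)) \<le> (\<Sum>k<N. (1/2)^k)"
      by (rule sum_norm_le) (use nd in auto)
    also have "\<dots> \<le> 2" by (simp add: sum_gp_strict)
    finally show ?thesis using * norm_lsq by metis
  qed
  \<comment> \<open>By monotone convergence the integral of the supremum is at most 2^2, where 2 is
    the sum of the geometric series; hence the increments are summable at almost every
    point.\<close>
  have "AE x in lborel. (SUP N. ennreal ((\<Sum>k<N. d k x)\<^sup>2)) \<noteq> \<infinity>"
  proof (rule nn_integral_noteq_infinite)
    have "(\<integral>\<^sup>+x. (SUP N. ennreal ((\<Sum>k<N. d k x)\<^sup>2)) \<partial>lborel) = (SUP N. \<integral>\<^sup>+x. ennreal ((\<Sum>k<N. d k x)\<^sup>2) \<partial>lborel)"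
      by (rule nn_integral_monotone_convergence_SUP)
        (auto simp: incseq_def le_fun_def d_def intro!: ennreal_leI power_mono sum_mono2 sum_nonneg)
    also have "\<dots> \<le> 4"
    proof (rule SUP_least)
      fix N
      have "(\<integral>\<^sup>+x. ennreal ((\<Sum>k<N. d k x)\<^sup>2) \<partial>lborel) = ennreal ((L2_norm (\<lambda>x. \<Sum>k<N. d k x))\<^sup>2)"
        using L2_nn_integral[of "\<lambda>x. \<Sum>k<N. d k x"] L2sum[of N] by simp
      also have "\<dots> \<le> ennreal (2\<^sup>2)"
        using L2sum[of N] by (intro ennreal_leI power_mono) auto
      finally show "(\<integral>\<^sup>+x. ennreal ((\<Sum>k<N. d k x)\<^sup>2) \<partial>lborel) \<le> 4" by simp
    qed
    also have "\<dots> < \<infinity>" by simp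
    finally show "(\<integral>\<^sup>+x. (SUP N. ennreal ((\<Sum>k<N. d k x)\<^sup>2)) \<partial>lborel) \<noteq> \<infinity>" by simp
  qed measurable
  then have conv: "AE x in lborel. (\<lambda>k. y k x) \<longlonglongrightarrow> lim (\<lambda>k. y k x)"
  proof eventually_elim
    case (elim x)
    then obtain c where c: "0 \<le> c" "(SUP N. ennreal ((\<Sum>k<N. d k x)\<^sup>2)) = ennreal c"
      by (metis ennreal_cases infinity_ennreal_def)
    have "(\<Sum>k<N. d k x) \<le> sqrt c" for N
    proof -
      have "ennreal ((\<Sum>k<N. d k x)\<^sup>2) \<le> ennreal c"
        unfolding c(2)[symmetric] by (rule SUP_upper) simp
      then show ?thesis using c(1) by (simp add: real_le_rsqrt)
    qed
    then have "summable (\<lambda>k. d k x)"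
      by (intro summableI_nonneg_bounded) (auto simp: d_def)
    then have "summable (\<lambda>k. y (Suc k) x - y k x)"
      by (intro summable_norm_cancel[of "\<lambda>k. y (Suc k) x - y k x"]) (simp add: d_def)
    then have "convergent (\<lambda>n. y n x - y 0 x)"
      by (simp add: summable_iff_convergent sum_lessThan_telescope[of "\<lambda>n. y n x"])
    then have "convergent (\<lambda>n. (y n x - y 0 x) + y 0 x)"
      by (intro convergent_add convergent_const)
    then show ?case by (simp add: convergent_LIMSEQ_iff)
  qed
  define f where "f x = lim (\<lambda>k. y k x)" for x
  have [measurable]: "f \<in> borel_measurable borel"
    unfolding f_def by measurable
  \<comment> \<open>With \<open>n\<close> fixed, Fatou's lemma is applied to the differences
    \<open>y m x - y n x\<close> as \<open>m\<close> grows.\<close>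
  have est: "L2 (\<lambda>x. f x - y n x) \<and> L2_norm (\<lambda>x. f x - y n x) \<le> (1/2)^n" for n
  proof (rule L2_pointwise_limit)
    show "L2 (\<lambda>x. y m x - y n x)" for m unfolding y_def by (intro L2_diff) auto
    show "AE x in lborel. (\<lambda>m. y m x - y n x) \<longlonglongrightarrow> f x - y n x"
      using conv unfolding f_def[symmetric] by eventually_elim (intro tendsto_intros)
    show "\<forall>\<^sub>F m in sequentially. L2_norm (\<lambda>x. y m x - y n x) \<le> (1/2)^n"
      using eventually_ge_at_top[of n]
    proof eventually_elim
      case (elim m)
      have "L2_norm (\<lambda>x. y m x - y n x) = norm (lsq (y m) - lsq (y n))"
        by (subst lsq_diff) (auto simp: y_def norm_lsq L2_diff)
      also have "\<dots> = norm (X (r m) - X (r n))" by (simp add: y_def)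
      also have "\<dots> \<le> (1/2)^n"
        using rX[of n "r m" "r n"] strict_mono_less_eq[OF mono] elim by (simp add: less_imp_le)
      finally show ?case .
    qed
  qed measurable
  have L2f: "L2 f"
    using L2_add[of "\<lambda>x. f x - y 0 x" "y 0"] est[of 0] by (simp add: y_def)
  have "(X \<circ> r) \<longlonglongrightarrow> lsq f"
  proof (rule LIM_zero_cancel, rule Lim_null_comparison)
    have "norm ((X \<circ> r) n - lsq f) \<le> (1/2)^n" for n
    proof -
      have "norm ((X \<circ> r) n - lsq f) = norm (lsq f - lsq (y n))"
        by (simp add: y_def norm_minus_commute)
      also have "\<dots> = L2_norm (\<lambda>x. f x - y n x)"
        using est[of n] by (subst lsq_diff) (auto simp: y_def norm_lsq L2f)
      finally show ?thesis using est[of n] by simp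
    qed
    then show "\<forall>\<^sub>F n in sequentially. norm ((X \<circ> r) n - lsq f) \<le> (1/2)^n" by simp
    show "(\<lambda>n. (1/2)^n :: real) \<longlonglongrightarrow> 0" by (intro LIMSEQ_power_zero) simp
  qed
  then show "convergent X"
    using Cauchy_converges_subseq[OF X mono] by (auto simp: convergent_def)
qed

text \<open>Dominated convergence for the squared distance, which is at most 2|h|^2 + 2|g|^2. Limits
  of indicators, translates, difference quotients and cut-offs are obtained from it.\<close>

lemma lsq_tendsto_dominated:
  assumes f: "\<And>n. L2 (f n)" and g: "L2 g" and h: "L2 h"
    and dom: "\<And>n. AE x in lborel. norm (f n x) \<le> norm (h x)"
    and lim: "AE x in lborel. (\<lambda>n. f n x) \<longlonglongrightarrow> g x"
  shows "(\<lambda>n. lsq (f n)) \<longlonglongrightarrow> lsq g"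
proof -
  have [measurable]: "f n \<in> borel_measurable borel" "g \<in> borel_measurable borel" "h \<in> borel_measurable borel" for n
    using f g h by (auto dest: L2_borel)
  have "(\<lambda>n. \<integral>x. (norm (f n x - g x))\<^sup>2 \<partial>lborel) \<longlonglongrightarrow> (\<integral>x. 0 \<partial>(lborel::'a measure))"
  proof (rule integral_dominated_convergence[where w="\<lambda>x. 2 * (norm (h x))\<^sup>2 + 2 * (norm (g x))\<^sup>2"])
    show "integrable lborel (\<lambda>x. 2 * (norm (h x))\<^sup>2 + 2 * (norm (g x))\<^sup>2)"
      using L2_integrable[OF h] L2_integrable[OF g] by simp
    show "AE x in lborel. (\<lambda>n. (norm (f n x - g x))\<^sup>2) \<longlonglongrightarrow> 0"
      using lim
    proof eventually_elim
      case (elim x)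
      then have "(\<lambda>n. norm (f n x - g x)) \<longlonglongrightarrow> 0" by (simp add: LIM_zero tendsto_norm_zero)
      then show ?case using tendsto_power[of "\<lambda>n. norm (f n x - g x)" 0 sequentially 2] by simp
    qed
    show "AE x in lborel. norm ((norm (f n x - g x))\<^sup>2) \<le> 2 * (norm (h x))\<^sup>2 + 2 * (norm (g x))\<^sup>2" for n
      using dom[of n]
    proof eventually_elim
      case (elim x)
      have "(norm (f n x - g x))\<^sup>2 \<le> (norm (h x) + norm (g x))\<^sup>2"
        using elim norm_triangle_ineq4[of "f n x" "g x"] by (intro power_mono) auto
      also have "\<dots> \<le> 2 * (norm (h x))\<^sup>2 + 2 * (norm (g x))\<^sup>2"
        using sum_squares_bound[of "norm (h x)" "norm (g x)"] by (simp add: power2_sum)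
      finally show ?case by simp
    qed
  qed measurable
  then have "(\<lambda>n. sqrt (\<integral>x. (norm (f n x - g x))\<^sup>2 \<partial>lborel)) \<longlonglongrightarrow> sqrt 0"
    by (intro tendsto_real_sqrt) simp
  then have "(\<lambda>n. norm (lsq (f n) - lsq g)) \<longlonglongrightarrow> 0"
    using f g by (simp add: lsq_diff norm_lsq L2_diff L2_norm_def)
  then show ?thesis by (rule tendsto_norm_zero_cancel[THEN LIM_zero_cancel])
qed

subsection \<open>Pointwise linear operators\<close>

text \<open>Measurability is asked for fixed vectors \<open>v\<close> only; linearity and a finite
  basis then give it for \<open>M x (f x)\<close>. The bound holds almost everywhere because
  absorptions are only essentially bounded.\<close>

definition pw_bounded :: "('a::euclidean_space \<Rightarrow> 'b::euclidean_space \<Rightarrow> 'c::euclidean_space) \<Rightarrow> real \<Rightarrow> bool" where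
  "pw_bounded M C \<longleftrightarrow> 0 \<le> C \<and> (\<forall>x. linear (M x)) \<and> (\<forall>v. (\<lambda>x. M x v) \<in> borel_measurable borel) \<and>
     (AE x in lborel. \<forall>v. norm (M x v) \<le> C * norm v)"

definition pw :: "('a::euclidean_space \<Rightarrow> 'b::euclidean_space \<Rightarrow> 'c::euclidean_space) \<Rightarrow> ('a, 'b) lsq \<Rightarrow> ('a, 'c) lsq" where
  "pw M u = lsq (\<lambda>x. M x (rep u x))"

lemma pw_bounded_measurable:
  assumes "pw_bounded M C" and [measurable]: "f \<in> borel_measurable borel"
  shows "(\<lambda>x. M x (f x)) \<in> borel_measurable borel"
proof -
  have "(\<lambda>x. M x (f x)) = (\<lambda>x. \<Sum>b\<in>Basis. (f x \<bullet> b) *\<^sub>R M x b)"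
  proof
    fix x
    have "linear (M x)" using assms by (simp add: pw_bounded_def)
    then have "M x (\<Sum>b\<in>Basis. (f x \<bullet> b) *\<^sub>R b) = (\<Sum>b\<in>Basis. (f x \<bullet> b) *\<^sub>R M x b)"
      by (simp add: linear_sum linear_scale)
    then show "M x (f x) = (\<Sum>b\<in>Basis. (f x \<bullet> b) *\<^sub>R M x b)" by (simp add: euclidean_representation)
  qed
  moreover have [measurable]: "(\<lambda>x. M x b) \<in> borel_measurable borel" for b
    using assms by (simp add: pw_bounded_def)
  ultimately show ?thesis by simp
qed

lemma pw_bounded_L2: "pw_bounded M C \<Longrightarrow> L2 f \<Longrightarrow> L2 (\<lambda>x. M x (f x))"
  by (rule L2_dominated[of f _ C]) (auto simp: pw_bounded_measurable L2_borel, auto simp: pw_bounded_def elim: eventually_mono)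

lemma AE_rep_pw: "pw_bounded M C \<Longrightarrow> AE x in lborel. rep (pw M u) x = M x (rep u x)"
  unfolding pw_def by (rule AE_rep_lsq) (simp add: pw_bounded_L2)

lemma norm_pw: assumes "pw_bounded M C" shows "norm (pw M u) \<le> C * norm u"
proof -
  have "norm (pw M u) = L2_norm (\<lambda>x. M x (rep u x))"
    unfolding pw_def by (rule norm_lsq) (simp add: pw_bounded_L2[OF assms])
  also have "\<dots> \<le> C * L2_norm (rep u)"
    by (rule L2_norm_mono)
      (use assms in \<open>auto simp: pw_bounded_measurable\<close>, auto simp: pw_bounded_def elim: eventually_mono)
  finally show ?thesis by (simp add: norm_lsq_eq)
qed

lemma bounded_linear_pw: assumes M: "pw_bounded M C" shows "bounded_linear (pw M)"
proof (rule bounded_linear_intro)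
  have lin: "linear (M x)" for x using M by (simp add: pw_bounded_def)
  show "pw M (u + v) = pw M u + pw M v" for u v
    by (rule lsq_eqI) (use AE_rep_pw[OF M, of "u+v"] AE_rep_pw[OF M, of u] AE_rep_pw[OF M, of v]
      AE_rep_add[of u v] AE_rep_add[of "pw M u" "pw M v"] in \<open>eventually_elim, simp add: linear_add[OF lin]\<close>)
  show "pw M (c *\<^sub>R u) = c *\<^sub>R pw M u" for c u
    by (rule lsq_eqI) (use AE_rep_pw[OF M, of "c *\<^sub>R u"] AE_rep_pw[OF M, of u]
      AE_rep_scaleR[of c u] AE_rep_scaleR[of c "pw M u"] in \<open>eventually_elim, simp add: linear_scale[OF lin]\<close>)
  show "norm (pw M u) \<le> norm u * C" for u
    using norm_pw[OF M, of u] by (simp add: mult.commute)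
qed

lemma pw_bounded_const: "linear m \<Longrightarrow> pw_bounded (\<lambda>_. m) (onorm m)"
  by (auto simp: pw_bounded_def onorm_pos_le onorm linear_conv_bounded_linear)

lemma pw_lsq: assumes "pw_bounded M C" "L2 f" shows "pw M (lsq f) = lsq (\<lambda>x. M x (f x))"
  unfolding pw_def
  by (rule lsq_cong) (use assms AE_rep_lsq[OF assms(2)] in \<open>auto simp: pw_bounded_L2 elim: eventually_mono\<close>)

lemma pw_pw:
  assumes "pw_bounded M C" "pw_bounded M' C'"
  shows "pw M (pw M' u) = pw (\<lambda>x v. M x (M' x v)) u"
  using pw_lsq[OF assms(1) pw_bounded_L2[OF assms(2), of "rep u"]] by (simp add: pw_def)

subsection \<open>Pairing with scalar functions\<close>

lemma norm_vector_scalar_mult [simp]: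
  fixes c :: complex and v :: "complex ^ 'm::finite"
  shows "norm (c *s v) = norm c * norm v"
  by (simp add: norm_vec_def norm_mult L2_set_right_distrib)

lemma bounded_bilinear_vector_scalar_mult:
  "bounded_bilinear ((*s) :: complex \<Rightarrow> complex ^ 'm::finite \<Rightarrow> complex ^ 'm)"
proof (rule bounded_bilinear.intro)
  show "\<exists>K. \<forall>a (b :: complex ^ 'm). norm (a *s b) \<le> norm a * norm b * K"
    by (rule exI[of _ 1]) simp
qed (simp_all add: vec_eq_iff algebra_simps)

interpretation vsm: bounded_bilinear "(*s) :: complex \<Rightarrow> complex ^ 'm::finite \<Rightarrow> complex ^ 'm"
  by (rule bounded_bilinear_vector_scalar_mult)

lemma borel_measurable_vsm [measurable (raw)]:
  fixes f :: "'a \<Rightarrow> complex" and g :: "'a \<Rightarrow> complex ^ 'm::finite"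
  assumes "f \<in> borel_measurable M" "g \<in> borel_measurable M"
  shows "(\<lambda>x. f x *s g x) \<in> borel_measurable M"
  by (rule borel_measurable_continuous_Pair[OF assms]) (intro vsm.continuous_on continuous_intros)

lemma L2_integrable_vsm:
  fixes f :: "'a::euclidean_space \<Rightarrow> complex" and g :: "'a \<Rightarrow> complex ^ 'm::finite"
  assumes f: "L2 f" and g: "L2 g"
  shows "integrable lborel (\<lambda>x. f x *s g x)"
  by (rule Bochner_Integration.integrable_bound[OF L2_integrable_mult[OF f g]])
    (use f g in \<open>auto dest!: L2_borel\<close>)

text \<open>The pairing of distributions: bilinear, without conjugation, and with values in the
  fibre \<open>complex ^ 'm\<close>, so that a constant matrix can be moved across it.\<close>

definition pair :: "('a::euclidean_space \<Rightarrow> complex) \<Rightarrow> ('a, complex ^ 'm::finite) lsq \<Rightarrow> complex ^ 'm" where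
  "pair \<psi> u = (\<integral>x. \<psi> x *s rep u x \<partial>lborel)"

lemma pair_lsq:
  assumes "L2 \<psi>" "L2 f"
  shows "pair \<psi> (lsq f) = (\<integral>x. \<psi> x *s f x \<partial>lborel)"
  unfolding pair_def
  by (rule integral_cong_AE) (use assms AE_rep_lsq[OF assms(2)] in \<open>auto dest!: L2_borel elim: eventually_mono\<close>)

lemma norm_pair:
  assumes "L2 \<psi>"
  shows "norm (pair \<psi> u) \<le> L2_norm \<psi> * norm u"
proof -
  have "norm (pair \<psi> u) \<le> (\<integral>x. norm (\<psi> x *s rep u x) \<partial>lborel)"
    unfolding pair_def by (rule integral_norm_bound)
  also have "\<dots> \<le> L2_norm \<psi> * L2_norm (rep u)"
    using L2_Cauchy_Schwarz[OF assms, of "rep u"] by simp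
  finally show ?thesis by (simp add: norm_lsq_eq)
qed

lemma bounded_linear_pair:
  assumes psi: "L2 \<psi>"
  shows "bounded_linear (pair \<psi> :: ('a::euclidean_space, complex ^ 'm::finite) lsq \<Rightarrow> _)"
proof (rule bounded_linear_intro)
  have [measurable]: "\<psi> \<in> borel_measurable borel" using psi by (rule L2_borel)
  fix u v :: "('a, complex ^ 'm) lsq" and c :: real
  have "pair \<psi> (u + v) = (\<integral>x. \<psi> x *s rep u x + \<psi> x *s rep v x \<partial>lborel)"
    unfolding pair_def
    by (rule integral_cong_AE, measurable)
      (use AE_rep_add[of u v] in \<open>eventually_elim, simp add: vsm.add_right\<close>)
  then show "pair \<psi> (u + v) = pair \<psi> u + pair \<psi> v"
    by (simp add: pair_def L2_integrable_vsm psi)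
  have "pair \<psi> (c *\<^sub>R u) = (\<integral>x. c *\<^sub>R (\<psi> x *s rep u x) \<partial>lborel)"
    unfolding pair_def
    by (rule integral_cong_AE, measurable)
      (use AE_rep_scaleR[of c u] in \<open>eventually_elim, simp add: vsm.scaleR_right\<close>)
  then show "pair \<psi> (c *\<^sub>R u) = c *\<^sub>R pair \<psi> u"
    by (simp add: pair_def)
  show "norm (pair \<psi> u) \<le> norm u * L2_norm \<psi>"
    using norm_pair[OF psi, of u] by (simp add: mult.commute)
qed

lemma pair_diff_left: "L2 \<phi> \<Longrightarrow> L2 \<psi> \<Longrightarrow> pair (\<lambda>x. \<phi> x - \<psi> x) u = pair \<phi> u - pair \<psi> u"
  by (simp add: pair_def vsm.diff_left L2_integrable_vsm)

lemma pair_minus_left: "pair (\<lambda>x. - \<psi> x) u = - pair \<psi> u"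
  by (simp add: pair_def vsm.minus_left)

lemma pair_scaleR_left: "pair (\<lambda>x. c *\<^sub>R \<psi> x) u = c *\<^sub>R pair \<psi> u"
  by (simp add: pair_def vsm.scaleR_left)

text \<open>\<open>linear\<close> means real linear, whereas the pairing multiplies by complex
  scalars; complex homogeneity is therefore a separate hypothesis.\<close>

lemma pair_pw_const:
  fixes m :: "complex ^ 'm::finite \<Rightarrow> complex ^ 'k::finite"
  assumes m: "linear m" "\<And>c v. m (c *s v) = c *s m v" and psi: "L2 \<psi>"
  shows "pair \<psi> (pw (\<lambda>_. m) u) = m (pair \<psi> u)"
proof -
  have "pair \<psi> (pw (\<lambda>_. m) u) = (\<integral>x. m (\<psi> x *s rep u x) \<partial>lborel)"
    unfolding pw_def using pair_lsq[OF psi pw_bounded_L2[OF pw_bounded_const[OF m(1)], of "rep u"]]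
    by (simp add: m(2))
  also have "\<dots> = m (pair \<psi> u)"
    unfolding pair_def
    by (rule integral_bounded_linear) (use m(1) in \<open>simp_all add: linear_conv_bounded_linear L2_integrable_vsm psi\<close>)
  finally show ?thesis .
qed

subsection \<open>Translations\<close>

lemma lborel_distr_translate: "distr lborel borel (\<lambda>x. x + z) = (lborel :: 'a::euclidean_space measure)"
proof -
  have "(\<lambda>x. x + z) = (+) z" by (auto simp: add.commute)
  then show ?thesis by (simp add: lborel_distr_plus)
qed

lemma AE_lborel_translate:
  assumes "AE x in lborel. P (x::'a::euclidean_space)" shows "AE x in lborel. P (x + z)"
proof -
  have "AE x in distr lborel borel (\<lambda>x. x + z). P x" using assms unfolding lborel_distr_translate .
  then show ?thesis by (rule AE_distrD[rotated]) simp
qed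

lemma integrable_lborel_translate:
  fixes f :: "'a::euclidean_space \<Rightarrow> 'b::{banach, second_countable_topology}"
  assumes "integrable lborel f" shows "integrable lborel (\<lambda>x. f (x + z))"
  by (rule integrable_distr[of "\<lambda>x. x + z" lborel borel]) (use assms in \<open>simp_all add: lborel_distr_translate\<close>)

lemma integral_lborel_translate:
  fixes f :: "'a::euclidean_space \<Rightarrow> 'b::{banach, second_countable_topology}"
  assumes "f \<in> borel_measurable borel"
  shows "(\<integral>x. f (x + z) \<partial>lborel) = (\<integral>x. f x \<partial>lborel)"
  using integral_distr[of "\<lambda>x. x + z" lborel borel f] assms by (simp add: lborel_distr_translate)

lemma L2_translate:
  assumes "L2 f" shows "L2 (\<lambda>x. f (x + z))"
proof -
  have [measurable]: "f \<in> borel_measurable borel" using assms by (rule L2_borel)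
  have "(\<lambda>x. f (x + z)) \<in> borel_measurable borel" by measurable
  then show ?thesis
    using integrable_lborel_translate[OF L2_integrable[OF assms], of z] by (simp add: L2_def)
qed

lemma L2_norm_translate: "L2 f \<Longrightarrow> L2_norm (\<lambda>x. f (x + z)) = L2_norm f"
  unfolding L2_norm_def by (simp add: integral_lborel_translate[of "\<lambda>x. (norm (f x))\<^sup>2"] L2_borel)

definition translate :: "'a \<Rightarrow> ('a::euclidean_space, 'b::euclidean_space) lsq \<Rightarrow> ('a, 'b) lsq" where
  "translate z u = lsq (\<lambda>x. rep u (x + z))"

lemma AE_rep_translate: "AE x in lborel. rep (translate z u) x = rep u (x + z)"
  unfolding translate_def by (rule AE_rep_lsq) (simp add: L2_translate)

lemma norm_translate [simp]: "norm (translate z u) = norm u"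
  unfolding translate_def by (simp add: norm_lsq L2_translate L2_norm_translate) (simp add: norm_lsq_eq)

lemma bounded_linear_translate: "bounded_linear (translate z)"
proof (rule bounded_linear_intro)
  show "translate z (u + v) = translate z u + translate z v" for u v :: "('a, 'b) lsq"
    by (rule lsq_eqI) (use AE_lborel_translate[OF AE_rep_add[of u v], of z] AE_rep_translate[of z "u+v"]
      AE_rep_translate[of z u] AE_rep_translate[of z v] AE_rep_add[of "translate z u" "translate z v"] in
      \<open>eventually_elim, simp\<close>)
  show "translate z (c *\<^sub>R u) = c *\<^sub>R translate z u" for c and u :: "('a, 'b) lsq"
    by (rule lsq_eqI) (use AE_lborel_translate[OF AE_rep_scaleR[of c u], of z] AE_rep_translate[of z "c *\<^sub>R u"]
      AE_rep_translate[of z u] AE_rep_scaleR[of c "translate z u"] in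
      \<open>eventually_elim, simp\<close>)
  show "norm (translate z u) \<le> norm u * 1" for u :: "('a, 'b) lsq" by simp
qed

lemma translate_lsq: "L2 f \<Longrightarrow> translate z (lsq f) = lsq (\<lambda>x. f (x + z))"
  unfolding translate_def
  by (rule lsq_cong) (auto simp: L2_translate intro!: AE_lborel_translate AE_rep_lsq)

lemma translate_translate: "translate z (translate z' u) = translate (z + z') u"
  using translate_lsq[OF L2_translate[OF L2_rep], of z u z'] by (simp add: translate_def add.assoc)

lemma translate_0 [simp]: "translate 0 u = u"
  by (simp add: translate_def)

lemma pair_translate:
  assumes psi: "L2 \<psi>"
  shows "pair \<psi> (translate z u) = pair (\<lambda>x. \<psi> (x - z)) u"
proof -
  have [measurable]: "\<psi> \<in> borel_measurable borel" using psi by (rule L2_borel)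
  have "pair \<psi> (translate z u) = (\<integral>x. \<psi> x *s rep u (x + z) \<partial>lborel)"
    unfolding translate_def by (rule pair_lsq[OF psi]) (simp add: L2_translate)
  also have "\<dots> = (\<integral>x. (\<lambda>y. \<psi> (y - z) *s rep u y) (x + z) \<partial>lborel)" by simp
  also have "\<dots> = pair (\<lambda>x. \<psi> (x - z)) u"
    unfolding pair_def by (rule integral_lborel_translate) measurable
  finally show ?thesis .
qed

section \<open>Smooth functions\<close>

lemma Ck_continuous: "Ck k f \<Longrightarrow> continuous_on UNIV f"
  by (cases k) (auto intro: differentiable_imp_continuous_on)

lemma Ck_SucI:
  assumes "\<And>x. (f has_derivative f' x) (at x)" "\<And>b. b \<in> Basis \<Longrightarrow> Ck k (\<lambda>x. f' x b)"
  shows "Ck (Suc k) f"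
proof -
  have "frechet_derivative f (at x) = f' x" for x
    using frechet_derivative_at[OF assms(1)] by simp
  then show ?thesis
    using assms by (auto simp: differentiable_on_def differentiable_def)
qed

lemma Ck_Suc_has_derivative: "Ck (Suc k) f \<Longrightarrow> (f has_derivative frechet_derivative f (at x)) (at x)"
  by (simp add: differentiable_on_def frechet_derivative_works)

lemma Ck_Suc_dest: "Ck (Suc k) f \<Longrightarrow> b \<in> Basis \<Longrightarrow> Ck k (\<lambda>x. frechet_derivative f (at x) b)"
  by simp

lemma Ck_decreasing: "Ck (Suc k) f \<Longrightarrow> Ck k f"
proof (induction k arbitrary: f)
  case 0
  then show ?case by (auto intro: differentiable_imp_continuous_on)
next
  case (Suc k)
  then show ?case by simp
qed

lemma Ck_const: "Ck k (\<lambda>x. c)"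
proof (induction k arbitrary: c)
  case (Suc k)
  show ?case by (rule Ck_SucI[where f'="\<lambda>_ _. 0"]) (use Suc in auto)
qed simp

lemma Ck_add: "Ck k f \<Longrightarrow> Ck k g \<Longrightarrow> Ck k (\<lambda>x. f x + g x)"
proof (induction k arbitrary: f g)
  case (Suc k)
  show ?case
    by (rule Ck_SucI[OF has_derivative_add[OF Suc.prems[THEN Ck_Suc_has_derivative]]])
      (intro Suc.IH Suc.prems[THEN Ck_Suc_dest])
qed (auto intro: continuous_intros)

lemma Ck_bounded_linear: "bounded_linear h \<Longrightarrow> Ck k f \<Longrightarrow> Ck k (\<lambda>x. h (f x))"
proof (induction k arbitrary: f)
  case (Suc k)
  show ?case
    by (rule Ck_SucI[OF bounded_linear.has_derivative[OF Suc.prems(1) Ck_Suc_has_derivative[OF Suc.prems(2)]]])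
      (intro Suc.IH Suc.prems Suc.prems(2)[THEN Ck_Suc_dest])
qed (auto intro: bounded_linear.continuous_on)

lemma Ck_scaleR: "Ck k f \<Longrightarrow> Ck k (\<lambda>x. c *\<^sub>R f x)"
  by (rule Ck_bounded_linear) (rule bounded_linear_scaleR_right)

lemma Ck_cmult: "Ck k f \<Longrightarrow> Ck k (\<lambda>x. c * f x :: 'b::real_normed_algebra)"
  by (rule Ck_bounded_linear) (rule bounded_linear_mult_right)

lemma Ck_uminus: "Ck k f \<Longrightarrow> Ck k (\<lambda>x. - f x)"
  using Ck_scaleR[of k f "-1"] by simp

lemma Ck_diff: "Ck k f \<Longrightarrow> Ck k g \<Longrightarrow> Ck k (\<lambda>x. f x - g x)"
  using Ck_add[of k f "\<lambda>x. - g x"] Ck_uminus[of k g] by simp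

lemma Ck_sum: "(\<And>i. i \<in> I \<Longrightarrow> Ck k (f i)) \<Longrightarrow> Ck k (\<lambda>x. \<Sum>i\<in>I. f i x)"
  by (induction I rule: infinite_finite_induct) (auto intro: Ck_add Ck_const)

lemma Ck_mult:
  fixes f g :: "'a::euclidean_space \<Rightarrow> 'b::real_normed_algebra"
  shows "Ck k f \<Longrightarrow> Ck k g \<Longrightarrow> Ck k (\<lambda>x. f x * g x)"
proof (induction k arbitrary: f g)
  case (Suc k)
  show ?case
    by (rule Ck_SucI[OF has_derivative_mult[OF Suc.prems[THEN Ck_Suc_has_derivative]]])
      (intro Ck_add Suc.IH Suc.prems[THEN Ck_Suc_dest] Suc.prems[THEN Ck_decreasing])
qed (auto intro: continuous_intros)

lemma Ck_prod:
  fixes f :: "'i \<Rightarrow> 'a::euclidean_space \<Rightarrow> 'b::{real_normed_algebra_1, comm_monoid_mult}"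
  shows "(\<And>i. i \<in> I \<Longrightarrow> Ck k (f i)) \<Longrightarrow> Ck k (\<lambda>x. \<Prod>i\<in>I. f i x)"
  by (induction I rule: infinite_finite_induct) (auto intro: Ck_mult Ck_const)

lemma Ck_compose_affine:
  fixes L :: "'a::euclidean_space \<Rightarrow> 'b::euclidean_space"
  assumes "bounded_linear L"
  shows "Ck k f \<Longrightarrow> Ck k (\<lambda>x. f (L x + c))"
proof (induction k arbitrary: f)
  case (Suc k)
  show ?case
  proof (rule Ck_SucI)
    fix x
    have "((\<lambda>x. L x + c) has_derivative L) (at x)"
      using assms by (auto intro!: derivative_eq_intros bounded_linear_imp_has_derivative)
    then show "((\<lambda>x. f (L x + c)) has_derivative (\<lambda>y. frechet_derivative f (at (L x + c)) (L y))) (at x)"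
      by (rule has_derivative_compose) (rule Ck_Suc_has_derivative[OF Suc.prems])
  next
    fix b :: 'a
    \<comment> \<open>\<open>Ck\<close> speaks of derivatives along basis vectors, but the chain
      rule produces the direction \<open>L b\<close>; it is expanded in the basis so that the
      induction hypothesis applies.\<close>
    have "frechet_derivative f (at y) (L b) = (\<Sum>e\<in>Basis. (L b \<bullet> e) *\<^sub>R frechet_derivative f (at y) e)" for y
    proof -
      have "linear (frechet_derivative f (at y))"
        using Ck_Suc_has_derivative[OF Suc.prems] by (rule has_derivative_linear)
      then have "frechet_derivative f (at y) (\<Sum>e\<in>Basis. (L b \<bullet> e) *\<^sub>R e)
          = (\<Sum>e\<in>Basis. (L b \<bullet> e) *\<^sub>R frechet_derivative f (at y) e)"
        by (simp add: linear_sum linear_scale)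
      then show ?thesis by (simp add: euclidean_representation)
    qed
    then show "Ck k (\<lambda>x. frechet_derivative f (at (L x + c)) (L b))"
      by (simp only:) (intro Ck_sum Ck_scaleR Suc.IH Suc.prems[THEN Ck_Suc_dest])
  qed
next
  case 0
  then have "continuous_on UNIV f" by simp
  moreover have "continuous_on UNIV (\<lambda>x. L x + c)"
    by (intro continuous_intros linear_continuous_on assms)
  ultimately have "continuous_on UNIV (\<lambda>x. f (L x + c))" by (rule continuous_on_compose2) simp
  then show ?case by simp
qed

lemma Ck_cis: "Ck k (\<lambda>x. cis (x \<bullet> \<xi>))"
proof -
  \<comment> \<open>Differentiation reproduces the function up to a constant factor, so the
    induction is generalised over \<open>c\<close>.\<close>
  have "Ck k (\<lambda>x. c * cis (x \<bullet> \<xi>))" for c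
  proof (induction k arbitrary: c)
    case (Suc k)
    show ?case
    proof (rule Ck_SucI)
      show "((\<lambda>x. c * cis (x \<bullet> \<xi>)) has_derivative (\<lambda>y. c * ((y \<bullet> \<xi>) *\<^sub>R (\<i> * cis (x \<bullet> \<xi>))))) (at x)" for x
      proof -
        have "((\<lambda>x. x \<bullet> \<xi>) has_derivative (\<lambda>y. y \<bullet> \<xi>)) (at x)"
          by (auto intro!: derivative_eq_intros)
        then show ?thesis by (intro has_derivative_mult_right has_derivative_cis)
      qed
      show "Ck k (\<lambda>x. c * ((b \<bullet> \<xi>) *\<^sub>R (\<i> * cis (x \<bullet> \<xi>))))" for b
        using Suc[of "c * (b \<bullet> \<xi>) * \<i>"] by (simp add: scaleR_conv_of_real mult.assoc)
    qed
  next
    case 0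
    show ?case by (auto intro!: continuous_intros simp: cis.code cis_conv_exp)
  qed
  from this[of 1] show ?thesis by simp
qed

section \<open>Test functions on a Euclidean space\<close>

definition testfun :: "('a::euclidean_space \<Rightarrow> complex) \<Rightarrow> bool" where
  "testfun \<psi> \<longleftrightarrow> (\<forall>k. Ck k \<psi>) \<and> compact (closure {x. \<psi> x \<noteq> 0})"

abbreviation dd :: "'a::euclidean_space \<Rightarrow> ('a \<Rightarrow> complex) \<Rightarrow> 'a \<Rightarrow> complex" where
  "dd b \<psi> x \<equiv> frechet_derivative \<psi> (at x) b"

lemma testfunI:
  assumes "\<And>k. Ck k \<psi>" "compact K" "\<And>x. x \<notin> K \<Longrightarrow> \<psi> x = 0"
  shows "testfun \<psi>"
proof -
  have "closure {x. \<psi> x \<noteq> 0} \<subseteq> K"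
    using assms(2,3) by (intro closure_minimal compact_imp_closed) auto
  then have "compact (closure {x. \<psi> x \<noteq> 0})"
    using assms(2) compact_Int_closed[of K "closure {x. \<psi> x \<noteq> 0}"] by (simp add: inf.absorb2)
  then show ?thesis using assms(1) by (simp add: testfun_def)
qed

lemma testfun_Ck: "testfun \<psi> \<Longrightarrow> Ck k \<psi>"
  by (simp add: testfun_def)

text \<open>One compact set serves for the function and its derivatives, since off the closed
  support the function vanishes on an open set.\<close>

lemma testfun_support:
  assumes "testfun \<psi>"
  obtains K where "compact K" "\<And>x. x \<notin> K \<Longrightarrow> \<psi> x = 0" "\<And>x b. x \<notin> K \<Longrightarrow> dd b \<psi> x = 0"
proof
  let ?K = "closure {x. \<psi> x \<noteq> 0}"
  show "compact ?K" using assms by (simp add: testfun_def)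
  show *: "\<psi> x = 0" if "x \<notin> ?K" for x
    using that subsetD[OF closure_subset, of x "{x. \<psi> x \<noteq> 0}"] by auto
  show "dd b \<psi> x = 0" if "x \<notin> ?K" for x b
  proof -
    have "(\<psi> has_derivative (\<lambda>_. 0)) (at x)"
    proof (rule has_derivative_transform_within_open)
      show "((\<lambda>_. 0) has_derivative (\<lambda>_. 0)) (at x)" by simp
      show "open (- ?K)" "x \<in> - ?K" using that by auto
      show "0 = \<psi> y" if "y \<in> - ?K" for y
        using *[OF ComplD[OF that]] by (rule sym)
    qed
    then show ?thesis by (simp add: frechet_derivative_at[symmetric])
  qed
qed

lemma testfun_dd: "testfun \<psi> \<Longrightarrow> b \<in> Basis \<Longrightarrow> testfun (dd b \<psi>)"
proof -
  assume \<psi>: "testfun \<psi>" and b: "b \<in> Basis"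
  from testfun_support[OF \<psi>] obtain K where K: "compact K" "\<And>x. x \<notin> K \<Longrightarrow> dd b \<psi> x = 0" by metis
  show ?thesis
    by (rule testfunI[OF _ K]) (use testfun_Ck[OF \<psi>] b in \<open>blast intro: Ck_Suc_dest\<close>)
qed

lemma testfun_has_derivative: "testfun \<psi> \<Longrightarrow> (\<psi> has_derivative (\<lambda>b. dd b \<psi> x)) (at x)"
  using Ck_Suc_has_derivative testfun_Ck by blast

lemma testfun_continuous: "testfun \<psi> \<Longrightarrow> continuous_on UNIV \<psi>"
  using Ck_continuous testfun_Ck by blast

lemma L2_compact_support:
  fixes f :: "'a::euclidean_space \<Rightarrow> 'b::euclidean_space"
  assumes K: "compact K" "\<And>x. x \<notin> K \<Longrightarrow> f x = 0"
    and f: "f \<in> borel_measurable borel" and B: "\<And>x. norm (f x) \<le> B"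
  shows "L2 f" and "L2_norm f \<le> B * sqrt (measure lborel K)"
proof -
  have int: "integrable lborel (indicator K :: 'a \<Rightarrow> real)"
    using K(1) emeasure_compact_finite[OF K(1)] by (intro integrable_real_indicator)
      (simp_all add: borel_compact)
  have 2: "L2 (indicator K :: 'a \<Rightarrow> real)"
  proof -
    have "(\<lambda>x. (norm (indicator K x :: real))\<^sup>2) = indicator K" by (auto simp: indicator_def)
    then show ?thesis unfolding L2_def using int K(1) by (simp add: borel_compact)
  qed
  have le: "AE x in lborel. norm (f x) \<le> B * norm (indicator K x :: real)"
    using B K(2) by (auto simp: indicator_def)
  show "L2 f"
    by (rule L2_dominated[OF 2 f le])
  have "0 \<le> B" using B[of 0] norm_ge_zero order_trans by blast
  then have "L2_norm f \<le> B * L2_norm (indicator K :: 'a \<Rightarrow> real)"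
    by (rule L2_norm_mono[OF 2 f _ le])
  also have "L2_norm (indicator K :: 'a \<Rightarrow> real) = sqrt (measure lborel K)"
  proof -
    have "(\<integral>x. (norm (indicator K x :: real))\<^sup>2 \<partial>lborel) = (\<integral>x. indicator K x \<partial>lborel)"
      by (rule Bochner_Integration.integral_cong) (auto simp: indicator_def)
    then show ?thesis using K(1) by (simp add: L2_norm_def)
  qed
  finally show "L2_norm f \<le> B * sqrt (measure lborel K)" .
qed

lemma bounded_compact_support:
  fixes f :: "'a::euclidean_space \<Rightarrow> 'b::real_normed_vector"
  assumes "compact K" "\<And>x. x \<notin> K \<Longrightarrow> f x = 0" "continuous_on UNIV f"
  obtains B where "0 < B" "\<And>x. norm (f x) \<le> B"
proof -
  have "bounded (f ` K)"
    using assms by (intro compact_imp_bounded compact_continuous_image) (auto intro: continuous_on_subset)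
  then obtain B where "0 < B" "\<forall>y\<in>f ` K. norm y \<le> B" unfolding bounded_pos by blast
  then show ?thesis using assms(2) by (intro that[of B]) (metis image_eqI less_imp_le norm_zero)+
qed

lemma testfun_bounded:
  assumes "testfun \<psi>" obtains B where "0 < B" "\<And>x. norm (\<psi> x) \<le> B"
  using testfun_support[OF assms] bounded_compact_support testfun_continuous[OF assms] by metis

lemma testfun_borel: "testfun \<psi> \<Longrightarrow> \<psi> \<in> borel_measurable borel"
  by (rule borel_measurable_continuous_onI) (rule testfun_continuous)

lemma testfun_L2 [intro]: assumes "testfun \<psi>" shows "L2 \<psi>"
proof -
  obtain K where "compact K" "\<And>x. x \<notin> K \<Longrightarrow> \<psi> x = 0" using testfun_support[OF assms] by metis
  moreover obtain B where "\<And>x. norm (\<psi> x) \<le> B" using testfun_bounded[OF assms] by metis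
  ultimately show ?thesis using L2_compact_support(1)[OF _ _ testfun_borel[OF assms]] by blast
qed

lemma testfun_mult:
  assumes "testfun \<psi>" "\<And>k. Ck k \<phi>"
  shows "testfun (\<lambda>x. \<phi> x * \<psi> x)"
proof -
  obtain K where "compact K" "\<And>x. x \<notin> K \<Longrightarrow> \<psi> x = 0" using testfun_support[OF assms(1)] by metis
  then show ?thesis using assms by (intro testfunI[of _ K] Ck_mult) (auto simp: testfun_Ck)
qed

lemma testfun_translate: assumes "testfun \<psi>" shows "testfun (\<lambda>x. \<psi> (x - z))"
proof -
  obtain K where K: "compact K" "\<And>x. x \<notin> K \<Longrightarrow> \<psi> x = 0" using testfun_support[OF assms] by metis
  show ?thesis
  proof (rule testfunI)
    show "Ck k (\<lambda>x. \<psi> (x - z))" for k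
      using Ck_compose_affine[OF bounded_linear_ident, of k \<psi> "-z"] assms by (simp add: testfun_Ck)
    show "compact ((\<lambda>x. x + z) ` K)" using K(1) by (intro compact_continuous_image continuous_intros)
    show "\<psi> (x - z) = 0" if "x \<notin> (\<lambda>x. x + z) ` K" for x
      using K(2)[of "x - z"] that by (metis diff_add_cancel image_eqI)
  qed
qed

lemma dd_translate:
  assumes "testfun \<psi>" shows "dd b (\<lambda>x. \<psi> (x - z)) x = dd b \<psi> (x - z)"
proof -
  have "((\<lambda>x. x - z) has_derivative (\<lambda>y. y)) (at x)" by (auto intro!: derivative_eq_intros)
  then have "((\<lambda>x. \<psi> (x - z)) has_derivative (\<lambda>b. dd b \<psi> (x - z))) (at x)"
    by (rule has_derivative_compose) (rule testfun_has_derivative[OF assms])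
  then show ?thesis by (simp add: frechet_derivative_at[symmetric])
qed

subsection \<open>Bump functions\<close>

text \<open>\<open>flat 0\<close> is the classical smooth function that is flat at the origin. The
  powers in the denominator make the family closed under differentiation up to linear combinations,
  so smoothness of all members follows by one induction.\<close>

definition flat :: "nat \<Rightarrow> real \<Rightarrow> real" where
  "flat n x = (if 0 < x then exp (- (1 / x)) / x ^ n else 0)"

lemma flat_tendsto_0: "(flat n \<longlongrightarrow> 0) (at 0)"
proof -
  have "(flat n \<longlongrightarrow> 0) (at_right 0)"
  proof -
    have "((\<lambda>x. x ^ n / exp x) \<longlongrightarrow> (0::real)) at_top"
      by (rule tendsto_power_div_exp_0)
    then have "((\<lambda>x. (inverse x) ^ n / exp (inverse x)) \<longlongrightarrow> (0::real)) (at_right 0)"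
      using filterlim_compose filterlim_inverse_at_top_right by blast
    then show ?thesis
    proof (rule Lim_transform_eventually)
      show "\<forall>\<^sub>F x in at_right 0. inverse x ^ n / exp (inverse x) = flat n x"
        using eventually_at_right_less[of 0]
        by eventually_elim (simp add: flat_def field_simps exp_minus)
    qed
  qed
  moreover have "(flat n \<longlongrightarrow> 0) (at_left 0)"
  proof (rule Lim_transform_eventually[OF tendsto_const])
    show "\<forall>\<^sub>F x in at_left 0. 0 = flat n x"
      unfolding eventually_at_filter flat_def by (auto intro: always_eventually)
  qed
  ultimately show ?thesis by (simp add: filterlim_at_split)
qed

lemma flat_has_derivative:
  "(flat n has_real_derivative (flat (n + 2) x - real n * flat (n + 1) x)) (at x)"
proof -
  consider "x < 0" | "x = 0" | "x > 0" by linarith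
  then show ?thesis
  proof cases
    case 1
    have "((\<lambda>_. 0) has_real_derivative 0) (at x)" by simp
    then have "(flat n has_real_derivative 0) (at x)"
      by (rule has_field_derivative_transform_within_open[of _ _ _ "{..<0}"]) (use 1 in \<open>auto simp: flat_def\<close>)
    then show ?thesis using 1 by (simp add: flat_def)
  next
    case 3
    have "((\<lambda>x. exp (- (1 / x)) / x ^ n) has_real_derivative (flat (n + 2) x - real n * flat (n + 1) x)) (at x)"
      using 3 by (cases n) (auto intro!: derivative_eq_intros simp: flat_def field_simps power2_eq_square,
        metis One_nat_def gr0I mult.commute power_minus_mult)
    then show ?thesis
      by (rule has_field_derivative_transform_within_open[of _ _ _ "{0<..}"]) (use 3 in \<open>auto simp: flat_def\<close>)
  next
    case 2
    \<comment> \<open>At the origin the difference quotient is the next member of the family, which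
      tends to 0.\<close>
    have "(\<lambda>y. (flat n y - flat n 0) / (y - 0)) = flat (Suc n)"
      by (auto simp: flat_def fun_eq_iff)
    then show ?thesis
      unfolding has_field_derivative_iff 2 using flat_tendsto_0[of "Suc n"] by (simp add: flat_def)
  qed
qed

lemma Ck_flat: "Ck k (flat n)"
proof (induction k arbitrary: n)
  case (Suc k)
  show ?case
  proof (rule Ck_SucI)
    show "(flat n has_derivative (\<lambda>y. (flat (n + 2) x - real n * flat (n + 1) x) * y)) (at x)" for x
      using flat_has_derivative[of n x] by (simp add: has_field_derivative_def)
    show "Ck k (\<lambda>x. (flat (n + 2) x - real n * flat (n + 1) x) * b)" if "b \<in> Basis" for b
      using that by (simp add: Ck_diff Ck_cmult Suc)
  qed
next
  case 0
  have "isCont (flat n) x" for x using flat_has_derivative DERIV_isCont by blast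
  then show ?case by (simp add: continuous_at_imp_continuous_on)
qed

text \<open>For \<open>0 < c\<close> this is a smooth function that is positive exactly on the open
  box. A larger \<open>c\<close> makes the edges steeper; in the limit the bump becomes the
  indicator of the box.\<close>

definition bump :: "real \<Rightarrow> 'a::euclidean_space \<Rightarrow> 'a \<Rightarrow> 'a \<Rightarrow> real" where
  "bump c a b x = (\<Prod>i\<in>Basis. flat 0 (c * ((x - a) \<bullet> i)) * flat 0 (c * ((b - x) \<bullet> i)))"

lemma flat_0_bounds: "0 \<le> flat 0 x" "flat 0 x \<le> 1"
  by (auto simp: flat_def)

lemma bump_bounds: "0 \<le> bump c a b x" "bump c a b x \<le> 1"
  unfolding bump_def by (auto intro!: prod_nonneg prod_le_1 mult_nonneg_nonneg mult_le_one simp: flat_0_bounds)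

lemma bump_pos: "0 < c \<Longrightarrow> x \<in> box a b \<Longrightarrow> 0 < bump c a b x"
  unfolding bump_def by (rule prod_pos) (auto simp: flat_def box_def algebra_simps)

lemma bump_outside:
  assumes "0 < c" "x \<notin> box a b" shows "bump c a b x = 0"
proof -
  obtain i where i: "i \<in> Basis" "(x - a) \<bullet> i \<le> 0 \<or> (b - x) \<bullet> i \<le> 0"
    using assms(2) by (fastforce simp: box_def inner_diff_left not_less)
  then have "flat 0 (c * ((x - a) \<bullet> i)) * flat 0 (c * ((b - x) \<bullet> i)) = 0"
    using assms(1) by (auto simp: flat_def zero_less_mult_iff not_less)
  then show ?thesis
    unfolding bump_def using i(1) by (intro prod_zero) auto
qed

lemma Ck_bump: "Ck k (bump c a b)"
proof -
  have lin: "bounded_linear (\<lambda>x. s * (x \<bullet> i))" for s and i :: 'a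
    by (intro bounded_linear_const_mult bounded_linear_inner_left)
  have "Ck k (\<lambda>x. flat 0 (c * (x \<bullet> i) + - (c * (a \<bullet> i))) * flat 0 (- c * (x \<bullet> i) + c * (b \<bullet> i)))" for i
    by (intro Ck_mult Ck_compose_affine[of "\<lambda>x. c * (x \<bullet> i)"] Ck_compose_affine[of "\<lambda>x. - c * (x \<bullet> i)"] lin Ck_flat)
  then have "Ck k (\<lambda>x. \<Prod>i\<in>Basis. flat 0 (c * (x \<bullet> i) + - (c * (a \<bullet> i))) * flat 0 (- c * (x \<bullet> i) + c * (b \<bullet> i)))"
    by (intro Ck_prod)
  then show ?thesis
    unfolding bump_def[abs_def] by (simp add: algebra_simps)
qed

lemma testfun_bump: "0 < c \<Longrightarrow> testfun (\<lambda>x. complex_of_real (bump c a b x))"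
  by (rule testfunI[of _ "cbox a b"])
    (auto intro!: Ck_bounded_linear[OF bounded_linear_of_real] Ck_bump bump_outside compact_cbox
      simp: box_subset_cbox[THEN subsetD] dest: subsetD[OF box_subset_cbox])

lemma bump_tendsto_indicator: "(\<lambda>n. bump (real (Suc n)) a b x) \<longlonglongrightarrow> indicator (box a b) x"
proof (cases "x \<in> box a b")
  case False
  then show ?thesis by (simp add: bump_outside)
next
  case True
  have lim: "(\<lambda>n. flat 0 (real (Suc n) * y)) \<longlonglongrightarrow> 1" if "0 < y" for y
  proof -
    have "(\<lambda>n. exp (- (inverse (real (Suc n)) * (1 / y)))) \<longlonglongrightarrow> exp (- (0 * (1 / y)))"
      by (intro tendsto_intros LIMSEQ_inverse_real_of_nat)
    moreover have "flat 0 (real (Suc n) * y) = exp (- (inverse (real (Suc n)) * (1 / y)))" for n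
    proof -
      have "0 < real (Suc n) * y" using that by simp
      then show ?thesis by (simp add: flat_def field_simps del: of_nat_Suc)
    qed
    ultimately show ?thesis by simp
  qed
  have "(\<lambda>n. bump (real (Suc n)) a b x) \<longlonglongrightarrow> (\<Prod>i\<in>(Basis::'a set). 1 * 1)"
    unfolding bump_def by (intro tendsto_intros lim) (use True in \<open>auto simp: box_def inner_diff_left\<close>)
  then show ?thesis using True by simp
qed

subsection \<open>Density of the bump functions\<close>

lemma lsq_sum:
  assumes "finite I" "\<And>i. i \<in> I \<Longrightarrow> L2 (f i)"
  shows "L2 (\<lambda>x. \<Sum>i\<in>I. f i x) \<and> lsq (\<lambda>x. \<Sum>i\<in>I. f i x) = (\<Sum>i\<in>I. lsq (f i))"
  using assms by (induction I rule: finite_induct) (auto simp: zero_lsq_def L2_add lsq_add[symmetric])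

lemma L2_indicator_box:
  assumes [measurable]: "A \<in> sets borel" and A: "A \<subseteq> cbox a b"
  shows "L2 (\<lambda>x. indicator A x *\<^sub>R v)"
  by (rule L2_compact_support(1)[of "cbox a b" _ "norm v"])
    (use A in \<open>auto simp: compact_cbox indicator_def\<close>)

text \<open>Density in the form of an induction principle. A closed subspace containing the bumps
  contains the indicators of boxes as their limits, then those of bounded Borel sets, then truncated
  simple functions, and finally every class by removing the truncation.\<close>

lemma lsq_dense_induct:
  fixes S :: "('a::euclidean_space, 'b::euclidean_space) lsq set"
  assumes cl: "closed S" and sub: "subspace S"
    and bump: "\<And>n a b v. lsq (\<lambda>x. bump (real (Suc n)) a b x *\<^sub>R v) \<in> S"
  shows "u \<in> S"
proof -
  have lim: "lsq g \<in> S" if "\<And>n. lsq (f n) \<in> S" "(\<lambda>n. lsq (f n)) \<longlonglongrightarrow> lsq g" for f :: "nat \<Rightarrow> 'a \<Rightarrow> 'b" and g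
    using closed_sequentially[OF cl, of "\<lambda>n. lsq (f n)"] that by blast
  have box: "lsq (\<lambda>x. indicator (box a b) x *\<^sub>R v) \<in> S" for a b v
  proof (rule lim[OF bump[of _ a b v]], rule lsq_tendsto_dominated)
    have norm_le: "norm (bump (real (Suc n)) a b x *\<^sub>R v) \<le> norm (indicator (box a b) x *\<^sub>R v)" for n x
      using bump_bounds[of "real (Suc n)" a b x] bump_outside[of "real (Suc n)" x a b]
      by (cases "x \<in> box a b") (auto simp: mult_left_le_one_le)
    show L: "L2 (\<lambda>x. indicator (box a b) x *\<^sub>R v)" "L2 (\<lambda>x. indicator (box a b) x *\<^sub>R v)"
      by (auto intro!: L2_indicator_box[of _ a b] box_subset_cbox)
    have m: "(\<lambda>x. bump (real (Suc n)) a b x *\<^sub>R v) \<in> borel_measurable borel" for n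
      by (intro borel_measurable_continuous_onI continuous_intros Ck_continuous[OF Ck_bump[of 0]])
    show "L2 (\<lambda>x. bump (real (Suc n)) a b x *\<^sub>R v)" for n
    proof (rule L2_dominated[OF _ m])
      show "AE x in lborel. norm (bump (real (Suc n)) a b x *\<^sub>R v) \<le> 1 * norm (indicator (box a b) x *\<^sub>R v)"
        using norm_le by simp
    qed (rule L(1))
    show "AE x in lborel. norm (bump (real (Suc n)) a b x *\<^sub>R v) \<le> norm (indicator (box a b) x *\<^sub>R v)" for n
      using norm_le by simp
    show "AE x in lborel. (\<lambda>n. bump (real (Suc n)) a b x *\<^sub>R v) \<longlonglongrightarrow> indicator (box a b) x *\<^sub>R v"
      by (intro always_eventually allI tendsto_intros bump_tendsto_indicator)
  qed
  \<comment> \<open>Truncation to bounded boxes keeps all indicators square integrable and makes the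
    indicator of a complement a difference of two elements of \<open>S\<close>.\<close>
  define B :: "nat \<Rightarrow> 'a set" where "B N = box (- (real N *\<^sub>R One)) (real N *\<^sub>R One)" for N
  have [measurable]: "B N \<in> sets borel" for N by (simp add: B_def)
  have L2B: "L2 (\<lambda>x. indicator (A \<inter> B N) x *\<^sub>R v)" if [measurable]: "A \<in> sets borel" for A N and v :: 'b
  proof (rule L2_indicator_box)
    show "A \<inter> B N \<subseteq> cbox (- (real N *\<^sub>R One)) (real N *\<^sub>R One)"
      unfolding B_def using box_subset_cbox by blast
  qed measurable
  \<comment> \<open>Dynkin's argument: boxes are stable under intersection and generate the Borel
    sets, and the sets with the required property are closed under complements and disjoint
    countable unions.\<close>
  have set: "lsq (\<lambda>x. indicator (A \<inter> B N) x *\<^sub>R v) \<in> S" if A: "A \<in> sets borel" for A N and v :: 'b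
  proof -
    let ?E = "range (\<lambda>(a::'a, b). box a b)"
    have eq: "sets (borel :: 'a measure) = sigma_sets UNIV ?E"
      unfolding borel_eq_box by (rule sets_measure_of) simp
    have Epow: "?E \<subseteq> Pow UNIV" by simp
    have st: "Int_stable ?E"
      by (auto simp: Int_stable_def box_Int_box)
    show ?thesis
      using st Epow A[unfolded eq]
    proof (induction A rule: sigma_sets_induct_disjoint)
      case (basic A)
      then obtain a b where "A \<inter> B N = box a b" unfolding B_def by (auto simp: box_Int_box)
      then show ?case by (simp add: box)
    next
      case empty
      show ?case using subspace_0[OF sub] by (simp add: zero_lsq_def)
    next
      case (compl A)
      then have [measurable]: "A \<in> sets borel" by (simp add: eq)
      have "lsq (\<lambda>x. indicator ((UNIV - A) \<inter> B N) x *\<^sub>R v)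
          = lsq (\<lambda>x. indicator (UNIV \<inter> B N) x *\<^sub>R v) - lsq (\<lambda>x. indicator (A \<inter> B N) x *\<^sub>R v)"
      proof (subst lsq_diff)
        have "indicator ((UNIV - A) \<inter> B N) x = (indicator (UNIV \<inter> B N) x - indicator (A \<inter> B N) x :: real)" for x
          by (auto simp: indicator_def)
        then show "lsq (\<lambda>x. indicator ((UNIV - A) \<inter> B N) x *\<^sub>R v)
            = lsq (\<lambda>x. indicator (UNIV \<inter> B N) x *\<^sub>R v - indicator (A \<inter> B N) x *\<^sub>R v)"
          by (simp add: scaleR_diff_left)
      qed (intro L2B; measurable)+
      then show ?case
        using subspace_diff[OF sub box compl(2)] by (simp add: B_def)
    next
      case (union A)
      then have [measurable]: "A i \<in> sets borel" for i by (auto simp: eq)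
      show ?case
      proof (rule lim)
        show "lsq (\<lambda>x. indicator ((\<Union>i<n. A i) \<inter> B N) x *\<^sub>R v) \<in> S" for n
        proof (induction n)
          case 0
          show ?case using subspace_0[OF sub] by (simp add: zero_lsq_def)
        next
          case (Suc n)
          have "lsq (\<lambda>x. indicator ((\<Union>i<Suc n. A i) \<inter> B N) x *\<^sub>R v)
             = lsq (\<lambda>x. indicator ((\<Union>i<n. A i) \<inter> B N) x *\<^sub>R v) + lsq (\<lambda>x. indicator (A n \<inter> B N) x *\<^sub>R v)"
          proof (subst lsq_add)
            have "indicator ((\<Union>i<Suc n. A i) \<inter> B N) x
              = (indicator ((\<Union>i<n. A i) \<inter> B N) x + indicator (A n \<inter> B N) x :: real)" for x
            proof -
              have "x \<notin> A n" if "i < n" "x \<in> A i" for i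
                using disjoint_family_onD[OF union(1), of i n] that by blast
              then show ?thesis by (simp add: indicator_def lessThan_Suc) blast
            qed
            then show "lsq (\<lambda>x. indicator ((\<Union>i<Suc n. A i) \<inter> B N) x *\<^sub>R v)
              = lsq (\<lambda>x. indicator ((\<Union>i<n. A i) \<inter> B N) x *\<^sub>R v + indicator (A n \<inter> B N) x *\<^sub>R v)"
              by (simp add: scaleR_add_left)
          qed (intro L2B; measurable)+
          then show ?case using subspace_add[OF sub Suc union(3)] by simp
        qed
        show "(\<lambda>n. lsq (\<lambda>x. indicator ((\<Union>i<n. A i) \<inter> B N) x *\<^sub>R v)) \<longlonglongrightarrow> lsq (\<lambda>x. indicator ((\<Union>i. A i) \<inter> B N) x *\<^sub>R v)"
        proof (rule lsq_tendsto_dominated[where h="\<lambda>x. indicator (UNIV \<inter> B N) x *\<^sub>R v"])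
          show "AE x in lborel. (\<lambda>n. indicator ((\<Union>i<n. A i) \<inter> B N) x *\<^sub>R v) \<longlonglongrightarrow> indicator ((\<Union>i. A i) \<inter> B N) x *\<^sub>R v"
            unfolding indicator_inter_arith
            by (intro always_eventually allI tendsto_intros LIMSEQ_indicator_UN)
          show "AE x in lborel. norm (indicator ((\<Union>i<n. A i) \<inter> B N) x *\<^sub>R v) \<le> norm (indicator (UNIV \<inter> B N) x *\<^sub>R v)" for n
            by (auto simp: indicator_def)
        qed (intro L2B; measurable)+
      qed
    qed
  qed
  have bounded_case: "lsq (\<lambda>x. indicator (B N) x *\<^sub>R f x) \<in> S" if L: "L2 f" for f :: "'a \<Rightarrow> 'b" and N
  proof -
    have [measurable]: "f \<in> borel_measurable borel" using L by (rule L2_borel)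
    obtain F where F: "\<And>i. simple_function borel (F i)" "\<And>x. (\<lambda>i. F i x) \<longlonglongrightarrow> f x"
      "\<And>i x. dist (F i x) 0 \<le> 2 * dist (f x) 0"
      using borel_measurable_implies_sequence_metric[of f borel 0] by auto
    have Fm[measurable]: "F i \<in> borel_measurable borel" for i
      using F(1) by (rule borel_measurable_simple_function)
    have L2N: "L2 (\<lambda>x. indicator (B N) x *\<^sub>R g x)" if "L2 g" for g :: "'a \<Rightarrow> 'b"
    proof -
      have [measurable]: "g \<in> borel_measurable borel" using that by (rule L2_borel)
      show ?thesis by (rule L2_dominated[OF that, of _ 1]) (auto simp: indicator_def)
    qed
    have LF: "L2 (F i)" for i
      by (rule L2_dominated[OF L Fm, where C=2]) (use F(3) in auto)
    show ?thesis
    proof (rule lim)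
      show "lsq (\<lambda>x. indicator (B N) x *\<^sub>R F i x) \<in> S" for i
      proof -
        have fin: "finite (range (F i))" using F(1)[of i] by (simp add: simple_function_def)
        have m: "F i -` {y} \<in> sets borel" for y
          using measurable_sets[OF Fm, of "{y}"] by simp
        have "(\<lambda>x. indicator (B N) x *\<^sub>R F i x) = (\<lambda>x. \<Sum>y\<in>range (F i). indicator (F i -` {y} \<inter> B N) x *\<^sub>R y)"
        proof
          fix x
          have "(\<Sum>y\<in>range (F i). indicator (F i -` {y} \<inter> B N) x *\<^sub>R y)
             = (\<Sum>y\<in>range (F i). if y = F i x then indicator (B N) x *\<^sub>R y else 0)"
            by (rule sum.cong) (auto simp: indicator_def)
          then show "indicator (B N) x *\<^sub>R F i x = (\<Sum>y\<in>range (F i). indicator (F i -` {y} \<inter> B N) x *\<^sub>R y)"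
            using fin by simp
        qed
        moreover have "(\<Sum>y\<in>range (F i). lsq (\<lambda>x. indicator (F i -` {y} \<inter> B N) x *\<^sub>R y)) \<in> S"
          by (intro subspace_sum[OF sub] set m)
        ultimately show ?thesis
          using lsq_sum[OF fin, of "\<lambda>y x. indicator (F i -` {y} \<inter> B N) x *\<^sub>R y"] L2B[OF m] by simp
      qed
      show "(\<lambda>i. lsq (\<lambda>x. indicator (B N) x *\<^sub>R F i x)) \<longlonglongrightarrow> lsq (\<lambda>x. indicator (B N) x *\<^sub>R f x)"
      proof (rule lsq_tendsto_dominated[where h="\<lambda>x. 2 *\<^sub>R f x"])
        show "AE x in lborel. norm (indicator (B N) x *\<^sub>R F i x) \<le> norm (2 *\<^sub>R f x)" for i
          using F(3)[of i] by (auto simp: indicator_def)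
        show "AE x in lborel. (\<lambda>i. indicator (B N) x *\<^sub>R F i x) \<longlonglongrightarrow> indicator (B N) x *\<^sub>R f x"
          by (intro always_eventually allI tendsto_intros F(2))
      qed (auto intro: L2N LF L L2_scaleR)
    qed
  qed
  have "lsq (rep u) \<in> S"
  proof (rule lim)
    show "lsq (\<lambda>x. indicator (B N) x *\<^sub>R rep u x) \<in> S" for N by (rule bounded_case) simp
    show "(\<lambda>N. lsq (\<lambda>x. indicator (B N) x *\<^sub>R rep u x)) \<longlonglongrightarrow> lsq (rep u)"
    proof (rule lsq_tendsto_dominated[where h="rep u"])
      show "L2 (\<lambda>x. indicator (B N) x *\<^sub>R rep u x)" for N
        by (rule L2_dominated[OF L2_rep, of _ 1 u]) (auto simp: indicator_def)
      show "AE x in lborel. norm (indicator (B N) x *\<^sub>R rep u x) \<le> norm (rep u x)" for N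
        by (auto simp: indicator_def)
      show "AE x in lborel. (\<lambda>N. indicator (B N) x *\<^sub>R rep u x) \<longlonglongrightarrow> rep u x"
      proof (rule always_eventually, rule allI, rule tendsto_eventually)
        fix x :: 'a
        obtain n where n: "norm x < real n" using reals_Archimedean2 by blast
        show "\<forall>\<^sub>F N in sequentially. indicator (B N) x *\<^sub>R rep u x = rep u x"
          using eventually_ge_at_top[of n]
        proof eventually_elim
          case (elim N)
          have "- real N < x \<bullet> i \<and> x \<bullet> i < real N" if "i \<in> Basis" for i
            using Basis_le_norm[OF that, of x] n elim by linarith
          then have "x \<in> B N" by (simp add: B_def box_def)
          then show ?case by simp
        qed
      qed
    qed auto
  qed
  then show ?thesis by simp
qed

text \<open>The orthogonal complement of \<open>u\<close> is a closed subspace. By hypothesis it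
  contains all bumps times vectors, hence every class, hence \<open>u\<close> itself.\<close>

lemma lsq_eq_0I:
  fixes u :: "('a::euclidean_space, complex ^ 'm::finite) lsq"
  assumes "\<And>\<psi>. testfun \<psi> \<Longrightarrow> pair \<psi> u = 0"
  shows "u = 0"
proof -
  have "u \<in> {w. inner w u = 0}"
  proof (rule lsq_dense_induct)
    show "closed {w. inner w u = 0}"
      by (intro closed_Collect_eq continuous_intros)
    show "subspace {w. inner w u = 0}"
      by (auto simp: subspace_def inner_add_left)
    fix n and a b :: 'a and v :: "complex ^ 'm"
    let ?b = "bump (real (Suc n)) a b" let ?\<psi> = "\<lambda>x. complex_of_real (?b x)"
    have t: "testfun ?\<psi>" by (rule testfun_bump) simp
    have [measurable]: "?b \<in> borel_measurable borel"
      by (intro borel_measurable_continuous_onI Ck_continuous[OF Ck_bump[of 0]])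
    have m: "(\<lambda>x. ?b x *\<^sub>R v) \<in> borel_measurable borel" by measurable
    have L: "L2 (\<lambda>x. ?b x *\<^sub>R v)"
      by (rule L2_dominated[OF testfun_L2[OF t] m, where C="norm v"]) auto
    have "inner (lsq (\<lambda>x. ?b x *\<^sub>R v)) u = (\<integral>x. inner v (?\<psi> x *s rep u x) \<partial>lborel)"
      unfolding inner_lsq_def
    proof (rule integral_cong_AE)
      show "AE x in lborel. inner (rep (lsq (\<lambda>x. ?b x *\<^sub>R v)) x) (rep u x) = inner v (?\<psi> x *s rep u x)"
        using AE_rep_lsq[OF L]
      proof eventually_elim
        case (elim x)
        have "?\<psi> x *s rep u x = ?b x *\<^sub>R rep u x" by (simp add: vec_eq_iff scaleR_conv_of_real[where 'a=complex])
        then show ?case using elim by simp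
      qed
    qed measurable
    also have "\<dots> = inner v (pair ?\<psi> u)"
      unfolding pair_def by (rule integral_inner_right)
        (rule L2_integrable_vsm[OF testfun_L2[OF t] L2_rep])
    finally show "lsq (\<lambda>x. ?b x *\<^sub>R v) \<in> {w. inner w u = 0}" using assms[OF t] by simp
  qed
  then show ?thesis by simp
qed

text \<open>The classes with this property form a closed subspace because translations are linear
  isometries. For a bump it follows from continuity and a common compact support of the small
  translates.\<close>

lemma translate_tendsto:
  fixes u :: "('a::euclidean_space, 'b::euclidean_space) lsq"
  shows "((\<lambda>z. translate z u) \<longlongrightarrow> u) (at 0)"
proof -
  interpret T: bounded_linear "translate z :: ('a, 'b) lsq \<Rightarrow> _" for z by (rule bounded_linear_translate)
  have "u \<in> {u. ((\<lambda>z. translate z u) \<longlongrightarrow> u) (at 0)}"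
  proof (rule lsq_dense_induct)
    show "subspace {u :: ('a, 'b) lsq. ((\<lambda>z. translate z u) \<longlongrightarrow> u) (at 0)}"
      by (auto simp: subspace_def T.add T.scaleR T.zero intro!: tendsto_intros)
    show "closed {u :: ('a, 'b) lsq. ((\<lambda>z. translate z u) \<longlongrightarrow> u) (at 0)}"
      unfolding closed_sequential_limits
    proof safe
      fix U :: "nat \<Rightarrow> ('a, 'b) lsq" and l
      assume U: "\<forall>n. U n \<in> {u. ((\<lambda>z. translate z u) \<longlongrightarrow> u) (at 0)}" and l: "U \<longlonglongrightarrow> l"
      show "((\<lambda>z. translate z l) \<longlongrightarrow> l) (at 0)"
      proof (rule tendstoI)
        fix e :: real assume e: "0 < e"
        obtain n where n: "dist (U n) l < e / 3"
          using metric_LIMSEQ_D[OF l, of "e/3"] e by auto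
        have "\<forall>\<^sub>F z in at 0. dist (translate z (U n)) (U n) < e / 3"
          using tendstoD[of "\<lambda>z. translate z (U n)" "U n" "at 0" "e/3"] U e by simp
        then show "\<forall>\<^sub>F z in at 0. dist (translate z l) l < e"
        proof eventually_elim
          case (elim z)
          have "dist (translate z l) (translate z (U n)) = dist l (U n)"
            by (simp add: dist_norm T.diff[symmetric])
          then show ?case using elim n dist_triangle[of "translate z l" l "translate z (U n)"]
            dist_triangle[of "translate z (U n)" l "U n"] by (simp add: dist_commute)
        qed
      qed
    qed
    fix n and a b :: 'a and v :: 'b
    let ?b = "bump (real (Suc n)) a b" let ?f = "\<lambda>x. ?b x *\<^sub>R v"
    \<comment> \<open>Outside \<open>K\<close> every translate by a vector of norm at most 1
      vanishes, so the indicator of \<open>K\<close> yields one dominating function.\<close>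
    define K where "K = {x - y | x y. x \<in> cbox a b \<and> y \<in> cball 0 1}"
    have K: "compact K" unfolding K_def by (intro compact_differences compact_cbox compact_cball)
    have cont: "continuous_on UNIV ?f"
      by (intro continuous_intros Ck_continuous[OF Ck_bump[of 0]])
    have m[measurable]: "?f \<in> borel_measurable borel"
      by (intro borel_measurable_continuous_onI cont)
    have bd: "norm (?f x) \<le> norm v" for x
      using bump_bounds[of "real (Suc n)" a b x] by (simp add: mult_left_le_one_le)
    have zero: "?f (x + z) = 0" if "norm z \<le> 1" "x \<notin> K" for x z
    proof -
      have "x + z \<notin> cbox a b"
      proof
        assume *: "x + z \<in> cbox a b"
        have "\<exists>x' y. x = x' - y \<and> x' \<in> cbox a b \<and> y \<in> cball 0 1"
          by (rule exI[of _ "x + z"], rule exI[of _ z]) (use * that(1) in auto)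
        then show False using that(2) by (simp add: K_def)
      qed
      then have "x + z \<notin> box a b" using box_subset_cbox by blast
      then show ?thesis using bump_outside[of "real (Suc n)" "x + z" a b] by (simp del: of_nat_Suc)
    qed
    have L: "L2 (\<lambda>x. ?f (x + z))" if "norm z \<le> 1" for z
      by (rule L2_compact_support(1)[OF K zero[OF that] measurable_compose[OF _ m] bd]) simp_all
    have Lf: "L2 ?f" using L[of 0] by simp
    have "((\<lambda>z. translate z (lsq ?f)) \<longlongrightarrow> lsq ?f) (at 0)"
      unfolding tendsto_at_iff_sequentially comp_def
    proof safe
      fix Z :: "nat \<Rightarrow> 'a" assume Z: "Z \<longlonglongrightarrow> 0"
      \<comment> \<open>Only finitely many shifts exceed norm 1; replacing them by 0 makes the
        domination valid for all indices and does not change the limit.\<close>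
      define Z' where "Z' k = (if norm (Z k) \<le> 1 then Z k else 0)" for k
      have ev: "\<forall>\<^sub>F k in sequentially. Z' k = Z k"
      proof -
        have "\<forall>\<^sub>F k in sequentially. dist (Z k) 0 < 1" using tendstoD[OF Z, of 1] by simp
        then show ?thesis by eventually_elim (simp add: Z'_def)
      qed
      then have Z': "Z' \<longlonglongrightarrow> 0"
        using Z by (simp add: tendsto_cong)
      have "(\<lambda>k. lsq (\<lambda>x. ?f (x + Z' k))) \<longlonglongrightarrow> lsq ?f"
      proof (rule lsq_tendsto_dominated[where h="\<lambda>x. indicator K x *\<^sub>R v"])
        show "L2 (\<lambda>x. indicator K x *\<^sub>R v)"
        proof (rule L2_compact_support(1)[OF K])
          have [measurable]: "K \<in> sets borel" using K by (rule borel_compact)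
          show "(\<lambda>x. indicator K x *\<^sub>R v) \<in> borel_measurable borel" by measurable
          show "norm (indicator K x *\<^sub>R v) \<le> norm v" for x by (auto simp: indicator_def)
        qed simp
        show "AE x in lborel. norm (?f (x + Z' k)) \<le> norm (indicator K x *\<^sub>R v)" for k
        proof (intro always_eventually allI)
          fix x
          show "norm (?f (x + Z' k)) \<le> norm (indicator K x *\<^sub>R v)"
            using bd[of "x + Z' k"] zero[of "Z' k" x] by (cases "x \<in> K") (auto simp: Z'_def)
        qed
        show "AE x in lborel. (\<lambda>k. ?f (x + Z' k)) \<longlonglongrightarrow> ?f x"
        proof (intro always_eventually allI)
          fix x
          have "isCont ?f (x + 0)" using cont by (simp add: continuous_on_eq_continuous_at)
          then show "(\<lambda>k. ?f (x + Z' k)) \<longlonglongrightarrow> ?f x"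
            using isCont_tendsto_compose[of "x + 0" ?f "\<lambda>k. x + Z' k"] tendsto_add[OF tendsto_const Z'] by simp
        qed
        show "L2 (\<lambda>x. ?f (x + Z' k))" for k by (rule L) (simp add: Z'_def)
      qed (rule Lf)
      then have "(\<lambda>k. translate (Z' k) (lsq ?f)) \<longlonglongrightarrow> lsq ?f"
        by (simp only: translate_lsq[OF Lf])
      moreover have "\<forall>\<^sub>F k in sequentially. translate (Z' k) (lsq ?f) = translate (Z k) (lsq ?f)"
        using ev by eventually_elim (simp only:)
      ultimately show "(\<lambda>k. translate (Z k) (lsq ?f)) \<longlonglongrightarrow> lsq ?f"
        by (rule Lim_transform_eventually)
    qed
    then show "lsq ?f \<in> {u. ((\<lambda>z. translate z u) \<longlongrightarrow> u) (at 0)}" by simp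
  qed
  then show ?thesis by simp
qed

lemma continuous_on_translate:
  fixes u :: "('a::euclidean_space, 'b::euclidean_space) lsq"
  shows "continuous_on UNIV (\<lambda>z. translate z u)"
proof -
  interpret T: bounded_linear "translate z :: ('a, 'b) lsq \<Rightarrow> _" for z by (rule bounded_linear_translate)
  have "((\<lambda>h. translate (z + h) u) \<longlongrightarrow> translate z u) (at 0)" for z
  proof (rule LIM_zero_cancel, rule tendsto_norm_zero_cancel)
    have "norm (translate (z + h) u - translate z u) = norm (translate h u - u)" for h
      by (metis T.diff norm_translate translate_translate)
    moreover have "((\<lambda>h. norm (translate h u - u)) \<longlongrightarrow> 0) (at 0)"
      by (intro tendsto_norm_zero LIM_zero translate_tendsto)
    ultimately show "((\<lambda>h. norm (translate (z + h) u - translate z u)) \<longlongrightarrow> 0) (at 0)" by simp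
  qed
  then show ?thesis
    by (simp add: continuous_on_eq_continuous_at isCont_iff)
qed

section \<open>Mild solutions and bounded perturbations\<close>

text \<open>Riemann sums are linear combinations of values of \<open>f\<close>, so they lie in
  \<open>S\<close>, and the integral is their limit. Applied to a closed graph, this moves a closed
  operator under the integral sign.\<close>

lemma integral_in_closed_subspace:
  fixes f :: "real \<Rightarrow> 'x::banach"
  assumes cl: "closed S" and sub: "subspace S" and int: "f integrable_on {a..b}"
    and S: "\<And>x. x \<in> {a..b} \<Longrightarrow> f x \<in> S"
  shows "integral {a..b} f \<in> S"
proof -
  have "\<exists>y\<in>S. dist y (integral {a..b} f) < e" if "0 < e" for e
  proof -
    obtain g where g: "gauge g" "\<And>D. D tagged_division_of {a..b} \<Longrightarrow> g fine D \<Longrightarrow>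
        norm ((\<Sum>(x,k)\<in>D. measure lborel k *\<^sub>R f x) - integral {a..b} f) < e"
      using integrable_integral[OF int] \<open>0 < e\<close> unfolding has_integral_real by metis
    obtain D where D: "D tagged_division_of {a..b}" "g fine D"
      using fine_division_exists_real[OF g(1)] by blast
    have "(\<Sum>(x,k)\<in>D. measure lborel k *\<^sub>R f x) \<in> S"
    proof (rule subspace_sum[OF sub])
      fix p assume p: "p \<in> D"
      obtain x k where "p = (x, k)" by (cases p)
      then have "x \<in> {a..b}" using tag_in_interval[OF D(1)] p by blast
      then show "(case p of (x, k) \<Rightarrow> measure lborel k *\<^sub>R f x) \<in> S"
        using \<open>p = (x, k)\<close> by (simp add: subspace_scale[OF sub] S)
    qed
    then show ?thesis using g(2)[OF D] by (auto simp: dist_norm)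
  qed
  then have "integral {a..b} f \<in> closure S" by (simp add: closure_approachable)
  then show ?thesis using cl by (simp add: closure_closed)
qed

lemma integral_Pair_in_closed_subspace:
  fixes f :: "real \<Rightarrow> 'x::banach" and g :: "real \<Rightarrow> 'y::banach"
  assumes "closed S" "subspace S" "continuous_on {a..b} f" "continuous_on {a..b} g"
    and "\<And>x. x \<in> {a..b} \<Longrightarrow> (f x, g x) \<in> S"
  shows "(integral {a..b} f, integral {a..b} g) \<in> S"
proof -
  let ?h = "\<lambda>x. (f x, g x)"
  have int: "?h integrable_on {a..b}"
    using assms(3,4) by (intro integrable_continuous_interval continuous_intros)
  have "integral {a..b} f = fst (integral {a..b} ?h)" "integral {a..b} g = snd (integral {a..b} ?h)"
    using integral_linear[OF int bounded_linear_fst] integral_linear[OF int bounded_linear_snd] by (simp_all add: o_def)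
  then show ?thesis
    using integral_in_closed_subspace[OF assms(1,2) int assms(5)] by simp
qed

text \<open>\<open>G\<close> is the graph of the spatial operator, kept as a relation so that no
  domain has to be named. The condition is the evolution equation integrated from 0 to
  \<open>t\<close>, the operator being applied to the integral of \<open>U\<close> rather than to
  \<open>U\<close>.\<close>

definition mild :: "('x \<times> 'x) set \<Rightarrow> ('x \<Rightarrow> 'x) \<Rightarrow> 'x::banach \<Rightarrow> (real \<Rightarrow> 'x) \<Rightarrow> bool" where
  "mild G B u U \<longleftrightarrow> continuous_on {0..} U \<and> U 0 = u \<and>
     (\<forall>t\<ge>0. (integral {0..t} U, u - U t - integral {0..t} (\<lambda>s. B (U s))) \<in> G)"

definition mild_wp :: "('x \<times> 'x) set \<Rightarrow> ('x \<Rightarrow> 'x::banach) \<Rightarrow> bool" where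
  "mild_wp G B \<longleftrightarrow> (\<exists>K>0. \<exists>\<alpha>. \<forall>u. \<exists>U. mild G B u U \<and> (\<forall>V. mild G B u V \<longrightarrow> (\<forall>t\<ge>0. V t = U t)) \<and>
     (\<forall>t\<ge>0. norm (U t) \<le> K * exp (\<alpha> * t) * norm u))"

lemma integrable_continuous_nonneg:
  fixes f :: "real \<Rightarrow> 'x::banach"
  assumes "continuous_on {0..} f" "0 \<le> a" shows "f integrable_on {a..t}"
  by (rule integrable_continuous_interval) (rule continuous_on_subset[OF assms(1)], use assms(2) in auto)

lemma continuous_on_nonnegI:
  fixes f :: "real \<Rightarrow> 'x::topological_space"
  assumes "\<And>a. 0 \<le> a \<Longrightarrow> continuous_on {0..a} f" shows "continuous_on {0..} f"
proof -
  have "continuous (at t within {0..}) f" if "0 \<le> t" for t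
  proof -
    have "continuous (at t within {0..t+1}) f"
      using assms[of "t+1"] that by (simp add: continuous_on_eq_continuous_within)
    moreover have "at t within {0..t+1} = at t within {0..}"
      by (rule at_within_nhd[of _ "{..<t+1}"]) auto
    ultimately show ?thesis by (simp add: continuous_within)
  qed
  then show ?thesis by (simp add: continuous_on_eq_continuous_within)
qed

lemma mild_lincomb:
  assumes sub: "subspace G" and B: "bounded_linear B" and U: "mild G B u U" and V: "mild G B v V"
  shows "mild G B (a *\<^sub>R u + b *\<^sub>R v) (\<lambda>t. a *\<^sub>R U t + b *\<^sub>R V t)"
proof -
  interpret B: bounded_linear B by fact
  have cont: "continuous_on {0..} U" "continuous_on {0..} V" using U V by (auto simp: mild_def)
  then have contB: "continuous_on {0..} (\<lambda>t. B (U t))" "continuous_on {0..} (\<lambda>t. B (V t))"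
    by (auto intro: B.continuous_on)
  note int = integrable_continuous_nonneg[OF _ order_refl]
  show ?thesis
    unfolding mild_def
  proof (intro conjI allI impI)
    fix t :: real assume t: "0 \<le> t"
    have "a *\<^sub>R (integral {0..t} U, u - U t - integral {0..t} (\<lambda>s. B (U s)))
      + b *\<^sub>R (integral {0..t} V, v - V t - integral {0..t} (\<lambda>s. B (V s))) \<in> G"
      using U V t by (intro subspace_add[OF sub] subspace_scale[OF sub]) (auto simp: mild_def)
    moreover have "integral {0..t} (\<lambda>t. a *\<^sub>R U t + b *\<^sub>R V t) = a *\<^sub>R integral {0..t} U + b *\<^sub>R integral {0..t} V"
      using int[OF cont(1), of t] int[OF cont(2), of t]
      by (simp add: integral_add integrable_cmul)
    moreover have "integral {0..t} (\<lambda>t. B (a *\<^sub>R U t + b *\<^sub>R V t))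
      = a *\<^sub>R integral {0..t} (\<lambda>t. B (U t)) + b *\<^sub>R integral {0..t} (\<lambda>t. B (V t))"
      using int[OF contB(1), of t] int[OF contB(2), of t]
      by (simp add: B.add B.scaleR integral_add integrable_cmul)
    ultimately show "(integral {0..t} (\<lambda>t. a *\<^sub>R U t + b *\<^sub>R V t), a *\<^sub>R u + b *\<^sub>R v - (a *\<^sub>R U t + b *\<^sub>R V t)
        - integral {0..t} (\<lambda>t. B (a *\<^sub>R U t + b *\<^sub>R V t))) \<in> G"
      by (simp add: algebra_simps)
  qed (use U V cont in \<open>auto simp: mild_def intro!: continuous_intros\<close>)
qed

section \<open>Solution operators and Duhamel's integral\<close>

locale solution_family =
  fixes G :: "('x::banach \<times> 'x) set" and T :: "real \<Rightarrow> 'x \<Rightarrow> 'x" and K \<alpha> :: real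
  assumes cl: "closed G" and sub: "subspace G" and K: "0 < K"
    and mild: "mild G (\<lambda>_. 0) u (\<lambda>t. T t u)"
    and unique: "mild G (\<lambda>_. 0) u V \<Longrightarrow> 0 \<le> t \<Longrightarrow> V t = T t u"
    and bound: "0 \<le> t \<Longrightarrow> norm (T t u) \<le> K * exp (\<alpha> * t) * norm u"
begin

lemma T_0 [simp]: "T 0 u = u"
  using mild[of u] by (simp add: mild_def)

text \<open>Linearity comes from uniqueness: by superposition the right-hand side is a solution with
  the initial value of the left-hand side.\<close>

lemma T_lincomb: "0 \<le> t \<Longrightarrow> T t (a *\<^sub>R u + b *\<^sub>R v) = a *\<^sub>R T t u + b *\<^sub>R T t v"
  using unique[OF mild_lincomb[OF sub bounded_linear_zero mild mild]] by simp

lemma T_diff: "0 \<le> t \<Longrightarrow> T t (u - v) = T t u - T t v"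
  using T_lincomb[of t 1 u "-1" v] by simp

lemma T_cont: "continuous_on {0..} (\<lambda>t. T t u)"
  using mild[of u] by (simp add: mild_def)

text \<open>Joint continuity: the change of the initial value is controlled by the locally bounded
  operator norms, the change of time by continuity of a single trajectory.\<close>

lemma continuous_on_T [continuous_intros]:
  assumes f: "continuous_on A f" and g: "continuous_on A g" and f0: "\<And>x. x \<in> A \<Longrightarrow> 0 \<le> f x"
  shows "continuous_on A (\<lambda>x. T (f x) (g x))"
  unfolding continuous_on_def
proof
  fix x assume x: "x \<in> A"
  have ev: "\<forall>\<^sub>F y in at x within A. y \<in> A" by (auto simp: eventually_at_filter)
  have "((\<lambda>y. T (f y) (g y - g x)) \<longlongrightarrow> 0) (at x within A)"
  proof (rule Lim_null_comparison)
    show "\<forall>\<^sub>F y in at x within A. norm (T (f y) (g y - g x)) \<le> K * exp (\<alpha> * f y) * norm (g y - g x)"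
      using ev by eventually_elim (simp add: bound f0)
    have "((\<lambda>y. K * exp (\<alpha> * f y) * norm (g y - g x)) \<longlongrightarrow> K * exp (\<alpha> * f x) * norm (g x - g x)) (at x within A)"
      using f g x by (intro tendsto_intros) (auto simp: continuous_on_def)
    then show "((\<lambda>y. K * exp (\<alpha> * f y) * norm (g y - g x)) \<longlongrightarrow> 0) (at x within A)" by simp
  qed
  moreover have "continuous_on A (\<lambda>y. T (f y) (g x))"
    by (rule continuous_on_compose2[OF T_cont f]) (use f0 in auto)
  then have "((\<lambda>y. T (f y) (g x)) \<longlongrightarrow> T (f x) (g x)) (at x within A)"
    using x by (simp add: continuous_on_def)
  ultimately have *: "((\<lambda>y. T (f y) (g y - g x) + T (f y) (g x)) \<longlongrightarrow> 0 + T (f x) (g x)) (at x within A)"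
    by (rule tendsto_add)
  have "\<forall>\<^sub>F y in at x within A. T (f y) (g y - g x) + T (f y) (g x) = T (f y) (g y)"
    using ev by eventually_elim (simp add: T_diff f0)
  with * have "((\<lambda>y. T (f y) (g y)) \<longlongrightarrow> 0 + T (f x) (g x)) (at x within A)"
    by (rule Lim_transform_eventually)
  then show "((\<lambda>y. T (f y) (g y)) \<longlongrightarrow> T (f x) (g x)) (at x within A)" by simp
qed

text \<open>Duhamel's integral, the response at time \<open>t\<close> to the source \<open>F\<close>
  when the initial value is 0.\<close>

definition D :: "(real \<Rightarrow> 'x) \<Rightarrow> real \<Rightarrow> 'x" where
  "D F t = integral {0..t} (\<lambda>s. T (t - s) (F s))"

context
  fixes F :: "real \<Rightarrow> 'x" and a :: real
  assumes F: "continuous_on {0..} F" and a: "0 \<le> a"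
begin

lemma F_ivl: "0 \<le> b \<Longrightarrow> continuous_on {b..c} F"
  by (rule continuous_on_subset[OF F]) auto

text \<open>Extending \<open>T\<close> by the identity to negative times gives an integrand that is continuous on the
  whole square, so that Fubini's theorem for continuous functions applies to the triangle.\<close>

lemma cont_square: "continuous_on ({0..a} \<times> {0..a}) (\<lambda>(t, s). T (max 0 (t - s)) (F s))"
  unfolding case_prod_beta
  by (intro continuous_intros continuous_on_compose2[OF F]) auto

lemma D_square:
  assumes t: "t \<in> {0..a}"
  shows "D F t = integral {0..a} (\<lambda>s. T (max 0 (t - s)) (F s)) - integral {0..a} F + integral {0..t} F"
proof -
  have "continuous_on {0..a} (\<lambda>s. T (max 0 (t - s)) (F s))"
    by (intro continuous_intros F_ivl) auto
  then have "integral {0..a} (\<lambda>s. T (max 0 (t - s)) (F s))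
    = integral {0..t} (\<lambda>s. T (max 0 (t - s)) (F s)) + integral {t..a} (\<lambda>s. T (max 0 (t - s)) (F s))"
    using t by (intro Henstock_Kurzweil_Integration.integral_combine[symmetric] integrable_continuous_interval) auto
  also have "integral {0..t} (\<lambda>s. T (max 0 (t - s)) (F s)) = D F t"
    unfolding D_def by (rule Henstock_Kurzweil_Integration.integral_cong) (auto simp: max_def)
  also have "integral {t..a} (\<lambda>s. T (max 0 (t - s)) (F s)) = integral {t..a} F"
    by (rule Henstock_Kurzweil_Integration.integral_cong) (auto simp: max_def)
  also have "integral {t..a} F = integral {0..a} F - integral {0..t} F"
    using Henstock_Kurzweil_Integration.integral_combine[of 0 t a F] t F_ivl[of 0 a]
    by (simp add: integrable_continuous_interval algebra_simps)
  finally show ?thesis by simp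
qed

lemma continuous_on_D_ivl: "continuous_on {0..a} (D F)"
proof -
  have "continuous_on {0..a} (\<lambda>t. integral (cbox 0 a) (\<lambda>s. T (max 0 (t - s)) (F s)))"
    by (rule integral_continuous_on_param) (use cont_square in simp)
  moreover have "continuous_on {0..a} (\<lambda>t. integral {0..t} F)"
    by (rule indefinite_integral_continuous_1) (intro integrable_continuous_interval F_ivl order_refl)
  ultimately have "continuous_on {0..a} (\<lambda>t. integral {0..a} (\<lambda>s. T (max 0 (t - s)) (F s)) - integral {0..a} F + integral {0..t} F)"
    by (intro continuous_intros) simp_all
  then show ?thesis
    by (rule continuous_on_eq) (simp add: D_square)
qed

text \<open>Integration by parts for t times the primitive of \<open>F\<close>. It serves to remove
  the terms that the extension of \<open>T\<close> by the identity adds to the double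
  integrals.\<close>

lemma integral_tF: "integral {0..a} (\<lambda>t. integral {0..t} F) + integral {0..a} (\<lambda>t. t *\<^sub>R F t) = a *\<^sub>R integral {0..a} F"
proof -
  let ?\<Phi> = "\<lambda>t. integral {0..t} F"
  have c: "continuous_on {0..a} ?\<Phi>"
    by (rule indefinite_integral_continuous_1) (intro integrable_continuous_interval F_ivl order_refl)
  have "((\<lambda>t. ?\<Phi> t + t *\<^sub>R F t) has_integral (a *\<^sub>R ?\<Phi> a - 0 *\<^sub>R ?\<Phi> 0)) {0..a}"
  proof (rule fundamental_theorem_of_calculus[OF a])
    fix t assume "t \<in> {0..a}"
    then have "(?\<Phi> has_vector_derivative F t) (at t within {0..a})"
      by (intro integral_has_vector_derivative F_ivl) auto
    then show "((\<lambda>t. t *\<^sub>R ?\<Phi> t) has_vector_derivative ?\<Phi> t + t *\<^sub>R F t) (at t within {0..a})"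
      by (auto intro!: derivative_eq_intros simp: add.commute)
  qed
  then have "integral {0..a} (\<lambda>t. ?\<Phi> t + t *\<^sub>R F t) = a *\<^sub>R ?\<Phi> a" by (simp add: integral_unique)
  then show ?thesis
    by (subst integral_add[symmetric]) (auto intro!: integrable_continuous_interval continuous_intros c F_ivl)
qed

lemma inner_integral:
  assumes s: "s \<in> {0..a}"
  shows "integral {0..a} (\<lambda>t. T (max 0 (t - s)) (F s)) = s *\<^sub>R F s + integral {0..a - s} (\<lambda>r. T r (F s))"
proof -
  have "continuous_on {0..a} (\<lambda>t. T (max 0 (t - s)) (F s))"
    by (intro continuous_intros) auto
  then have "integral {0..a} (\<lambda>t. T (max 0 (t - s)) (F s))
    = integral {0..s} (\<lambda>t. T (max 0 (t - s)) (F s)) + integral {s..a} (\<lambda>t. T (max 0 (t - s)) (F s))"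
    using s by (intro Henstock_Kurzweil_Integration.integral_combine[symmetric] integrable_continuous_interval) auto
  also have "integral {0..s} (\<lambda>t. T (max 0 (t - s)) (F s)) = integral {0..s} (\<lambda>t. F s)"
    by (rule Henstock_Kurzweil_Integration.integral_cong) (auto simp: max_def)
  also have "integral {0..s} (\<lambda>t. F s) = s *\<^sub>R F s" using s by simp
  also have "integral {s..a} (\<lambda>t. T (max 0 (t - s)) (F s)) = integral {s..a} (\<lambda>t. T (t - s) (F s))"
    by (rule Henstock_Kurzweil_Integration.integral_cong) (auto simp: max_def)
  also have "\<dots> = integral {0..a - s} (\<lambda>r. T r (F s))"
    using integral_shift_real_ivl[of s s a "\<lambda>t. T (t - s) (F s)"] by simp
  finally show ?thesis .
qed

text \<open>The integrated inhomogeneous equation with source \<open>F\<close>. Exchanging the order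
  of integration turns the integral of \<open>D F\<close> into an integral over s of
  \<open>integral {0..a - s} (\<lambda>r. T r (F s))\<close>. For each s, the homogeneous equation
  started at \<open>F s\<close> places this in relation \<open>G\<close> with
  \<open>F s - T (a - s) (F s)\<close>, and the closed subspace is preserved by integration in
  s.\<close>

lemma D_in_G: "(integral {0..a} (D F), integral {0..a} F - D F a) \<in> G"
proof -
  let ?J = "\<lambda>s. integral {0..a - s} (\<lambda>r. T r (F s))"
  let ?P = "\<lambda>t. integral {0..a} (\<lambda>s. T (max 0 (t - s)) (F s))"
  let ?Q = "\<lambda>s. integral {0..a} (\<lambda>t. T (max 0 (t - s)) (F s))"
  have cP: "continuous_on {0..a} ?P"
    using integral_continuous_on_param[of "{0..a}" 0 a "\<lambda>t s. T (max 0 (t - s)) (F s)"] cont_square by simp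
  have "continuous_on ({0..a} \<times> {0..a}) (\<lambda>(s, t). T (max 0 (t - s)) (F s))"
    unfolding case_prod_beta by (intro continuous_intros continuous_on_compose2[OF F]) auto
  then have cQ: "continuous_on {0..a} ?Q"
    using integral_continuous_on_param[of "{0..a}" 0 a "\<lambda>s t. T (max 0 (t - s)) (F s)"] by simp
  have "continuous_on {0..a} (\<lambda>s. ?Q s - s *\<^sub>R F s)"
    by (intro continuous_intros cQ F_ivl order_refl)
  then have cJ: "continuous_on {0..a} ?J"
    by (rule continuous_on_eq) (simp add: inner_integral)
  have ctF: "continuous_on {0..a} (\<lambda>t. t *\<^sub>R F t)"
    by (intro continuous_intros F_ivl order_refl)
  have cI: "continuous_on {0..a} (\<lambda>t. integral {0..t} F)"
    by (rule indefinite_integral_continuous_1) (intro integrable_continuous_interval F_ivl order_refl)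
  have "integral {0..a} ?P = integral {0..a} ?Q"
    using integral_swap_continuous[of 0 0 a a "\<lambda>t s. T (max 0 (t - s)) (F s)"] cont_square
    by (simp add: cbox_Pair_eq)
  also have "\<dots> = integral {0..a} (\<lambda>s. s *\<^sub>R F s + ?J s)"
    by (rule Henstock_Kurzweil_Integration.integral_cong) (simp add: inner_integral)
  also have "\<dots> = integral {0..a} (\<lambda>s. s *\<^sub>R F s) + integral {0..a} ?J"
    by (intro integral_add integrable_continuous_interval cJ ctF)
  finally have P: "integral {0..a} ?P = integral {0..a} (\<lambda>s. s *\<^sub>R F s) + integral {0..a} ?J" .
  have "integral {0..a} (D F) = integral {0..a} (\<lambda>t. ?P t - integral {0..a} F + integral {0..t} F)"
    by (rule Henstock_Kurzweil_Integration.integral_cong) (rule D_square)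
  also have "\<dots> = integral {0..a} ?P - a *\<^sub>R integral {0..a} F + integral {0..a} (\<lambda>t. integral {0..t} F)"
    using a by (subst integral_add; (subst Henstock_Kurzweil_Integration.integral_diff)?)
      (auto intro!: integrable_continuous_interval continuous_intros cP cI)
  \<comment> \<open>The contributions of the region s > t, where the integrand is artificial, cancel
    by \<open>integral_tF\<close>; only the triangle remains.\<close>
  also have "\<dots> = integral {0..a} ?J"
    using integral_tF P by (simp add: algebra_simps)
  finally have *: "integral {0..a} (D F) = integral {0..a} ?J" .
  have "(integral {0..a} ?J, integral {0..a} (\<lambda>s. F s - T (a - s) (F s))) \<in> G"
  proof (rule integral_Pair_in_closed_subspace[OF cl sub cJ])
    show "continuous_on {0..a} (\<lambda>s. F s - T (a - s) (F s))"
      by (intro continuous_intros F_ivl) auto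
    show "(?J s, F s - T (a - s) (F s)) \<in> G" if "s \<in> {0..a}" for s
      using mild[of "F s"] that by (auto simp: mild_def)
  qed
  also have "integral {0..a} (\<lambda>s. F s - T (a - s) (F s)) = integral {0..a} F - D F a"
    unfolding D_def
    by (rule Henstock_Kurzweil_Integration.integral_diff)
      (auto intro!: integrable_continuous_interval continuous_intros F_ivl)
  finally show ?thesis unfolding * .
qed

text \<open>The solution operator grows with exponent \<alpha> and the source with exponent \<beta>,
  so integrating the product gains the factor 1/(\<beta> - \<alpha>). A large \<beta> thus makes
  Duhamel's operator small in the weighted norm.\<close>

lemma norm_D:
  assumes \<beta>: "\<alpha> < \<beta>" and M: "0 \<le> M" and le: "\<And>s. s \<in> {0..a} \<Longrightarrow> norm (F s) \<le> M * exp (\<beta> * s)"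
  shows "norm (D F a) \<le> K * M / (\<beta> - \<alpha>) * exp (\<beta> * a)"
proof -
  have I: "((\<lambda>s. K * M * exp (\<alpha> * a + (\<beta> - \<alpha>) * s)) has_integral
      (K * M / (\<beta> - \<alpha>) * exp (\<alpha> * a + (\<beta> - \<alpha>) * a) - K * M / (\<beta> - \<alpha>) * exp (\<alpha> * a + (\<beta> - \<alpha>) * 0))) {0..a}"
    by (rule fundamental_theorem_of_calculus[OF a])
      (use \<beta> in \<open>auto intro!: derivative_eq_intros simp: has_real_derivative_iff_has_vector_derivative[symmetric]\<close>)
  have "norm (D F a) \<le> integral {0..a} (\<lambda>s. K * M * exp (\<alpha> * a + (\<beta> - \<alpha>) * s))"
    unfolding D_def
  proof (rule Henstock_Kurzweil_Integration.integral_norm_bound_integral)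
    show "(\<lambda>s. T (a - s) (F s)) integrable_on {0..a}"
      by (auto intro!: integrable_continuous_interval continuous_intros F_ivl)
    show "(\<lambda>s. K * M * exp (\<alpha> * a + (\<beta> - \<alpha>) * s)) integrable_on {0..a}"
      using I by blast
    fix s assume s: "s \<in> {0..a}"
    have "norm (T (a - s) (F s)) \<le> K * exp (\<alpha> * (a - s)) * norm (F s)"
      using s by (intro bound) auto
    also have "\<dots> \<le> K * exp (\<alpha> * (a - s)) * (M * exp (\<beta> * s))"
      using le[OF s] K by (intro mult_left_mono) auto
    also have "\<dots> = K * M * exp (\<alpha> * a + (\<beta> - \<alpha>) * s)"
      by (simp add: exp_add[symmetric] exp_diff algebra_simps)
    finally show "norm (T (a - s) (F s)) \<le> K * M * exp (\<alpha> * a + (\<beta> - \<alpha>) * s)" .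
  qed
  also have "\<dots> = K * M / (\<beta> - \<alpha>) * exp (\<beta> * a) - K * M / (\<beta> - \<alpha>) * exp (\<alpha> * a)"
    using integral_unique[OF I] by (simp add: algebra_simps)
  also have "\<dots> \<le> K * M / (\<beta> - \<alpha>) * exp (\<beta> * a)"
    using \<beta> M K by simp
  finally show ?thesis .
qed

end

lemma continuous_on_D:
  assumes F: "continuous_on {0..} F" shows "continuous_on {0..} (D F)"
  by (intro continuous_on_nonnegI continuous_on_D_ivl[OF F])

lemma D_diff:
  assumes "continuous_on {0..} F" "continuous_on {0..} H" "0 \<le> t"
  shows "D (\<lambda>s. F s - H s) t = D F t - D H t"
proof -
  have "D (\<lambda>s. F s - H s) t = integral {0..t} (\<lambda>s. T (t - s) (F s) - T (t - s) (H s))"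
    unfolding D_def by (rule Henstock_Kurzweil_Integration.integral_cong) (simp add: T_diff)
  also have "\<dots> = D F t - D H t"
    unfolding D_def
    by (rule Henstock_Kurzweil_Integration.integral_diff)
      (auto intro!: integrable_continuous_interval continuous_intros
        F_ivl[OF assms(1) assms(3)] F_ivl[OF assms(2) assms(3)])
  finally show ?thesis .
qed

lemma D_0 [simp]: "D F 0 = 0"
  by (simp add: D_def)

end

lemma mild_wp_solution_family:
  assumes "closed G" "subspace G" "mild_wp G (\<lambda>_. 0)"
  obtains T K \<alpha> where "solution_family G T K \<alpha>"
proof -
  obtain K \<alpha> where K: "0 < K" and ex: "\<And>u. \<exists>U. mild G (\<lambda>_. 0) u U \<and>
      (\<forall>V. mild G (\<lambda>_. 0) u V \<longrightarrow> (\<forall>t\<ge>0. V t = U t)) \<and> (\<forall>t\<ge>0. norm (U t) \<le> K * exp (\<alpha> * t) * norm u)"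
    using assms(3) unfolding mild_wp_def by blast
  obtain S where S: "\<And>u. mild G (\<lambda>_. 0) u (S u)"
      "\<And>u V t. mild G (\<lambda>_. 0) u V \<Longrightarrow> 0 \<le> t \<Longrightarrow> V t = S u t"
      "\<And>u t. 0 \<le> t \<Longrightarrow> norm (S u t) \<le> K * exp (\<alpha> * t) * norm u"
    using ex by metis
  have "solution_family G (\<lambda>t u. S u t) K \<alpha>"
    by standard (use assms K S in auto)
  then show thesis by (rule that)
qed

text \<open>The fixed point equation U = T u - D (B U) is solved on the whole half line at once,
  since the exponential weight makes the map contracting uniformly in time. \<open>D_in_G\<close>
  translates between this equation and the integrated one.\<close>

theorem mild_wp_bounded_perturbation:
  fixes G :: "('x::banach \<times> 'x) set"
  assumes cl: "closed G" and sub: "subspace G" and B: "bounded_linear B" and wp: "mild_wp G (\<lambda>_. 0)"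
  shows "mild_wp G B"
proof -
  obtain T K \<alpha> where "solution_family G T K \<alpha>"
    using mild_wp_solution_family[OF cl sub wp] by blast
  then interpret solution_family G T K \<alpha> .
  interpret B: bounded_linear B by (rule B)
  obtain b where b: "0 < b" "\<And>x. norm (B x) \<le> norm x * b" using B.pos_bounded by blast
  \<comment> \<open>With this exponent \<open>K * b / (\<beta> - \<alpha>)\<close> is 1/2, the
    contraction constant.\<close>
  define \<beta> where "\<beta> = \<alpha> + 2 * K * b"
  have \<beta>: "\<alpha> < \<beta>" using K b by (simp add: \<beta>_def)
  have q: "K * (b * M) / (\<beta> - \<alpha>) = M / 2" for M
    using K b by (simp add: \<beta>_def)
  have D_bound: "norm (D (\<lambda>s. B (F s)) t) \<le> M / 2 * exp (\<beta> * t)"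
    if F: "continuous_on {0..} F" and t: "0 \<le> t" and M: "0 \<le> M"
      and le: "\<And>s. s \<in> {0..t} \<Longrightarrow> norm (F s) \<le> M * exp (\<beta> * s)" for F t M
  proof -
    have "norm (B (F s)) \<le> b * M * exp (\<beta> * s)" if "s \<in> {0..t}" for s
    proof -
      have "norm (B (F s)) \<le> norm (F s) * b" by (rule b(2))
      also have "\<dots> \<le> M * exp (\<beta> * s) * b" using b(1) by (intro mult_right_mono le that) simp
      finally show ?thesis by (simp add: mult_ac)
    qed
    then have "norm (D (\<lambda>s. B (F s)) t) \<le> K * (b * M) / (\<beta> - \<alpha>) * exp (\<beta> * t)"
      using M b(1) by (intro norm_D[OF B.continuous_on[OF F] t \<beta>]) auto
    then show ?thesis by (simp add: q)
  qed
  \<comment> \<open>The unknown \<open>g\<close> is the solution divided by the weight, so the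
    weighted space is the Banach space of bounded continuous functions.\<close>
  define E :: "(real \<Rightarrow>\<^sub>C 'x) \<Rightarrow> real \<Rightarrow> 'x" where "E g s = exp (\<beta> * s) *\<^sub>R apply_bcontfun g s" for g s
  have E_cont: "continuous_on A (E g)" for g A
    unfolding E_def by (intro continuous_intros) simp
  have E_le: "norm (E g s) \<le> norm g * exp (\<beta> * s)" for g s
    unfolding E_def using norm_bounded[of g s] by (simp add: mult.commute)
  \<comment> \<open>Bounded continuous functions live on the whole line; \<open>max 0 t\<close>
    extends the image by a constant to negative times.\<close>
  define \<Phi> where "\<Phi> u g t = exp (- \<beta> * max 0 t) *\<^sub>R (T (max 0 t) u - D (\<lambda>s. B (E g s)) (max 0 t))" for u g t
  have \<Phi>_le: "norm (\<Phi> u g t) \<le> K * norm u + norm g / 2" for u g t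
  proof -
    let ?t = "max 0 t"
    have "norm (T ?t u) \<le> K * exp (\<beta> * ?t) * norm u"
    proof -
      have "norm (T ?t u) \<le> K * exp (\<alpha> * ?t) * norm u" by (rule bound) simp
      also have "\<dots> \<le> K * exp (\<beta> * ?t) * norm u"
        using \<beta> K by (intro mult_right_mono mult_left_mono) (auto intro: mult_right_mono)
      finally show ?thesis .
    qed
    moreover have "norm (D (\<lambda>s. B (E g s)) ?t) \<le> norm g / 2 * exp (\<beta> * ?t)"
      by (rule D_bound[OF E_cont]) (auto simp: E_le)
    ultimately have "norm (T ?t u - D (\<lambda>s. B (E g s)) ?t) \<le> exp (\<beta> * ?t) * (K * norm u + norm g / 2)"
      using norm_triangle_ineq4[of "T ?t u" "D (\<lambda>s. B (E g s)) ?t"] by (simp add: algebra_simps)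
    then have "exp (- \<beta> * ?t) * norm (T ?t u - D (\<lambda>s. B (E g s)) ?t)
        \<le> exp (- \<beta> * ?t) * (exp (\<beta> * ?t) * (K * norm u + norm g / 2))"
      by (rule mult_left_mono) simp
    then show ?thesis
      by (simp add: \<Phi>_def mult.assoc[symmetric] exp_add[symmetric])
  qed
  have DE_cont: "continuous_on {0..} (D (\<lambda>s. B (E g s)))" for g
    by (intro continuous_on_D B.continuous_on E_cont)
  have \<Phi>_bc: "\<Phi> u g \<in> bcontfun" for u g
  proof (rule bcontfun_normI)
    have "continuous_on UNIV (\<lambda>t. D (\<lambda>s. B (E g s)) (max 0 t))"
      by (rule continuous_on_compose2[OF DE_cont]) (auto intro!: continuous_intros)
    then show "continuous_on UNIV (\<Phi> u g)"
      unfolding \<Phi>_def by (intro continuous_intros) auto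
  qed (rule \<Phi>_le)
  define P where "P u g = Bcontfun (\<Phi> u g)" for u g
  have P: "apply_bcontfun (P u g) t = \<Phi> u g t" for u g t
    unfolding P_def by (simp add: Bcontfun_inverse \<Phi>_bc)
  have "\<exists>!g. P u g = g" for u
  proof (rule banach_fix_type[of "1/2"])
    show "\<forall>g h. dist (P u g) (P u h) \<le> 1 / 2 * dist g h"
    proof (intro allI)
      fix g h :: "real \<Rightarrow>\<^sub>C 'x"
      have "norm (apply_bcontfun (P u g - P u h) t) \<le> 1/2 * norm (g - h)" for t
      proof -
        let ?t = "max 0 t"
        have "apply_bcontfun (P u g - P u h) t
          = exp (- \<beta> * ?t) *\<^sub>R (D (\<lambda>s. B (E h s)) ?t - D (\<lambda>s. B (E g s)) ?t)"
          by (simp add: P \<Phi>_def scaleR_diff_right)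
        also have "D (\<lambda>s. B (E h s)) ?t - D (\<lambda>s. B (E g s)) ?t = - D (\<lambda>s. B (E (g - h) s)) ?t"
        proof -
          have "D (\<lambda>s. B (E (g - h) s)) ?t = D (\<lambda>s. B (E g s) - B (E h s)) ?t"
            by (simp add: E_def B.diff B.scaleR scaleR_diff_right)
          also have "\<dots> = D (\<lambda>s. B (E g s)) ?t - D (\<lambda>s. B (E h s)) ?t"
            by (rule D_diff) (auto intro: B.continuous_on E_cont)
          finally show ?thesis by simp
        qed
        finally have "norm (apply_bcontfun (P u g - P u h) t) = exp (- \<beta> * ?t) * norm (D (\<lambda>s. B (E (g - h) s)) ?t)"
          by simp
        also have "\<dots> \<le> exp (- \<beta> * ?t) * (norm (g - h) / 2 * exp (\<beta> * ?t))"
          by (intro mult_left_mono D_bound[OF E_cont]) (auto simp: E_le)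
        also have "\<dots> = 1/2 * norm (g - h)" by (simp add: exp_minus field_simps)
        finally show ?thesis .
      qed
      then show "dist (P u g) (P u h) \<le> 1 / 2 * dist g h"
        unfolding dist_norm by (rule norm_bound)
    qed
  qed auto
  then obtain g where g: "\<And>u. P u (g u) = g u" by metis
  define U where "U u = E (g u)" for u
  have U_cont: "continuous_on A (U u)" for u A unfolding U_def by (rule E_cont)
  have U_eq: "U u t = T t u - D (\<lambda>s. B (U u s)) t" if "0 \<le> t" for u t
  proof -
    have "U u t = exp (\<beta> * t) *\<^sub>R \<Phi> u (g u) t"
      unfolding U_def E_def by (subst g[symmetric]) (simp add: P)
    then show ?thesis using that
      by (simp add: \<Phi>_def U_def exp_add[symmetric])
  qed
  \<comment> \<open>The fixed point satisfies
    \<open>norm (g u) \<le> K * norm u + norm (g u) / 2\<close>; absorbing the last term gives the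
    constant \<open>2 * K\<close>.\<close>
  have U_le: "norm (U u t) \<le> 2 * K * exp (\<beta> * t) * norm u" for u t
  proof -
    have "norm (apply_bcontfun (P u (g u)) t) \<le> K * norm u + norm (g u) / 2" for t
      by (simp add: P \<Phi>_le)
    then have "norm (P u (g u)) \<le> K * norm u + norm (g u) / 2" by (rule norm_bound)
    then have "norm (g u) \<le> 2 * K * norm u" by (simp add: g)
    then have "norm (g u) * exp (\<beta> * t) \<le> 2 * K * norm u * exp (\<beta> * t)" by (rule mult_right_mono) simp
    from order_trans[OF E_le this] show ?thesis by (simp only: U_def mult_ac)
  qed
  note icont = integrable_continuous_nonneg[OF _ order_refl]
  have BU_cont: "continuous_on {0..} (\<lambda>s. B (U u s))" for u by (intro B.continuous_on U_cont)
  have U_mild: "mild G B u (U u)" for u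
    unfolding mild_def
  proof (intro conjI allI impI U_cont)
    show "U u 0 = u" by (simp add: U_eq)
    fix t :: real assume t: "0 \<le> t"
    \<comment> \<open>The homogeneous integrated equation minus the inhomogeneous one with source
      \<open>B (U u s)\<close>; by the fixed point equation this difference is the perturbed
      equation.\<close>
    have "(integral {0..t} (\<lambda>s. T s u), u - T t u) - (integral {0..t} (D (\<lambda>s. B (U u s))),
        integral {0..t} (\<lambda>s. B (U u s)) - D (\<lambda>s. B (U u s)) t) \<in> G"
      using mild[of u] t by (intro subspace_diff[OF sub] D_in_G[OF BU_cont t]) (auto simp: mild_def)
    moreover have "integral {0..t} (\<lambda>s. T s u) - integral {0..t} (D (\<lambda>s. B (U u s))) = integral {0..t} (U u)"
    proof (subst Henstock_Kurzweil_Integration.integral_diff[symmetric])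
      show "integral {0..t} (\<lambda>s. T s u - D (\<lambda>s. B (U u s)) s) = integral {0..t} (U u)"
        by (rule Henstock_Kurzweil_Integration.integral_cong) (simp add: U_eq)
    qed (intro icont T_cont continuous_on_D BU_cont)+
    ultimately show "(integral {0..t} (U u), u - U u t - integral {0..t} (\<lambda>s. B (U u s))) \<in> G"
      by (simp add: U_eq[OF t] algebra_simps)
  qed
  have U_unique: "V a = U u a" if V: "mild G B u V" and a: "0 \<le> a" for u V a
  proof -
    define W where "W t = V t - U u t" for t
    have W: "mild G B 0 W"
      using mild_lincomb[OF sub B V U_mild[of u], of 1 "-1"] by (simp add: W_def[abs_def])
    then have Wc: "continuous_on {0..} W" by (simp add: mild_def)
    have BWc: "continuous_on {0..} (\<lambda>s. B (W s))" by (intro B.continuous_on Wc)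
    let ?D = "D (\<lambda>s. B (W s))"
    \<comment> \<open>Adding Duhamel's integral cancels the perturbation: the sum solves the
      unperturbed problem with zero initial value and therefore vanishes.\<close>
    have "mild G (\<lambda>_. 0) 0 (\<lambda>t. W t + ?D t)"
      unfolding mild_def
    proof (intro conjI allI impI)
      show "continuous_on {0..} (\<lambda>t. W t + ?D t)"
        by (intro continuous_intros Wc continuous_on_D BWc)
      show "W 0 + ?D 0 = 0" using W by (simp add: mild_def)
      fix t :: real assume t: "0 \<le> t"
      have "(integral {0..t} W, 0 - W t - integral {0..t} (\<lambda>s. B (W s)))
         + (integral {0..t} ?D, integral {0..t} (\<lambda>s. B (W s)) - ?D t) \<in> G"
        using W t by (intro subspace_add[OF sub] D_in_G[OF BWc t]) (auto simp: mild_def)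
      moreover have "integral {0..t} (\<lambda>t. W t + ?D t) = integral {0..t} W + integral {0..t} ?D"
        by (intro integral_add icont Wc continuous_on_D BWc)
      ultimately show "(integral {0..t} (\<lambda>t. W t + ?D t), 0 - (W t + ?D t) - integral {0..t} (\<lambda>s. 0)) \<in> G"
        by (simp add: algebra_simps)
    qed
    then have "W t + ?D t = T t 0" if "0 \<le> t" for t using unique that by blast
    moreover have "T t 0 = 0" if "0 \<le> t" for t using T_diff[OF that, of 0 0] by simp
    ultimately have WD: "W t = - ?D t" if "0 \<le> t" for t
      using that by (simp add: eq_neg_iff_add_eq_0)
    \<comment> \<open>A competing solution is not known to be bounded in the weighted norm on the
      half line. The smallness of Duhamel's operator is therefore used on \<open>{0..a}\<close>, at
      a maximum point \<open>c\<close> of the weighted norm, where it gives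
      \<open>M \<le> M / 2\<close>.\<close>
    have "continuous_on {0..a} (\<lambda>t. norm (W t) * exp (- \<beta> * t))"
      by (intro continuous_intros continuous_on_subset[OF Wc]) auto
    then obtain c where c: "c \<in> {0..a}" "\<And>t. t \<in> {0..a} \<Longrightarrow> norm (W t) * exp (- \<beta> * t) \<le> norm (W c) * exp (- \<beta> * c)"
      using continuous_attains_sup[of "{0..a}" "\<lambda>t. norm (W t) * exp (- \<beta> * t)"] a by auto
    define M where "M = norm (W c) * exp (- \<beta> * c)"
    have WM: "norm (W t) \<le> M * exp (\<beta> * t)" if "t \<in> {0..a}" for t
    proof -
      have "norm (W t) * exp (- \<beta> * t) \<le> M" using c(2)[OF that] by (simp only: M_def)
      then show ?thesis by (simp add: exp_minus field_simps)
    qed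
    have "norm (?D c) \<le> M / 2 * exp (\<beta> * c)"
      by (rule D_bound[OF Wc]) (use c(1) WM in \<open>auto simp: M_def\<close>)
    then have "norm (W c) \<le> M / 2 * exp (\<beta> * c)"
      using c(1) by (simp add: WD)
    then have "M \<le> M / 2" by (simp add: M_def exp_minus field_simps)
    then have "M * exp (\<beta> * a) \<le> 0" by (intro mult_nonpos_nonneg) auto
    with WM[of a] a have "norm (W a) \<le> 0" by (simp del: norm_le_zero_iff)
    then show ?thesis by (simp add: W_def)
  qed
  show ?thesis
    unfolding mild_wp_def
  proof (intro exI conjI allI impI)
    show "0 < 2 * K" using K by simp
    show "mild G B u (U u)" for u by (rule U_mild)
    show "V t = U u t" if "mild G B u V" "0 \<le> t" for u V t using that by (rule U_unique)
    show "norm (U u t) \<le> 2 * K * exp (\<beta> * t) * norm u" for u t by (rule U_le)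
  qed
qed

section \<open>An \<open>L\<^sup>2\<close> comparison principle for Fourier transforms\<close>

definition gauss :: "'a::euclidean_space \<Rightarrow> real" where
  "gauss \<xi> = exp (- (norm \<xi>)\<^sup>2 / 2)"

text \<open>Lebesgue measure is the image of a product of one-dimensional measures; this reduces the
  Gaussian transform to dimension one.\<close>

lemma integral_lborel_product:
  fixes f :: "'a::euclidean_space \<Rightarrow> real \<Rightarrow> 'c::{real_normed_field, banach, second_countable_topology}"
  assumes "\<And>b. b \<in> Basis \<Longrightarrow> integrable lborel (f b)"
  shows "integrable lborel (\<lambda>x. \<Prod>b\<in>Basis. f b (x \<bullet> b))"
    and "(\<integral>x. (\<Prod>b\<in>Basis. f b (x \<bullet> b)) \<partial>lborel) = (\<Prod>b\<in>Basis. \<integral>s. f b s \<partial>lborel)"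
proof -
  interpret product_sigma_finite "\<lambda>b::'a. lborel :: real measure" ..
  have [measurable]: "f b \<in> borel_measurable borel" if "b \<in> Basis" for b
    using borel_measurable_integrable[OF assms[OF that]] by simp
  have comp: "(\<Sum>b\<in>Basis. g b *\<^sub>R b) \<bullet> b' = g b'" if "b' \<in> Basis" for g and b' :: 'a
    using that by simp
  have m: "(\<lambda>x. \<Prod>b\<in>Basis. f b (x \<bullet> b)) \<in> borel_measurable borel" by measurable
  have m': "(\<lambda>g. \<Sum>b\<in>Basis. g b *\<^sub>R b) \<in> (\<Pi>\<^sub>M b\<in>Basis. lborel) \<rightarrow>\<^sub>M (borel :: 'a measure)" by measurable
  show "(\<integral>x. (\<Prod>b\<in>Basis. f b (x \<bullet> b)) \<partial>lborel) = (\<Prod>b\<in>Basis. \<integral>s. f b s \<partial>lborel)"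
    by (subst lborel_eq, subst integral_distr[OF m' m])
      (use assms in \<open>simp add: comp product_integral_prod cong: prod.cong\<close>)
  show "integrable lborel (\<lambda>x. \<Prod>b\<in>Basis. f b (x \<bullet> b))"
    by (subst lborel_eq, subst integrable_distr_eq[OF m' m])
      (use assms in \<open>simp add: comp product_integrable_prod cong: prod.cong\<close>)
qed

lemma cis_borel [measurable]: "cis \<in> borel_measurable borel"
  by (intro borel_measurable_continuous_onI continuous_intros)

text \<open>The value is the characteristic function of the standard normal distribution, with the
  normalising factor put back.\<close>

lemma gauss_transform_real:
  "integrable lborel (\<lambda>s. complex_of_real (exp (- s\<^sup>2 / 2)) * cis (t * s))"
  "(\<integral>s. complex_of_real (exp (- s\<^sup>2 / 2)) * cis (t * s) \<partial>lborel) = complex_of_real (sqrt (2 * pi) * exp (- t\<^sup>2 / 2))"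
proof -
  have i: "integrable lborel (\<lambda>s::real. exp (- s\<^sup>2 / 2))"
    using integrable_mult_right[OF integrable_std_normal_moment[of 0], of "sqrt (2 * pi)"]
    by (simp add: std_normal_density_def)
  show "integrable lborel (\<lambda>s. complex_of_real (exp (- s\<^sup>2 / 2)) * cis (t * s))"
    by (rule Bochner_Integration.integrable_bound[OF i]) (simp_all add: norm_mult)
  have "complex_of_real (exp (- t\<^sup>2 / 2)) = (\<integral>s. cis (t * s) \<partial>std_normal_distribution)"
    using char_std_normal_distribution by (simp add: char_def fun_eq_iff cis_conv_exp)
  also have "\<dots> = (\<integral>s. std_normal_density s *\<^sub>R cis (t * s) \<partial>lborel)"
    by (subst integral_density) auto
  also have "\<dots> = (\<integral>s. complex_of_real (1 / sqrt (2 * pi)) * (complex_of_real (exp (- s\<^sup>2 / 2)) * cis (t * s)) \<partial>lborel)"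
    by (simp add: std_normal_density_def scaleR_conv_of_real mult.assoc)
  also have "\<dots> = complex_of_real (1 / sqrt (2 * pi)) * (\<integral>s. complex_of_real (exp (- s\<^sup>2 / 2)) * cis (t * s) \<partial>lborel)"
    by (rule integral_mult_right_zero)
  finally show "(\<integral>s. complex_of_real (exp (- s\<^sup>2 / 2)) * cis (t * s) \<partial>lborel) = complex_of_real (sqrt (2 * pi) * exp (- t\<^sup>2 / 2))"
    by (simp add: field_simps)
qed

lemma gauss_prod: "gauss x = (\<Prod>b\<in>Basis. exp (- (x \<bullet> b)\<^sup>2 / 2))"
proof -
  have "(norm x)\<^sup>2 = (\<Sum>b\<in>Basis. (x \<bullet> b)\<^sup>2)"
    unfolding power2_norm_eq_inner by (subst euclidean_inner) (simp add: power2_eq_square)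
  then show ?thesis
    by (simp add: gauss_def exp_sum[symmetric] sum_negf sum_divide_distrib)
qed

lemma cis_sum: "finite I \<Longrightarrow> cis (\<Sum>i\<in>I. f i) = (\<Prod>i\<in>I. cis (f i))"
  by (induction I rule: finite_induct) (auto simp: cis_mult[symmetric])

lemma gauss_transform:
  fixes z :: "'a::euclidean_space"
  shows "integrable lborel (\<lambda>\<xi>. complex_of_real (gauss \<xi>) * cis (z \<bullet> \<xi>))"
    and "(\<integral>\<xi>. complex_of_real (gauss \<xi>) * cis (z \<bullet> \<xi>) \<partial>lborel) = complex_of_real (sqrt (2 * pi) ^ DIM('a) * gauss z)"
proof -
  have eq: "complex_of_real (gauss \<xi>) * cis (z \<bullet> \<xi>)
      = (\<Prod>b\<in>Basis. complex_of_real (exp (- (\<xi> \<bullet> b)\<^sup>2 / 2)) * cis ((z \<bullet> b) * (\<xi> \<bullet> b)))" for \<xi>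
    by (simp add: gauss_prod euclidean_inner[of z \<xi>] cis_sum prod.distrib)
  show "integrable lborel (\<lambda>\<xi>. complex_of_real (gauss \<xi>) * cis (z \<bullet> \<xi>))"
    unfolding eq by (rule integral_lborel_product(1)[OF gauss_transform_real(1)])
  show "(\<integral>\<xi>. complex_of_real (gauss \<xi>) * cis (z \<bullet> \<xi>) \<partial>lborel) = complex_of_real (sqrt (2 * pi) ^ DIM('a) * gauss z)"
    unfolding eq
    by (subst integral_lborel_product(2)[OF gauss_transform_real(1)])
      (simp only: gauss_transform_real(2), simp add: gauss_prod prod.distrib)
qed

lemma gauss_integrable: "integrable lborel (gauss :: 'a::euclidean_space \<Rightarrow> real)"
  and gauss_integral: "(\<integral>\<xi>. gauss (\<xi>::'a) \<partial>lborel) = sqrt (2 * pi) ^ DIM('a)"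
proof -
  have "integrable lborel (\<lambda>\<xi>::'a. complex_of_real (gauss \<xi>))"
    using gauss_transform(1)[of "0::'a"] by simp
  then show i: "integrable lborel (gauss :: 'a \<Rightarrow> real)"
    using integrable_Re[of lborel "\<lambda>\<xi>::'a. complex_of_real (gauss \<xi>)"] by simp
  have "complex_of_real (\<integral>\<xi>. gauss (\<xi>::'a) \<partial>lborel) = complex_of_real (sqrt (2 * pi) ^ DIM('a))"
    using gauss_transform(2)[of "0::'a"] i by (simp add: gauss_def)
  then show "(\<integral>\<xi>. gauss (\<xi>::'a) \<partial>lborel) = sqrt (2 * pi) ^ DIM('a)"
    using of_real_eq_iff by blast
qed

lemma gauss_borel [measurable]: "gauss \<in> borel_measurable borel"
  unfolding gauss_def by measurable

lemma gauss_pos [simp]: "0 < gauss x" and gauss_minus [simp]: "gauss (- x) = gauss x"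
  and gauss_abs [simp]: "\<bar>gauss x\<bar> = gauss x"
  by (simp_all add: gauss_def)

definition ft :: "('a::euclidean_space \<Rightarrow> complex ^ 'm::finite) \<Rightarrow> 'a \<Rightarrow> complex ^ 'm" where
  "ft p \<xi> = (\<integral>x. cis (- (x \<bullet> \<xi>)) *s p x \<partial>lborel)"

lemma ft_integrable:
  fixes p :: "'a::euclidean_space \<Rightarrow> complex ^ 'm::finite"
  assumes "integrable lborel p" shows "integrable lborel (\<lambda>x. cis (- (x \<bullet> \<xi>)) *s p x)"
proof (rule Bochner_Integration.integrable_bound[OF assms])
  have [measurable]: "p \<in> borel_measurable borel" using assms by auto
  show "(\<lambda>x. cis (- (x \<bullet> \<xi>)) *s p x) \<in> borel_measurable lborel" by measurable
qed simp

lemma ft_borel [measurable]: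
  fixes p :: "'a::euclidean_space \<Rightarrow> complex ^ 'm::finite"
  assumes [measurable]: "p \<in> borel_measurable borel"
  shows "ft p \<in> borel_measurable borel"
  unfolding ft_def by measurable

lemma norm_ft_le:
  assumes "integrable lborel p" shows "norm (ft p \<xi>) \<le> (\<integral>x. norm (p x) \<partial>lborel)"
  unfolding ft_def using integral_norm_bound[of lborel "\<lambda>x. cis (- (x \<bullet> \<xi>)) *s p x"] by simp

lemma inner_cis_cis:
  fixes v w :: "complex ^ 'm::finite"
  shows "inner (cis a *s v) (cis b *s w) = inner v (cis (b - a) *s w)"
proof -
  have "inner (cis a * z) (cis b * y) = inner z (cis (b - a) * y)" for z y
    by (simp add: inner_complex_def cos_diff sin_diff algebra_simps)
  then show ?thesis by (simp add: inner_vec_def)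
qed

lemma integrable_lborel_pair:
  fixes f :: "'a::euclidean_space \<Rightarrow> 'b::euclidean_space \<Rightarrow> real"
  assumes f: "case_prod f \<in> borel_measurable (lborel \<Otimes>\<^sub>M lborel)"
    and a: "integrable lborel a" and b: "integrable lborel b" and le: "\<And>x y. \<bar>f x y\<bar> \<le> a x * b y"
  shows "integrable (lborel \<Otimes>\<^sub>M lborel) (case_prod f)"
proof (rule Bochner_Integration.integrable_bound[OF _ f])
  have [measurable]: "a \<in> borel_measurable borel" "b \<in> borel_measurable borel" using a b by auto
  show "integrable (lborel \<Otimes>\<^sub>M lborel) (\<lambda>z. a (fst z) * b (snd z))"
  proof (rule lborel_pair.Fubini_integrable)
    have "integrable lborel (\<lambda>x. \<bar>a x\<bar> * (\<integral>y. \<bar>b y\<bar> \<partial>lborel))"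
      using a by (intro integrable_mult_left integrable_abs)
    then show "integrable lborel (\<lambda>x. \<integral>y. norm (a (fst (x, y)) * b (snd (x, y))) \<partial>lborel)"
      by (simp add: abs_mult)
    show "AE x in lborel. integrable lborel (\<lambda>y. a (fst (x, y)) * b (snd (x, y)))"
      using b by simp
  qed measurable
  show "AE z in lborel \<Otimes>\<^sub>M lborel. norm (case z of (x, y) \<Rightarrow> f x y) \<le> norm (a (fst z) * b (snd z))"
  proof (intro always_eventually allI)
    fix z :: "'a \<times> 'b"
    show "norm (case z of (x, y) \<Rightarrow> f x y) \<le> norm (a (fst z) * b (snd z))"
      using le[of "fst z" "snd z"] by (simp add: case_prod_beta)
  qed
qed

lemma lborel_integral_affine:
  fixes f :: "'a::euclidean_space \<Rightarrow> real"
  assumes [measurable]: "f \<in> borel_measurable borel" and c: "0 < c"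
  shows "(\<integral>x. f x \<partial>lborel) = c ^ DIM('a) * (\<integral>x. f (t + c *\<^sub>R x) \<partial>lborel)"
  using c by (subst lborel_affine[of c t]) (simp_all add: integral_density integral_distr)

text \<open>In the variable \<xi>/e the weight tends to 1 as e tends to 0, so the left side is a
  regularised energy of the transform. Integrating over \<xi> first leaves a Gaussian of (x - y)/e,
  and the substitution y = x + e z turns the double integral into a Gaussian average of
  autocorrelations of \<open>p\<close>.\<close>

lemma ft_energy:
  fixes p :: "'a::euclidean_space \<Rightarrow> complex ^ 'm::finite"
  assumes p1: "integrable lborel p" and p2: "L2 p" and e: "0 < e"
  shows "(\<integral>\<xi>. gauss \<xi> * (norm (ft p (\<xi> /\<^sub>R e)))\<^sup>2 \<partial>lborel)
    = sqrt (2 * pi) ^ DIM('a) * e ^ DIM('a) * (\<integral>z. gauss z * inner (lsq p) (translate (e *\<^sub>R z) (lsq p)) \<partial>lborel)"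
proof -
  have [measurable]: "p \<in> borel_measurable borel" using p1 by auto
  define N where "N = (\<integral>x. norm (p x) \<partial>lborel)"
  let ?c = "sqrt (2 * pi) ^ DIM('a)"
  define w where "w x \<xi> = cis (- (x \<bullet> (\<xi> /\<^sub>R e))) *s p x" for x \<xi>
  have [measurable]: "(\<lambda>z. w (fst z) (snd z)) \<in> borel_measurable (lborel \<Otimes>\<^sub>M lborel)"
    unfolding w_def by measurable
  have [measurable]: "w x \<in> borel_measurable borel" "(\<lambda>x. w x \<xi>) \<in> borel_measurable borel" for x \<xi>
    unfolding w_def by measurable
  have nw: "norm (w x \<xi>) = norm (p x)" for x \<xi> by (simp add: w_def)
  have wint: "integrable lborel (\<lambda>x. w x \<xi>)" for \<xi>
    unfolding w_def by (rule ft_integrable[OF p1])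
  have ftw: "ft p (\<xi> /\<^sub>R e) = (\<integral>x. w x \<xi> \<partial>lborel)" for \<xi>
    by (simp add: ft_def w_def)
  have [measurable]: "(\<lambda>\<xi>. ft p (\<xi> /\<^sub>R e)) \<in> borel_measurable borel"
    by measurable
  have np: "integrable lborel (\<lambda>x. norm (p x))" using p1 by simp
  have gN: "integrable lborel (\<lambda>\<xi>::'a. gauss \<xi> * C)" for C
    by (intro integrable_mult_left gauss_integrable)
  have "(\<integral>\<xi>. gauss \<xi> * (norm (ft p (\<xi> /\<^sub>R e)))\<^sup>2 \<partial>lborel)
     = (\<integral>\<xi>. (\<integral>x. gauss \<xi> * inner (w x \<xi>) (ft p (\<xi> /\<^sub>R e)) \<partial>lborel) \<partial>lborel)"
  proof (rule Bochner_Integration.integral_cong[OF refl])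
    fix \<xi> :: 'a
    show "gauss \<xi> * (norm (ft p (\<xi> /\<^sub>R e)))\<^sup>2 = (\<integral>x. gauss \<xi> * inner (w x \<xi>) (ft p (\<xi> /\<^sub>R e)) \<partial>lborel)"
      using integral_inner_left[of "ft p (\<xi> /\<^sub>R e)", OF wint[of \<xi>]]
      by (simp add: power2_norm_eq_inner ftw)
  qed
  \<comment> \<open>The two factors of the square are unfolded one at a time; each exchange of
    integrals is dominated by the norm of \<open>p\<close> times a multiple of the Gaussian.\<close>
  also have "\<dots> = (\<integral>x. (\<integral>\<xi>. gauss \<xi> * inner (w x \<xi>) (ft p (\<xi> /\<^sub>R e)) \<partial>lborel) \<partial>lborel)"
  proof (rule lborel_pair.Fubini_integral, rule integrable_lborel_pair[OF _ np gN[of N]])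
    fix x \<xi>
    have "\<bar>inner (w x \<xi>) (ft p (\<xi> /\<^sub>R e))\<bar> \<le> norm (p x) * N"
    proof -
      have "\<bar>inner (w x \<xi>) (ft p (\<xi> /\<^sub>R e))\<bar> \<le> norm (w x \<xi>) * norm (ft p (\<xi> /\<^sub>R e))"
        by (rule Cauchy_Schwarz_ineq2)
      also have "\<dots> \<le> norm (p x) * N"
        unfolding nw N_def by (intro mult_left_mono norm_ft_le[OF p1]) simp
      finally show ?thesis .
    qed
    then have "gauss \<xi> * \<bar>inner (w x \<xi>) (ft p (\<xi> /\<^sub>R e))\<bar> \<le> gauss \<xi> * (norm (p x) * N)"
      by (rule mult_left_mono) (simp add: less_imp_le)
    then show "\<bar>gauss \<xi> * inner (w x \<xi>) (ft p (\<xi> /\<^sub>R e))\<bar> \<le> norm (p x) * (gauss \<xi> * N)"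
      by (simp only: abs_mult gauss_abs mult_ac)
  qed (simp add: case_prod_beta)
  also have "\<dots> = (\<integral>x. (\<integral>y. ?c * gauss ((x - y) /\<^sub>R e) * inner (p x) (p y) \<partial>lborel) \<partial>lborel)"
  proof (rule Bochner_Integration.integral_cong[OF refl])
    fix x :: 'a
    have "(\<integral>\<xi>. gauss \<xi> * inner (w x \<xi>) (ft p (\<xi> /\<^sub>R e)) \<partial>lborel)
      = (\<integral>\<xi>. (\<integral>y. gauss \<xi> * inner (w x \<xi>) (w y \<xi>) \<partial>lborel) \<partial>lborel)"
    proof (rule Bochner_Integration.integral_cong[OF refl])
      fix \<xi> :: 'a
      show "gauss \<xi> * inner (w x \<xi>) (ft p (\<xi> /\<^sub>R e)) = (\<integral>y. gauss \<xi> * inner (w x \<xi>) (w y \<xi>) \<partial>lborel)"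
        using integral_inner_right[of "w x \<xi>", OF wint[of \<xi>]] by (simp add: ftw)
    qed
    also have "\<dots> = (\<integral>y. (\<integral>\<xi>. gauss \<xi> * inner (w x \<xi>) (w y \<xi>) \<partial>lborel) \<partial>lborel)"
    proof (rule lborel_pair.Fubini_integral, rule integrable_lborel_pair[OF _ np gN[of "norm (p x)"]])
      fix y \<xi>
      have "\<bar>inner (w x \<xi>) (w y \<xi>)\<bar> \<le> norm (p x) * norm (p y)"
        using Cauchy_Schwarz_ineq2[of "w x \<xi>" "w y \<xi>"] by (simp add: nw)
      then have "gauss \<xi> * \<bar>inner (w x \<xi>) (w y \<xi>)\<bar> \<le> gauss \<xi> * (norm (p x) * norm (p y))"
        by (rule mult_left_mono) (simp add: less_imp_le)
      then show "\<bar>gauss \<xi> * inner (w x \<xi>) (w y \<xi>)\<bar> \<le> norm (p y) * (gauss \<xi> * norm (p x))"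
        by (simp only: abs_mult gauss_abs mult_ac)
    qed (simp add: case_prod_beta)
    also have "\<dots> = (\<integral>y. ?c * gauss ((x - y) /\<^sub>R e) * inner (p x) (p y) \<partial>lborel)"
    proof (rule Bochner_Integration.integral_cong[OF refl])
      fix y :: 'a
      let ?z = "(x - y) /\<^sub>R e"
      let ?h = "\<lambda>v::complex. inner (p x) (v *s p y)"
      have h: "bounded_linear ?h"
        by (rule bounded_linear_compose[OF bounded_linear_inner_right vsm.bounded_linear_left])
      have "gauss \<xi> * inner (w x \<xi>) (w y \<xi>) = ?h (complex_of_real (gauss \<xi>) * cis (?z \<bullet> \<xi>))" for \<xi>
      proof -
        have "inner (w x \<xi>) (w y \<xi>) = inner (p x) (cis (?z \<bullet> \<xi>) *s p y)"
          by (simp add: w_def inner_cis_cis inner_diff_left algebra_simps)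
        moreover have "(complex_of_real (gauss \<xi>) * cis (?z \<bullet> \<xi>)) *s p y = gauss \<xi> *\<^sub>R (cis (?z \<bullet> \<xi>) *s p y)"
          by (simp add: vec_eq_iff scaleR_conv_of_real[where 'a=complex] mult.assoc)
        ultimately show ?thesis by simp
      qed
      then have "(\<integral>\<xi>. gauss \<xi> * inner (w x \<xi>) (w y \<xi>) \<partial>lborel) = ?h (\<integral>\<xi>. complex_of_real (gauss \<xi>) * cis (?z \<bullet> \<xi>) \<partial>lborel)"
        using integral_bounded_linear[OF h gauss_transform(1)[of ?z]] by simp
      also have "\<dots> = ?c * gauss ?z * inner (p x) (p y)"
      proof -
        have "complex_of_real r *s p y = r *\<^sub>R p y" for r
          by (simp add: vec_eq_iff scaleR_conv_of_real[where 'a=complex])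
        then show ?thesis unfolding gauss_transform(2) by (simp only: inner_scaleR_right)
      qed
      finally show "(\<integral>\<xi>. gauss \<xi> * inner (w x \<xi>) (w y \<xi>) \<partial>lborel) = ?c * gauss ?z * inner (p x) (p y)" .
    qed
    finally show "(\<integral>\<xi>. gauss \<xi> * inner (w x \<xi>) (ft p (\<xi> /\<^sub>R e)) \<partial>lborel)
      = (\<integral>y. ?c * gauss ((x - y) /\<^sub>R e) * inner (p x) (p y) \<partial>lborel)" .
  qed
  \<comment> \<open>Substitution y = x + e z with Jacobian \<open>e ^ DIM('a)\<close>; the Gaussian
    is even.\<close>
  also have "\<dots> = (\<integral>x. ?c * e ^ DIM('a) * (\<integral>z. gauss z * inner (p x) (p (x + e *\<^sub>R z)) \<partial>lborel) \<partial>lborel)"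
  proof (rule Bochner_Integration.integral_cong[OF refl])
    fix x :: 'a
    have "(\<integral>y. ?c * gauss ((x - y) /\<^sub>R e) * inner (p x) (p y) \<partial>lborel)
        = ?c * (\<integral>y. gauss ((x - y) /\<^sub>R e) * inner (p x) (p y) \<partial>lborel)"
      by (simp add: mult.assoc)
    also have "(\<integral>y. gauss ((x - y) /\<^sub>R e) * inner (p x) (p y) \<partial>lborel)
        = e ^ DIM('a) * (\<integral>z. gauss z * inner (p x) (p (x + e *\<^sub>R z)) \<partial>lborel)"
      using e by (subst lborel_integral_affine[OF _ e, of _ x]) simp_all
    finally show "(\<integral>y. ?c * gauss ((x - y) /\<^sub>R e) * inner (p x) (p y) \<partial>lborel)
        = ?c * e ^ DIM('a) * (\<integral>z. gauss z * inner (p x) (p (x + e *\<^sub>R z)) \<partial>lborel)"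
      by (simp add: mult.assoc)
  qed
  also have "\<dots> = ?c * e ^ DIM('a) * (\<integral>x. (\<integral>z. gauss z * inner (p x) (p (x + e *\<^sub>R z)) \<partial>lborel) \<partial>lborel)"
    by (rule integral_mult_right_zero)
  \<comment> \<open>Square integrability of \<open>p\<close> enters here: for fixed
    \<open>z\<close>, Cauchy-Schwarz and translation invariance bound the integral over
    \<open>x\<close> by the square of \<open>L2_norm p\<close>.\<close>
  also have "(\<integral>x. (\<integral>z. gauss z * inner (p x) (p (x + e *\<^sub>R z)) \<partial>lborel) \<partial>lborel)
    = (\<integral>z. (\<integral>x. gauss z * inner (p x) (p (x + e *\<^sub>R z)) \<partial>lborel) \<partial>lborel)"
  proof (rule lborel_pair.Fubini_integral, rule lborel_pair.Fubini_integrable)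
    have L: "L2 (\<lambda>x. p (x + e *\<^sub>R z))" for z by (rule L2_translate[OF p2])
    have i: "integrable lborel (\<lambda>x. norm (p x) * norm (p (x + e *\<^sub>R z)))" for z
      by (rule L2_integrable_mult[OF p2 L])
    show "AE z in lborel. integrable lborel (\<lambda>x. case (z, x) of (z, x) \<Rightarrow> gauss z * inner (p x) (p (x + e *\<^sub>R z)))"
      by (simp add: L2_integrable_inner[OF p2 L])
    show "integrable lborel (\<lambda>z. \<integral>x. norm (case (z, x) of (z, x) \<Rightarrow> gauss z * inner (p x) (p (x + e *\<^sub>R z))) \<partial>lborel)"
    proof (rule Bochner_Integration.integrable_bound[OF gN[of "(L2_norm p)\<^sup>2"]])
      show "AE z in lborel. norm (\<integral>x. norm (case (z, x) of (z, x) \<Rightarrow> gauss z * inner (p x) (p (x + e *\<^sub>R z))) \<partial>lborel)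
          \<le> norm (gauss z * (L2_norm p)\<^sup>2)"
      proof (intro always_eventually allI)
        fix z :: 'a
        have "(\<integral>x. \<bar>inner (p x) (p (x + e *\<^sub>R z))\<bar> \<partial>lborel) \<le> (\<integral>x. norm (p x) * norm (p (x + e *\<^sub>R z)) \<partial>lborel)"
          by (intro integral_mono integrable_abs L2_integrable_inner[OF p2 L] i Cauchy_Schwarz_ineq2)
        also have "\<dots> \<le> (L2_norm p)\<^sup>2"
          using L2_Cauchy_Schwarz[OF p2 L, of z] by (simp add: L2_norm_translate[OF p2] power2_eq_square)
        finally show "norm (\<integral>x. norm (case (z, x) of (z, x) \<Rightarrow> gauss z * inner (p x) (p (x + e *\<^sub>R z))) \<partial>lborel)
          \<le> norm (gauss z * (L2_norm p)\<^sup>2)"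
          by (simp add: abs_mult mult_left_mono)
      qed
    qed measurable
  qed measurable
  also have "(\<integral>z. (\<integral>x. gauss z * inner (p x) (p (x + e *\<^sub>R z)) \<partial>lborel) \<partial>lborel)
    = (\<integral>z. gauss z * inner (lsq p) (translate (e *\<^sub>R z) (lsq p)) \<partial>lborel)"
  proof (rule Bochner_Integration.integral_cong[OF refl])
    fix z :: 'a
    have "inner (lsq p) (translate (e *\<^sub>R z) (lsq p)) = (\<integral>x. inner (p x) (p (x + e *\<^sub>R z)) \<partial>lborel)"
      unfolding inner_lsq_def translate_lsq[OF p2]
      by (rule integral_cong_AE, measurable)
        (use AE_rep_lsq[OF p2] AE_rep_lsq[OF L2_translate[OF p2, of "e *\<^sub>R z"]] in \<open>eventually_elim, simp\<close>)
    then show "(\<integral>x. gauss z * inner (p x) (p (x + e *\<^sub>R z)) \<partial>lborel) = gauss z * inner (lsq p) (translate (e *\<^sub>R z) (lsq p))"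
      by simp
  qed
  finally show ?thesis .
qed

text \<open>Translations are isometries, which gives the dominating function, and depend
  continuously on the shift, which gives the pointwise limit; the constant is the integral of the
  Gaussian.\<close>

lemma ft_energy_tendsto:
  fixes u :: "('a::euclidean_space, 'b::euclidean_space) lsq"
  shows "(\<lambda>n. \<integral>z. gauss z * inner u (translate (inverse (real (Suc n)) *\<^sub>R z) u) \<partial>lborel)
    \<longlonglongrightarrow> sqrt (2 * pi) ^ DIM('a) * (norm u)\<^sup>2"
proof -
  have cont: "continuous_on UNIV (\<lambda>z. inner u (translate (c *\<^sub>R z) u))" for c
    by (intro continuous_intros continuous_on_compose2[OF continuous_on_translate]) auto
  have [measurable]: "(\<lambda>z. inner u (translate (c *\<^sub>R z) u)) \<in> borel_measurable borel" for c
    by (rule borel_measurable_continuous_onI) (rule cont)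
  have "(\<lambda>n. \<integral>z. gauss z * inner u (translate (inverse (real (Suc n)) *\<^sub>R z) u) \<partial>lborel)
    \<longlonglongrightarrow> (\<integral>z. gauss (z::'a) * (norm u)\<^sup>2 \<partial>lborel)"
  proof (rule integral_dominated_convergence[where w="\<lambda>z. gauss z * (norm u)\<^sup>2"])
    show "AE z in lborel. (\<lambda>n. gauss z * inner u (translate (inverse (real (Suc n)) *\<^sub>R z) u)) \<longlonglongrightarrow> gauss z * (norm u)\<^sup>2"
    proof (intro always_eventually allI)
      fix z :: 'a
      have "isCont (\<lambda>z. translate z u) 0"
        using continuous_on_translate[of u] by (simp add: continuous_on_eq_continuous_at)
      moreover have "(\<lambda>n. inverse (real (Suc n)) *\<^sub>R z) \<longlonglongrightarrow> 0 *\<^sub>R z"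
        by (intro tendsto_intros LIMSEQ_inverse_real_of_nat)
      ultimately have "(\<lambda>n. translate (inverse (real (Suc n)) *\<^sub>R z) u) \<longlonglongrightarrow> translate 0 u"
        using isCont_tendsto_compose[of 0 "\<lambda>z. translate z u"] by simp
      then show "(\<lambda>n. gauss z * inner u (translate (inverse (real (Suc n)) *\<^sub>R z) u)) \<longlonglongrightarrow> gauss z * (norm u)\<^sup>2"
        unfolding power2_norm_eq_inner by (intro tendsto_intros) simp
    qed
    show "AE z in lborel. norm (gauss z * inner u (translate (inverse (real (Suc n)) *\<^sub>R z) u)) \<le> gauss z * (norm u)\<^sup>2" for n
    proof (intro always_eventually allI)
      fix z :: 'a
      have "\<bar>inner u (translate (inverse (real (Suc n)) *\<^sub>R z) u)\<bar> \<le> (norm u)\<^sup>2"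
        using Cauchy_Schwarz_ineq2[of u "translate (inverse (real (Suc n)) *\<^sub>R z) u"] by (simp add: power2_eq_square)
      then show "norm (gauss z * inner u (translate (inverse (real (Suc n)) *\<^sub>R z) u)) \<le> gauss z * (norm u)\<^sup>2"
        by (simp add: abs_mult mult_left_mono less_imp_le)
    qed
    show "(\<lambda>z. gauss z * inner u (translate (inverse (real (Suc n)) *\<^sub>R z) u)) \<in> borel_measurable lborel" for n
      using borel_measurable_times[of gauss lborel "\<lambda>z. inner u (translate (inverse (real (Suc n)) *\<^sub>R z) u)"]
      by simp
    show "integrable lborel (\<lambda>z::'a. gauss z * (norm u)\<^sup>2)"
      by (intro integrable_mult_left gauss_integrable)
  qed simp
  then show ?thesis by (simp add: gauss_integral)
qed

text \<open>Used with the same parameter for both functions, \<open>ft_energy\<close> turns the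
  pointwise bound on transforms into a bound between smoothed energies. The prefactors are equal and
  cancel before the parameter tends to 0.\<close>

theorem ft_comparison:
  fixes p :: "'a::euclidean_space \<Rightarrow> complex ^ 'm::finite" and q :: "'a \<Rightarrow> complex ^ 'k::finite"
  assumes p: "integrable lborel p" "L2 p" and q: "integrable lborel q" "L2 q" and C: "0 \<le> C"
    and le: "\<And>\<xi>. norm (ft p \<xi>) \<le> C * norm (ft q \<xi>)"
  shows "L2_norm p \<le> C * L2_norm q"
proof -
  let ?I = "\<lambda>u n. \<integral>z. gauss (z::'a) * inner u (translate (inverse (real (Suc n)) *\<^sub>R z) u) \<partial>lborel"
  let ?c = "sqrt (2 * pi) ^ DIM('a)"
  have c: "0 < ?c" by simp
  have int: "integrable lborel (\<lambda>\<xi>. gauss \<xi> * (norm (ft r (\<xi> /\<^sub>R e)))\<^sup>2)" if r: "integrable lborel r"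
    for r :: "'a \<Rightarrow> complex ^ 'j::finite" and e
  proof (rule Bochner_Integration.integrable_bound)
    show "integrable lborel (\<lambda>\<xi>::'a. gauss \<xi> * (\<integral>x. norm (r x) \<partial>lborel)\<^sup>2)"
      by (intro integrable_mult_left gauss_integrable)
    have [measurable]: "r \<in> borel_measurable borel" using r by auto
    show "(\<lambda>\<xi>. gauss \<xi> * (norm (ft r (\<xi> /\<^sub>R e)))\<^sup>2) \<in> borel_measurable lborel" by measurable
    show "AE \<xi> in lborel. norm (gauss \<xi> * (norm (ft r (\<xi> /\<^sub>R e)))\<^sup>2) \<le> norm (gauss \<xi> * (\<integral>x. norm (r x) \<partial>lborel)\<^sup>2)"
      by (intro always_eventually allI) (simp add: abs_mult norm_ft_le[OF r] mult_left_mono power_mono)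
  qed
  have step: "?I (lsq p) n \<le> C\<^sup>2 * ?I (lsq q) n" for n
  proof -
    let ?e = "inverse (real (Suc n))"
    have e: "0 < ?e" by simp
    have "(\<integral>\<xi>. gauss \<xi> * (norm (ft p (\<xi> /\<^sub>R ?e)))\<^sup>2 \<partial>lborel) \<le> (\<integral>\<xi>. C\<^sup>2 * (gauss \<xi> * (norm (ft q (\<xi> /\<^sub>R ?e)))\<^sup>2) \<partial>lborel)"
    proof (rule integral_mono[OF int[OF p(1)] integrable_mult_right[OF int[OF q(1)]]])
      fix \<xi> :: 'a
      have "(norm (ft p (\<xi> /\<^sub>R ?e)))\<^sup>2 \<le> (C * norm (ft q (\<xi> /\<^sub>R ?e)))\<^sup>2"
        by (intro power_mono le) simp
      then have "gauss \<xi> * (norm (ft p (\<xi> /\<^sub>R ?e)))\<^sup>2 \<le> gauss \<xi> * (C * norm (ft q (\<xi> /\<^sub>R ?e)))\<^sup>2"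
        by (rule mult_left_mono) (simp add: less_imp_le)
      then show "gauss \<xi> * (norm (ft p (\<xi> /\<^sub>R ?e)))\<^sup>2 \<le> C\<^sup>2 * (gauss \<xi> * (norm (ft q (\<xi> /\<^sub>R ?e)))\<^sup>2)"
        by (simp only: power_mult_distrib mult_ac)
    qed
    then have "?c * ?e ^ DIM('a) * ?I (lsq p) n \<le> C\<^sup>2 * (?c * ?e ^ DIM('a) * ?I (lsq q) n)"
      by (simp only: ft_energy[OF p e] ft_energy[OF q e] integral_mult_right_zero)
    then have "(?c * ?e ^ DIM('a)) * ?I (lsq p) n \<le> (?c * ?e ^ DIM('a)) * (C\<^sup>2 * ?I (lsq q) n)"
      by (simp only: mult_ac)
    moreover have "0 < ?c * ?e ^ DIM('a)" by (rule mult_pos_pos[OF c zero_less_power[OF e]])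
    ultimately show ?thesis by (simp only: mult_le_cancel_left_pos)
  qed
  have "?c * (norm (lsq p))\<^sup>2 \<le> C\<^sup>2 * (?c * (norm (lsq q))\<^sup>2)"
    by (rule LIMSEQ_le[OF ft_energy_tendsto tendsto_mult_left[OF ft_energy_tendsto]])
      (use step in blast)
  then have "?c * (norm (lsq p))\<^sup>2 \<le> ?c * (C * norm (lsq q))\<^sup>2"
    by (simp only: power_mult_distrib mult_ac)
  then have "(norm (lsq p))\<^sup>2 \<le> (C * norm (lsq q))\<^sup>2"
    using c by (simp only: mult_le_cancel_left_pos)
  then have "norm (lsq p) \<le> C * norm (lsq q)"
    using C by (simp add: power2_le_iff_abs_le)
  then show ?thesis by (simp add: norm_lsq p q)
qed

section \<open>Differentiation under the pairing\<close>

text \<open>The quotient form of the derivative is suited to limits in L^2 and to splitting the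
  increment of a pairing into two parts.\<close>

lemma has_vector_derivative_iff_quotient:
  fixes f :: "real \<Rightarrow> 'b::real_normed_vector"
  shows "(f has_vector_derivative D) (at x within S) \<longleftrightarrow> ((\<lambda>y. (f y - f x) /\<^sub>R (y - x)) \<longlongrightarrow> D) (at x within S)"
proof -
  have eq: "norm (f y - f x - (y - x) *\<^sub>R D) / norm (y - x) = norm ((f y - f x) /\<^sub>R (y - x) - D)" if "y \<noteq> x" for y
  proof -
    have "(f y - f x) /\<^sub>R (y - x) - D = (f y - f x - (y - x) *\<^sub>R D) /\<^sub>R (y - x)"
      using that by (simp add: scaleR_diff_right)
    then show ?thesis by (simp add: divide_inverse mult.commute)
  qed
  have "\<forall>\<^sub>F y in at x within S. norm (f y - f x - (y - x) *\<^sub>R D) / norm (y - x) = norm ((f y - f x) /\<^sub>R (y - x) - D)"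
    unfolding eventually_at_filter by (intro always_eventually allI impI eq)
  then have "((\<lambda>y. norm (f y - f x - (y - x) *\<^sub>R D) / norm (y - x)) \<longlongrightarrow> 0) (at x within S)
    \<longleftrightarrow> ((\<lambda>y. norm ((f y - f x) /\<^sub>R (y - x) - D)) \<longlongrightarrow> 0) (at x within S)"
    by (rule tendsto_cong)
  then show ?thesis
    unfolding has_vector_derivative_def has_derivative_iff_norm
    by (simp add: bounded_linear_scaleR_left tendsto_norm_zero_iff LIM_zero_iff)
qed

text \<open>By the mean value inequality the difference quotients are bounded by the maximum of the
  derivative on a compact set, and they vanish off \<open>K\<close>; so their pointwise limit is
  also the limit in L^2.\<close>

lemma lsq_has_vector_derivative:
  fixes \<phi> \<phi>' :: "real \<Rightarrow> 'a::euclidean_space \<Rightarrow> 'b::euclidean_space"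
  assumes K: "compact K" and zero: "\<And>s x. s \<in> {a..b} \<Longrightarrow> x \<notin> K \<Longrightarrow> \<phi> s x = 0"
    and t: "a < t" "t < b"
    and der: "\<And>s x. ((\<lambda>s. \<phi> s x) has_vector_derivative \<phi>' s x) (at s)"
    and cont: "\<And>s. continuous_on UNIV (\<phi> s)" and cont': "continuous_on UNIV (\<lambda>z. \<phi>' (fst z) (snd z))"
  shows "((\<lambda>s. lsq (\<phi> s)) has_vector_derivative lsq (\<phi>' t)) (at t)" and "L2 (\<phi>' t)"
    and "s \<in> {a..b} \<Longrightarrow> L2 (\<phi> s)"
proof -
  have zero': "\<phi>' s x = 0" if "s \<in> {a<..<b}" "x \<notin> K" for s x
  proof -
    have "((\<lambda>s. \<phi> s x) has_vector_derivative 0) (at s)"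
      by (rule has_vector_derivative_transform_within_open[of "\<lambda>_. 0" _ _ "{a<..<b}"])
        (use that zero in auto)
    then show ?thesis using vector_derivative_unique_at[OF der] by blast
  qed
  have "compact ((\<lambda>z. \<phi>' (fst z) (snd z)) ` ({a..b} \<times> K))"
    by (intro compact_continuous_image continuous_on_subset[OF cont'] compact_Times K) auto
  then have "bounded ((\<lambda>z. \<phi>' (fst z) (snd z)) ` ({a..b} \<times> K))" by (rule compact_imp_bounded)
  then obtain M where M0: "0 < M" and M': "\<forall>y\<in>(\<lambda>z. \<phi>' (fst z) (snd z)) ` ({a..b} \<times> K). norm y \<le> M"
    unfolding bounded_pos by blast
  have M: "norm (\<phi>' s x) \<le> M" if "s \<in> {a..b}" "x \<in> K" for s x
    using bspec[OF M' imageI[of "(s, x)"]] that by simp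
  have lip: "norm (\<phi> s x - \<phi> t x) \<le> M * \<bar>s - t\<bar>" if "s \<in> {a<..<b}" for s x
  proof (cases "x \<in> K")
    case True
    have "norm (\<phi> s x - \<phi> t x) \<le> M * norm (s - t)"
    proof (rule differentiable_bound[of "{a<..<b}" "\<lambda>s. \<phi> s x" "\<lambda>s h. h *\<^sub>R \<phi>' s x"])
      show "((\<lambda>s. \<phi> s x) has_derivative (\<lambda>h. h *\<^sub>R \<phi>' s x)) (at s within {a<..<b})" for s
        using has_vector_derivative_at_within[OF der] by (simp add: has_vector_derivative_def)
      show "onorm (\<lambda>h. h *\<^sub>R \<phi>' s x) \<le> M" if "s \<in> {a<..<b}" for s
      proof (rule onorm_bound)
        show "norm (h *\<^sub>R \<phi>' s x) \<le> M * norm h" for h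
          using mult_right_mono[OF M[of s x], of "\<bar>h\<bar>"] True that by (simp add: mult.commute)
      qed (use M0 in simp)
    qed (use that t in auto)
    then show ?thesis by simp
  qed (use zero that t M0 in auto)
  have "continuous_on UNIV (\<phi>' s)" for s
    using continuous_on_compose2[OF cont', of UNIV "\<lambda>x. (s, x)"] by (simp add: continuous_on_Pair)
  then have m[measurable]: "\<phi> s \<in> borel_measurable borel" "\<phi>' s \<in> borel_measurable borel" for s
    using cont[of s] by (simp_all add: borel_measurable_continuous_onI)
  have L: "L2 (\<phi> s)" if s: "s \<in> {a..b}" for s
  proof -
    obtain B where "0 < B" and B: "\<And>x. norm (\<phi> s x) \<le> B"
      using bounded_compact_support[OF K zero[OF s] cont[of s]] by blast
    show ?thesis by (rule L2_compact_support(1)[OF K zero[OF s] m(1) B])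
  qed
  then show "s \<in> {a..b} \<Longrightarrow> L2 (\<phi> s)" .
  show L': "L2 (\<phi>' t)"
  proof (rule L2_compact_support(1)[OF K])
    show "\<phi>' t x = 0" if "x \<notin> K" for x using zero' that t by simp
    show "norm (\<phi>' t x) \<le> M" for x using M[of t x] zero'[of t x] t M0 by (cases "x \<in> K") auto
  qed (rule m)
  have LK: "L2 (\<lambda>x. M *\<^sub>R (indicator K x :: real))"
  proof (rule L2_compact_support(1)[OF K])
    have [measurable]: "K \<in> sets borel" using K by (rule borel_compact)
    show "(\<lambda>x. M *\<^sub>R (indicator K x :: real)) \<in> borel_measurable borel" by measurable
    show "norm (M *\<^sub>R (indicator K x :: real)) \<le> M" for x using M0 by (auto simp: indicator_def)
  qed simp
  show "((\<lambda>s. lsq (\<phi> s)) has_vector_derivative lsq (\<phi>' t)) (at t)"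
    unfolding has_vector_derivative_iff_quotient tendsto_at_iff_sequentially comp_def
  proof (intro allI impI)
    fix X :: "nat \<Rightarrow> real" assume X: "\<forall>i. X i \<in> UNIV - {t}" "X \<longlonglongrightarrow> t"
    have "\<forall>\<^sub>F n in sequentially. X n \<in> {a<..<b}"
      by (rule topological_tendstoD[OF X(2)]) (use t in auto)
    then obtain N where N: "\<And>n. N \<le> n \<Longrightarrow> X n \<in> {a<..<b}" unfolding eventually_sequentially by blast
    \<comment> \<open>Dropping the first \<open>N\<close> terms keeps all times in
      \<open>{a<..<b}\<close>, where the common support and the Lipschitz bound are
      available.\<close>
    define Y where "Y n = X (n + N)" for n
    have Y: "Y n \<in> {a<..<b}" "Y n \<noteq> t" for n using N[of "n + N"] X(1) by (auto simp: Y_def)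
    have Yt: "Y \<longlonglongrightarrow> t" unfolding Y_def using X(2) by (rule LIMSEQ_ignore_initial_segment)
    let ?q = "\<lambda>n x. (\<phi> (Y n) x - \<phi> t x) /\<^sub>R (Y n - t)"
    have LY: "L2 (\<phi> (Y n))" for n using L[of "Y n"] Y[of n] by simp
    have Lt: "L2 (\<phi> t)" using L t by simp
    have "(\<lambda>n. lsq (?q n)) \<longlonglongrightarrow> lsq (\<phi>' t)"
    proof (rule lsq_tendsto_dominated[OF _ L' LK])
      show "L2 (?q n)" for n by (intro L2_scaleR L2_diff LY Lt)
      show "AE x in lborel. norm (?q n x) \<le> norm (M *\<^sub>R (indicator K x :: real))" for n
      proof (intro always_eventually allI)
        fix x
        show "norm (?q n x) \<le> norm (M *\<^sub>R (indicator K x :: real))"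
        proof (cases "x \<in> K")
          case True
          have "norm (?q n x) = norm (\<phi> (Y n) x - \<phi> t x) / \<bar>Y n - t\<bar>"
            by (simp add: divide_inverse mult.commute)
          also have "\<dots> \<le> M"
            using lip[OF Y(1), of n x] Y(2)[of n] by (simp add: pos_divide_le_eq)
          finally show ?thesis using True M0 by simp
        next
          case False
          then show ?thesis using zero[of "Y n" x] zero[of t x] Y(1)[of n] t by simp
        qed
      qed
      show "AE x in lborel. (\<lambda>n. ?q n x) \<longlonglongrightarrow> \<phi>' t x"
      proof (intro always_eventually allI)
        fix x
        show "(\<lambda>n. ?q n x) \<longlonglongrightarrow> \<phi>' t x"
          using der[of x t, unfolded has_vector_derivative_iff_quotient tendsto_at_iff_sequentially comp_def] Y(2) Yt by simp
      qed
    qed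
    then have "(\<lambda>n. (lsq (\<phi> (Y n)) - lsq (\<phi> t)) /\<^sub>R (Y n - t)) \<longlonglongrightarrow> lsq (\<phi>' t)"
      by (simp only: lsq_diff[OF LY Lt] lsq_scaleR[OF L2_diff[OF LY Lt]])
    then show "(\<lambda>n. (lsq (\<phi> (X n)) - lsq (\<phi> t)) /\<^sub>R (X n - t)) \<longlonglongrightarrow> lsq (\<phi>' t)"
      unfolding Y_def by (rule LIMSEQ_offset)
  qed
qed

lemma pair_rep_lsq:
  assumes "L2 \<psi>" shows "pair (rep (lsq \<psi>)) u = pair \<psi> u"
  unfolding pair_def
proof (rule integral_cong_AE)
  have [measurable]: "\<psi> \<in> borel_measurable borel" using assms by (rule L2_borel)
  show "(\<lambda>x. \<psi> x *s rep u x) \<in> borel_measurable lborel" by measurable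
  show "AE x in lborel. rep (lsq \<psi>) x *s rep u x = \<psi> x *s rep u x"
    using AE_rep_lsq[OF assms] by eventually_elim simp
qed measurable

text \<open>Rules for bilinear maps require both arguments in normed spaces, so the test function
  enters as a class; \<open>pair_rep_lsq\<close> leads back to the function itself.\<close>

lemma bounded_bilinear_pair:
  "bounded_bilinear (\<lambda>v (u :: ('a::euclidean_space, complex ^ 'm::finite) lsq). pair (rep v) u)"
proof (rule bounded_bilinear.intro)
  fix v v' :: "('a, complex) lsq" and u u' :: "('a, complex ^ 'm) lsq" and r :: real
  interpret bounded_linear "pair (rep v) :: ('a, complex ^ 'm) lsq \<Rightarrow> _" by (rule bounded_linear_pair) simp
  show "pair (rep v) (u + u') = pair (rep v) u + pair (rep v) u'" by (rule add)
  show "pair (rep v) (r *\<^sub>R u) = r *\<^sub>R pair (rep v) u" by (rule scaleR)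
  have "pair (rep (v + v')) u = pair (\<lambda>x. rep v x + rep v' x) u"
    unfolding plus_lsq_def by (rule pair_rep_lsq) (simp add: L2_add)
  also have "\<dots> = pair (\<lambda>x. rep v x - - rep v' x) u" by simp
  also have "\<dots> = pair (rep v) u + pair (rep v') u"
    by (subst pair_diff_left) (simp_all add: L2_minus pair_minus_left)
  finally show "pair (rep (v + v')) u = pair (rep v) u + pair (rep v') u" .
  have "pair (rep (r *\<^sub>R v)) u = pair (\<lambda>x. r *\<^sub>R rep v x) u"
    unfolding scaleR_lsq_def by (rule pair_rep_lsq) (simp add: L2_scaleR)
  then show "pair (rep (r *\<^sub>R v)) u = r *\<^sub>R pair (rep v) u" by (simp add: pair_scaleR_left)
next
  show "\<exists>K. \<forall>v (u :: ('a, complex ^ 'm) lsq). norm (pair (rep v) u) \<le> norm v * norm u * K"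
    by (rule exI[of _ 1]) (simp add: norm_pair norm_lsq_eq[of "_ :: ('a, complex) lsq"])
qed

interpretation pair: bounded_bilinear "\<lambda>v (u :: ('a::euclidean_space, complex ^ 'm::finite) lsq). pair (rep v) u"
  by (rule bounded_bilinear_pair)

section \<open>Elliptic systems in \<open>L\<^sup>2\<close>\<close>

text \<open>The weak partial derivative as a graph in L^2, in the sense of distributions.\<close>

definition wd :: "'d::finite \<Rightarrow> ((real ^ 'd, complex ^ 'm::finite) lsq \<times> (real ^ 'd, complex ^ 'm) lsq) set" where
  "wd l = {(w, g). \<forall>\<psi>. testfun \<psi> \<longrightarrow> - pair (dd (axis l 1) \<psi>) w = pair \<psi> g}"

text \<open>The operator with its largest domain in L^2: only the combination of the derivatives has
  to be square integrable. That the single derivatives are so too, for elliptic \<open>A\<close>, is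
  \<open>elliptic_regularity\<close>.\<close>

definition sysop :: "('d::finite \<Rightarrow> complex ^ 'm ^ 'm) \<Rightarrow> ((real ^ 'd, complex ^ 'm::finite) lsq \<times> (real ^ 'd, complex ^ 'm) lsq) set" where
  "sysop A = {(w, f). \<forall>\<psi>. testfun \<psi> \<longrightarrow> - (\<Sum>l\<in>UNIV. A l *v pair (dd (axis l 1) \<psi>) w) = pair \<psi> f}"

text \<open>Both graphs are intersections, over all test functions, of solution sets of continuous
  linear equations.\<close>

lemma closed_subspace_pairing:
  fixes P Q :: "'i \<Rightarrow> ('a::euclidean_space, complex ^ 'm::finite) lsq \<Rightarrow> complex ^ 'm"
  assumes "\<And>i. i \<in> I \<Longrightarrow> bounded_linear (P i)" "\<And>i. i \<in> I \<Longrightarrow> bounded_linear (Q i)"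
  shows "closed {(w, f). \<forall>i\<in>I. P i w = Q i f}" and "subspace {(w, f). \<forall>i\<in>I. P i w = Q i f}"
proof -
  have eq: "{(w, f). \<forall>i\<in>I. P i w = Q i f} = (\<Inter>i\<in>I. {z. P i (fst z) = Q i (snd z)})" by auto
  show "closed {(w, f). \<forall>i\<in>I. P i w = Q i f}"
    unfolding eq
    by (intro closed_INT ballI closed_Collect_eq bounded_linear.continuous_on[OF assms(1)]
        bounded_linear.continuous_on[OF assms(2)] continuous_intros)
  show "subspace {(w, f). \<forall>i\<in>I. P i w = Q i f}"
    using assms
    by (auto simp: subspace_def linear_simps zero_prod_def)
qed

lemma bounded_linear_pair_testfun: "testfun \<psi> \<Longrightarrow> bounded_linear (pair \<psi>)"
  by (intro bounded_linear_pair testfun_L2)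

lemma bounded_linear_pair_dd:
  fixes \<psi> :: "real ^ 'd::finite \<Rightarrow> complex"
  shows "testfun \<psi> \<Longrightarrow> bounded_linear (pair (dd (axis l 1) \<psi>))"
  by (intro bounded_linear_pair_testfun testfun_dd) simp_all

lemma wd_closed: "closed (wd l)" and wd_subspace: "subspace (wd l)"
proof -
  have eq: "wd l = {(w, g). \<forall>\<psi>\<in>Collect testfun. - pair (dd (axis l 1) \<psi>) w = pair \<psi> g}"
    by (auto simp: wd_def)
  show "closed (wd l)" "subspace (wd l)"
    unfolding eq
    by (intro closed_subspace_pairing bounded_linear_minus bounded_linear_pair_dd bounded_linear_pair_testfun; simp)+
qed

lemma sysop_closed: "closed (sysop A)" and sysop_subspace: "subspace (sysop A)"
proof -
  have eq: "sysop A = {(w, g). \<forall>\<psi>\<in>Collect testfun. - (\<Sum>l\<in>UNIV. A l *v pair (dd (axis l 1) \<psi>) w) = pair \<psi> g}"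
    by (auto simp: sysop_def)
  show "closed (sysop A)" "subspace (sysop A)"
    unfolding eq
    by (intro closed_subspace_pairing bounded_linear_minus bounded_linear_sum
        bounded_linear_compose[OF matrix_vector_mul_bounded_linear] bounded_linear_pair_dd bounded_linear_pair_testfun; simp)+
qed

lemma lsq_eqI_pair:
  fixes f g :: "('a::euclidean_space, complex ^ 'm::finite) lsq"
  assumes "\<And>\<psi>. testfun \<psi> \<Longrightarrow> pair \<psi> f = pair \<psi> g" shows "f = g"
proof -
  have "f - g = 0"
  proof (rule lsq_eq_0I)
    fix \<psi> :: "'a \<Rightarrow> complex" assume \<psi>: "testfun \<psi>"
    interpret bounded_linear "pair \<psi> :: ('a, complex ^ 'm) lsq \<Rightarrow> _" by (rule bounded_linear_pair_testfun[OF \<psi>])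
    show "pair \<psi> (f - g) = 0" using assms[OF \<psi>] by (simp add: diff)
  qed
  then show ?thesis by simp
qed

lemma sysop_unique: "(w, f) \<in> sysop A \<Longrightarrow> (w, g) \<in> sysop A \<Longrightarrow> f = g"
  by (rule lsq_eqI_pair) (auto simp: sysop_def)

lemma pair_dd_translate:
  assumes "testfun \<psi>" "b \<in> Basis"
  shows "pair (dd b \<psi>) (translate z u) = pair (dd b (\<lambda>x. \<psi> (x - z))) u"
  by (simp add: pair_translate testfun_L2 testfun_dd assms dd_translate)

lemma sysop_translate: "(w, f) \<in> sysop A \<Longrightarrow> (translate z w, translate z f) \<in> sysop A"
  unfolding sysop_def
  by (auto simp: pair_dd_translate pair_translate testfun_L2 testfun_translate)

text \<open>By homogeneity in \<open>\<xi>\<close> and \<open>v\<close> it suffices to look at a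
  product of two unit spheres. There the norm of the symbol applied to \<open>v\<close> attains its
  minimum, which the determinant condition makes positive; \<open>C\<close> is its
  reciprocal.\<close>

lemma elliptic_bound:
  fixes A :: "'d::finite \<Rightarrow> complex ^ 'n::finite ^ 'n"
  assumes "elliptic A"
  obtains C where "0 \<le> C" "\<And>\<xi> v l. \<bar>\<xi> $ l\<bar> * norm v \<le> C * norm ((\<Sum>l\<in>UNIV. (\<xi> $ l) *\<^sub>R A l) *v v)"
proof -
  let ?A = "\<lambda>\<xi>::real^'d. \<Sum>l\<in>UNIV. (\<xi> $ l) *\<^sub>R A l"
  have Av: "?A \<xi> *v v = (\<Sum>l\<in>UNIV. (\<xi> $ l) *\<^sub>R (A l *v v))" for \<xi> v
    by (simp add: matrix_vector_mult_def vec_eq_iff sum_distrib_right sum_distrib_left scaleR_sum_right sum_component)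
      (auto intro: sum.swap)
  let ?S = "sphere (0::real^'d) 1 \<times> sphere (0::complex^'n) 1"
  have "compact ?S" by (intro compact_Times) auto
  moreover have "?S \<noteq> {}"
  proof -
    have "axis undefined 1 \<in> sphere (0::real^'d) 1" "axis undefined 1 \<in> sphere (0::complex^'n) 1" by simp_all
    then show ?thesis by blast
  qed
  moreover have "continuous_on ?S (\<lambda>z. norm (?A (fst z) *v snd z))"
    unfolding Av
    by (intro continuous_intros bounded_linear.continuous_on[OF matrix_vector_mul_bounded_linear]
      bounded_linear.continuous_on[OF bounded_linear_vec_nth])
  ultimately obtain z where z: "z \<in> ?S" "\<And>y. y \<in> ?S \<Longrightarrow> norm (?A (fst z) *v snd z) \<le> norm (?A (fst y) *v snd y)"
    using continuous_attains_inf[of ?S "\<lambda>z. norm (?A (fst z) *v snd z)"] by blast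
  define c where "c = norm (?A (fst z) *v snd z)"
  have "c \<noteq> 0"
  proof
    assume "c = 0"
    then have 0: "?A (fst z) *v snd z = 0" by (simp add: c_def)
    have nz: "fst z \<noteq> 0" "snd z \<noteq> 0" using z(1) by auto
    then have "invertible (?A (fst z))" using assms by (simp add: elliptic_def invertible_det_nz)
    then have "inj ((*v) (?A (fst z)))" by (rule inj_matrix_vector_mult)
    then show False using 0 nz by (metis injD matrix_vector_mult_0_right)
  qed
  then have c: "0 < c" by (simp add: c_def)
  show thesis
  proof (rule that[of "1 / c"])
    show "0 \<le> 1 / c" using c by simp
    fix \<xi> :: "real^'d" and v :: "complex^'n" and l
    have "c * (norm \<xi> * norm v) \<le> norm (?A \<xi> *v v)"
    proof (cases "\<xi> = 0 \<or> v = 0")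
      case False
      let ?x = "\<xi> /\<^sub>R norm \<xi>" and ?y = "v /\<^sub>R norm v"
      have "(?x, ?y) \<in> ?S" using False by simp
      then have "c \<le> norm (?A ?x *v ?y)" using z(2)[of "(?x, ?y)"] by (simp add: c_def)
      also have "?A ?x *v ?y = inverse (norm \<xi> * norm v) *\<^sub>R (?A \<xi> *v v)"
        unfolding Av
        by (simp add: linear_scale[OF matrix_vector_mul_linear] scaleR_sum_right mult_ac)
      also have "norm \<dots> = norm (?A \<xi> *v v) / (norm \<xi> * norm v)"
        by (simp add: divide_inverse mult.commute)
      finally show ?thesis using False by (simp add: pos_le_divide_eq)
    qed auto
    moreover have "\<bar>\<xi> $ l\<bar> * norm v \<le> norm \<xi> * norm v"
      by (intro mult_right_mono component_le_norm_cart) simp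
    then have "c * (\<bar>\<xi> $ l\<bar> * norm v) \<le> c * (norm \<xi> * norm v)"
      using c by (intro mult_left_mono) auto
    ultimately have "c * (\<bar>\<xi> $ l\<bar> * norm v) \<le> norm (?A \<xi> *v v)" by linarith
    then show "\<bar>\<xi> $ l\<bar> * norm v \<le> 1 / c * norm (?A \<xi> *v v)"
      using c by (simp add: pos_le_divide_eq mult_ac)
  qed
qed

section \<open>Fourier transforms of cut-off functions and the a priori estimate\<close>

lemma L2_bounded_vsm:
  fixes u :: "('a::euclidean_space, complex ^ 'm::finite) lsq"
  assumes [measurable]: "a \<in> borel_measurable borel" and B: "\<And>x. norm (a x) \<le> B"
  shows "L2 (\<lambda>x. a x *s rep u x)" and "L2_norm (\<lambda>x. a x *s rep u x) \<le> B * norm u"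
proof -
  have m: "(\<lambda>x. a x *s rep u x) \<in> borel_measurable borel" by measurable
  have le: "AE x in lborel. norm (a x *s rep u x) \<le> B * norm (rep u x)"
    using B by (simp add: mult_right_mono)
  show "L2 (\<lambda>x. a x *s rep u x)" by (rule L2_dominated[OF L2_rep m le])
  have "0 \<le> B" using B[of 0] norm_ge_zero order_trans by blast
  then show "L2_norm (\<lambda>x. a x *s rep u x) \<le> B * norm u"
    unfolding norm_lsq_eq by (rule L2_norm_mono[OF L2_rep m _ le])
qed

lemma ft_vsm: "ft (\<lambda>x. a x *s rep u x) \<xi> = pair (\<lambda>x. cis (- (x \<bullet> \<xi>)) * a x) u"
  by (simp add: ft_def pair_def vector_smult_assoc)

lemma dd_modulation:
  fixes \<theta> :: "real ^ 'd::finite \<Rightarrow> complex"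
  assumes "testfun \<theta>"
  shows "dd b (\<lambda>x. cis (- (x \<bullet> \<xi>)) * \<theta> x) x = cis (- (x \<bullet> \<xi>)) * dd b \<theta> x - \<i> * (b \<bullet> \<xi>) * (cis (- (x \<bullet> \<xi>)) * \<theta> x)"
proof -
  have "((\<lambda>x. - (x \<bullet> \<xi>)) has_derivative (\<lambda>b. - (b \<bullet> \<xi>))) (at x)"
    by (auto intro!: derivative_eq_intros)
  from has_derivative_mult[OF has_derivative_cis[OF this] testfun_has_derivative[OF assms]]
  have "((\<lambda>x. cis (- (x \<bullet> \<xi>)) * \<theta> x) has_derivative
    (\<lambda>b. cis (- (x \<bullet> \<xi>)) * dd b \<theta> x + (- (b \<bullet> \<xi>)) *\<^sub>R (\<i> * cis (- (x \<bullet> \<xi>))) * \<theta> x)) (at x)" .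
  from frechet_derivative_at[OF this, symmetric] show ?thesis
    by (simp add: scaleR_conv_of_real mult_ac)
qed

lemma dd_dilate:
  fixes \<theta> :: "real ^ 'd::finite \<Rightarrow> complex"
  assumes "testfun \<theta>"
  shows "dd b (\<lambda>x. \<theta> (\<delta> *\<^sub>R x)) x = \<delta> *\<^sub>R dd b \<theta> (\<delta> *\<^sub>R x)"
proof -
  have "((\<lambda>x. \<delta> *\<^sub>R x) has_derivative (\<lambda>b. \<delta> *\<^sub>R b)) (at x)" by (auto intro!: derivative_eq_intros)
  then have "((\<lambda>x. \<theta> (\<delta> *\<^sub>R x)) has_derivative (\<lambda>b. dd (\<delta> *\<^sub>R b) \<theta> (\<delta> *\<^sub>R x))) (at x)"
    by (rule has_derivative_compose) (rule testfun_has_derivative[OF assms])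
  from frechet_derivative_at[OF this, symmetric] show ?thesis
    by (simp add: linear_scale[OF has_derivative_linear[OF testfun_has_derivative[OF assms]]])
qed

lemma testfun_dilate:
  fixes \<theta> :: "real ^ 'd::finite \<Rightarrow> complex"
  assumes \<theta>: "testfun \<theta>" and \<delta>: "0 < \<delta>"
  shows "testfun (\<lambda>x. \<theta> (\<delta> *\<^sub>R x))"
proof -
  obtain K where K: "compact K" "\<And>x. x \<notin> K \<Longrightarrow> \<theta> x = 0" using testfun_support[OF \<theta>] by metis
  show ?thesis
  proof (rule testfunI)
    show "Ck k (\<lambda>x. \<theta> (\<delta> *\<^sub>R x))" for k
      using Ck_compose_affine[OF bounded_linear_scaleR_right[of \<delta>] testfun_Ck[OF \<theta>], where c=0] by simp
    show "compact ((\<lambda>x. x /\<^sub>R \<delta>) ` K)" using K(1) by (intro compact_continuous_image continuous_intros)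
    show "\<theta> (\<delta> *\<^sub>R x) = 0" if "x \<notin> (\<lambda>x. x /\<^sub>R \<delta>) ` K" for x
    proof (rule K(2))
      show "\<delta> *\<^sub>R x \<notin> K" using that \<delta> imageI[of "\<delta> *\<^sub>R x" K "\<lambda>x. x /\<^sub>R \<delta>"] by auto
    qed
  qed
qed

text \<open>A plane wave times a cut-off is an admissible test function. Testing with it turns a
  weak derivative into multiplication by \<open>\<i> * (\<xi> $ l)\<close> on the transform of the
  cut-off class, up to a term in which the derivative falls on the cut-off.\<close>

lemma pair_dd_modulation:
  fixes u :: "(real ^ 'd::finite, complex ^ 'm::finite) lsq"
  assumes \<theta>: "testfun \<theta>"
  shows "pair (dd (axis l 1) (\<lambda>x. cis (- (x \<bullet> \<xi>)) * \<theta> x)) u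
    = ft (\<lambda>x. dd (axis l 1) \<theta> x *s rep u x) \<xi> - (\<i> * (\<xi> $ l)) *s ft (\<lambda>x. \<theta> x *s rep u x) \<xi>"
proof -
  have ck: "Ck k (\<lambda>x. cis (- (x \<bullet> \<xi>)))" for k
    using Ck_cis[of k "- \<xi>"] by simp
  have t: "testfun (\<lambda>x. cis (- (x \<bullet> \<xi>)) * \<theta> x)" "testfun (\<lambda>x. cis (- (x \<bullet> \<xi>)) * dd (axis l 1) \<theta> x)"
    by (intro testfun_mult ck \<theta> testfun_dd; simp)+
  have "pair (dd (axis l 1) (\<lambda>x. cis (- (x \<bullet> \<xi>)) * \<theta> x)) u
    = (\<integral>x. (cis (- (x \<bullet> \<xi>)) * dd (axis l 1) \<theta> x) *s rep u x
        - (\<i> * (\<xi> $ l)) *s ((cis (- (x \<bullet> \<xi>)) * \<theta> x) *s rep u x) \<partial>lborel)"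
    unfolding pair_def dd_modulation[OF \<theta>]
    by (simp add: vector_sub_rdistrib vector_smult_assoc inner_axis' mult.assoc)
  also have "\<dots> = pair (\<lambda>x. cis (- (x \<bullet> \<xi>)) * dd (axis l 1) \<theta> x) u
      - (\<i> * (\<xi> $ l)) *s pair (\<lambda>x. cis (- (x \<bullet> \<xi>)) * \<theta> x) u"
  proof -
    have i: "integrable lborel (\<lambda>x. (cis (- (x \<bullet> \<xi>)) * \<theta> x) *s rep u x)"
      "integrable lborel (\<lambda>x. (cis (- (x \<bullet> \<xi>)) * dd (axis l 1) \<theta> x) *s rep u x)"
      by (intro L2_integrable_vsm testfun_L2 t L2_rep)+
    have j: "integrable lborel (\<lambda>x. (\<i> * (\<xi> $ l)) *s ((cis (- (x \<bullet> \<xi>)) * \<theta> x) *s rep u x))"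
      by (rule integrable_bounded_linear[OF vsm.bounded_linear_right i(1)])
    show ?thesis
      unfolding pair_def
      by (simp only: Bochner_Integration.integral_diff[OF i(2) j] integral_bounded_linear[OF vsm.bounded_linear_right i(1)])
  qed
  finally show ?thesis by (simp only: ft_vsm)
qed

lemma ft_add: "integrable lborel p \<Longrightarrow> integrable lborel q \<Longrightarrow> ft (\<lambda>x. p x + q x) \<xi> = ft p \<xi> + ft q \<xi>"
  by (simp add: ft_def vsm.add_right ft_integrable)

lemma ft_sum: "(\<And>i. i \<in> I \<Longrightarrow> integrable lborel (p i)) \<Longrightarrow> ft (\<lambda>x. \<Sum>i\<in>I. p i x) \<xi> = (\<Sum>i\<in>I. ft (p i) \<xi>)"
  by (simp add: ft_def vsm.sum_right ft_integrable)

lemma matrix_vector_smult: "(M :: complex ^ 'm::finite ^ 'k::finite) *v (c *s v) = c *s (M *v v)"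
  by (simp add: matrix_vector_mult_def vec_eq_iff sum_distrib_left mult_ac)

lemma ft_matrix:
  fixes M :: "complex ^ 'm::finite ^ 'k::finite"
  assumes "integrable lborel p" shows "ft (\<lambda>x. M *v p x) \<xi> = M *v ft p \<xi>"
  unfolding ft_def
  by (simp add: matrix_vector_smult[symmetric]
      integral_bounded_linear[OF matrix_vector_mul_bounded_linear ft_integrable[OF assms]])

text \<open>For the cut-offs \<open>\<eta> n\<close>, the functions \<open>p n\<close> and
  \<open>q n\<close> are the derivative and the system applied to \<open>\<eta> n\<close> times
  \<open>w\<close>. If W denotes the transform of the latter, their transforms are \<i> \<xi>_l W
  and \<i> times the symbol applied to W, so the bound on the symbol feeds
  \<open>ft_comparison\<close>. As the cut-offs are dilated, the terms containing their derivatives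
  vanish in L^2.\<close>

lemma elliptic_apriori:
  fixes A :: "'d::finite \<Rightarrow> complex ^ 'n::finite ^ 'n"
  assumes C: "0 \<le> C" "\<And>\<xi> v. \<bar>\<xi> $ l\<bar> * norm v \<le> C * norm ((\<Sum>k\<in>UNIV. (\<xi> $ k) *\<^sub>R A k) *v v)"
    and f: "(w, f) \<in> sysop A" and g: "(w, g) \<in> wd l"
  shows "norm g \<le> C * norm f"
proof -
  \<comment> \<open>This bump is not 1 near the origin; the limits carry the nonzero factor
    \<open>\<theta> 0\<close>, which is cancelled at the end.\<close>
  define \<theta> :: "real ^ 'd \<Rightarrow> complex" where "\<theta> x = complex_of_real (bump 1 (- One) One x)" for x
  have \<theta>: "testfun \<theta>" unfolding \<theta>_def[abs_def] by (rule testfun_bump) simp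
  have "(0 :: real ^ 'd) \<in> box (- One) One" by (simp add: box_def)
  then have \<theta>0: "\<theta> 0 \<noteq> 0" using bump_pos[of 1 0 "- One" "One :: real ^ 'd"] by (simp add: \<theta>_def)
  have \<theta>1: "norm (\<theta> x) \<le> 1" for x using bump_bounds[of 1 "- One" One x] by (simp add: \<theta>_def)
  have "\<exists>B. 0 < B \<and> (\<forall>x. norm (dd (axis k 1) \<theta> x) \<le> B)" for k
    using testfun_bounded[OF testfun_dd[OF \<theta>, of "axis k 1"]] by (metis axis_in_Basis_iff Basis_real_def insertI1)
  then obtain B where B: "\<And>k x. norm (dd (axis k 1) \<theta> x) \<le> B k" "\<And>k. 0 < B k" by metis
  define \<delta> where "\<delta> n = inverse (real (Suc n))" for n
  have \<delta>: "0 < \<delta> n" "\<delta> n \<le> 1" for n by (simp_all add: \<delta>_def inverse_le_1_iff)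
  have \<delta>0: "\<delta> \<longlonglongrightarrow> 0" unfolding \<delta>_def by (rule LIMSEQ_inverse_real_of_nat)
  \<comment> \<open>Dilation by \<open>\<delta> n\<close> gives each first derivative of the cut-off
    the factor \<open>\<delta> n\<close>, so these derivatives tend to 0 uniformly.\<close>
  define \<eta> where "\<eta> n x = \<theta> (\<delta> n *\<^sub>R x)" for n x
  have \<eta>: "testfun (\<eta> n)" for n unfolding \<eta>_def[abs_def] by (intro testfun_dilate \<theta> \<delta>)
  define E where "E n k x = dd (axis k 1) (\<eta> n) x" for n k x
  have E_eq: "E n k x = \<delta> n *\<^sub>R dd (axis k 1) \<theta> (\<delta> n *\<^sub>R x)" for n k x
    unfolding E_def \<eta>_def by (rule dd_dilate[OF \<theta>])
  have E_le: "norm (E n k x) \<le> \<delta> n * B k" for n k x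
    unfolding E_eq using B(1)[of "\<delta> n *\<^sub>R x" k] \<delta>(1)[of n] by simp
  have E_B: "norm (E n k x) \<le> B k" for n k x
  proof -
    have "\<delta> n * B k \<le> 1 * B k" using \<delta>(2)[of n] B(2)[of k] by (intro mult_right_mono) auto
    then show ?thesis using E_le[of n k x] by simp
  qed
  have E_0: "(\<lambda>n. E n k x) \<longlonglongrightarrow> 0" for k x
    by (rule Lim_null_comparison[of _ "\<lambda>n. \<delta> n * B k"])
      (use E_le tendsto_mult_right[OF \<delta>0, of "B k"] in auto)
  have E_test: "testfun (E n k)" for n k
    unfolding E_def[abs_def] by (intro testfun_dd \<eta>) simp
  have \<eta>1: "norm (\<eta> n x) \<le> 1" for n x unfolding \<eta>_def by (rule \<theta>1)
  have "isCont \<theta> 0" using testfun_continuous[OF \<theta>] by (simp add: continuous_on_eq_continuous_at)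
  then have \<eta>_lim: "(\<lambda>n. \<eta> n x) \<longlonglongrightarrow> \<theta> 0" for x
    unfolding \<eta>_def using isCont_tendsto_compose[of 0 \<theta>] tendsto_scaleR[OF \<delta>0 tendsto_const, of x] by simp
  have int: "integrable lborel (\<lambda>x. a x *s rep u x)" if "testfun a" for a and u :: "(real ^ 'd, complex ^ 'n) lsq"
    by (intro L2_integrable_vsm testfun_L2 that L2_rep)
  have L2v: "L2 (\<lambda>x. a x *s rep u x)" if "testfun a" for a and u :: "(real ^ 'd, complex ^ 'n) lsq"
    using testfun_bounded[OF that] L2_bounded_vsm(1)[OF testfun_borel[OF that]] by metis
  have intA: "integrable lborel (\<lambda>x. A k *v (E n k x *s rep w x))" for n k
    by (intro integrable_bounded_linear[OF matrix_vector_mul_bounded_linear] int E_test)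
  have L2A: "L2 (\<lambda>x. A k *v (E n k x *s rep w x))" for n k
    by (rule pw_bounded_L2[OF pw_bounded_const[OF matrix_vector_mul_linear] L2v[OF E_test]])
  have L2sum: "L2 (\<lambda>x. \<Sum>k\<in>UNIV. A k *v (E n k x *s rep w x))" for n
    using lsq_sum[of "UNIV :: 'd set" "\<lambda>k x. A k *v (E n k x *s rep w x)"] L2A by simp
  define p where "p n x = \<eta> n x *s rep g x + E n l x *s rep w x" for n x
  define q where "q n x = \<eta> n x *s rep f x + (\<Sum>k\<in>UNIV. A k *v (E n k x *s rep w x))" for n x
  have L2p: "L2 (p n)" and L2q: "L2 (q n)" for n
    unfolding p_def[abs_def] q_def[abs_def] by (intro L2_add L2v \<eta> E_test L2sum)+
  have est: "L2_norm (p n) \<le> C * L2_norm (q n)" for n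
  proof (rule ft_comparison[OF _ L2p _ L2q C(1)])
    show "integrable lborel (p n)" "integrable lborel (q n)"
      unfolding p_def[abs_def] q_def[abs_def]
      by (intro Bochner_Integration.integrable_add Bochner_Integration.integrable_sum int intA \<eta> E_test)+
    fix \<xi> :: "real ^ 'd"
    let ?W = "ft (\<lambda>x. \<eta> n x *s rep w x) \<xi>"
    let ?E = "\<lambda>k. ft (\<lambda>x. E n k x *s rep w x) \<xi>"
    let ?\<psi> = "\<lambda>x. cis (- (x \<bullet> \<xi>)) * \<eta> n x"
    have "Ck k (\<lambda>x. cis (- (x \<bullet> \<xi>)))" for k using Ck_cis[of k "- \<xi>"] by simp
    then have \<psi>: "testfun ?\<psi>" by (intro testfun_mult \<eta>)
    have pd: "pair (dd (axis k 1) ?\<psi>) w = ?E k - (\<i> * (\<xi> $ k)) *s ?W" for k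
      unfolding pair_dd_modulation[OF \<eta>] E_def ..
    have "ft (\<lambda>x. \<eta> n x *s rep g x) \<xi> = - pair (dd (axis l 1) ?\<psi>) w"
      using g \<psi> unfolding ft_vsm wd_def by simp
    then have "ft (p n) \<xi> = (\<i> * (\<xi> $ l)) *s ?W"
      unfolding p_def[abs_def] by (simp add: ft_add int \<eta> E_test pd)
    then have "norm (ft (p n) \<xi>) = \<bar>\<xi> $ l\<bar> * norm ?W" by (simp add: norm_mult)
    also have "\<dots> \<le> C * norm ((\<Sum>k\<in>UNIV. (\<xi> $ k) *\<^sub>R A k) *v ?W)" by (rule C(2))
    also have "norm ((\<Sum>k\<in>UNIV. (\<xi> $ k) *\<^sub>R A k) *v ?W) = norm (ft (q n) \<xi>)"
    proof -
      have "ft (\<lambda>x. \<eta> n x *s rep f x) \<xi> = - (\<Sum>k\<in>UNIV. A k *v pair (dd (axis k 1) ?\<psi>) w)"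
        using f \<psi> unfolding ft_vsm sysop_def by simp
      then have "ft (q n) \<xi> = - (\<Sum>k\<in>UNIV. A k *v (?E k - (\<i> * (\<xi> $ k)) *s ?W)) + (\<Sum>k\<in>UNIV. A k *v ?E k)"
        unfolding q_def[abs_def]
        by (subst ft_add) (simp_all add: int \<eta> intA ft_sum ft_matrix E_test pd)
      \<comment> \<open>The terms with the derivative on the cut-off cancel; they were included in
        \<open>q n\<close> for this purpose.\<close>
      also have "\<dots> = (\<Sum>k\<in>UNIV. A k *v ((\<i> * (\<xi> $ k)) *s ?W))"
        by (simp add: matrix_vector_mult_diff_distrib sum_subtractf)
      also have "\<dots> = \<i> *s ((\<Sum>k\<in>UNIV. (\<xi> $ k) *\<^sub>R A k) *v ?W)"
      proof -
        have "(\<Sum>k\<in>UNIV. (\<xi> $ k) *\<^sub>R A k) *v ?W = (\<Sum>k\<in>UNIV. complex_of_real (\<xi> $ k) *s (A k *v ?W))"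
          by (simp add: matrix_vector_mult_def vec_eq_iff sum_distrib_right sum_distrib_left sum_component
              scaleR_conv_of_real[where 'a=complex] mult.assoc) (auto intro: sum.swap)
        then show ?thesis by (simp add: matrix_vector_smult vsm.sum_right vector_smult_assoc)
      qed
      finally show ?thesis by simp
    qed
    finally show "norm (ft (p n) \<xi>) \<le> C * norm (ft (q n) \<xi>)" .
  qed
  have \<theta>0m: "(\<lambda>x::real^'d. \<theta> 0) \<in> borel_measurable borel" by simp
  have p_lim: "(\<lambda>n. lsq (p n)) \<longlonglongrightarrow> lsq (\<lambda>x. \<theta> 0 *s rep g x)"
  proof (rule lsq_tendsto_dominated[OF L2p])
    show "L2 (\<lambda>x. \<theta> 0 *s rep g x)" by (rule L2_bounded_vsm(1)[OF \<theta>0m order_refl])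
    show "L2 (\<lambda>x. norm (rep g x) + B l *\<^sub>R norm (rep w x))"
      by (intro L2_add L2_scaleR L2_norm_fun L2_rep)
    show "AE x in lborel. norm (p n x) \<le> norm (norm (rep g x) + B l *\<^sub>R norm (rep w x))" for n
    proof (intro always_eventually allI)
      fix x
      have "norm (p n x) \<le> norm (\<eta> n x) * norm (rep g x) + norm (E n l x) * norm (rep w x)"
        unfolding p_def using norm_triangle_ineq[of "\<eta> n x *s rep g x" "E n l x *s rep w x"] by simp
      also have "\<dots> \<le> 1 * norm (rep g x) + B l * norm (rep w x)"
        by (intro add_mono mult_right_mono \<eta>1 E_B) auto
      finally show "norm (p n x) \<le> norm (norm (rep g x) + B l *\<^sub>R norm (rep w x))" by simp
    qed
    show "AE x in lborel. (\<lambda>n. p n x) \<longlonglongrightarrow> \<theta> 0 *s rep g x"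
    proof (intro always_eventually allI)
      fix x
      have "(\<lambda>n. p n x) \<longlonglongrightarrow> \<theta> 0 *s rep g x + 0 *s rep w x"
        unfolding p_def by (intro tendsto_add vsm.tendsto \<eta>_lim E_0 tendsto_const)
      then show "(\<lambda>n. p n x) \<longlonglongrightarrow> \<theta> 0 *s rep g x" by simp
    qed
  qed
  define c where "c k = onorm ((*v) (A k))" for k
  have c: "norm (A k *v v) \<le> c k * norm v" "0 \<le> c k" for k v
    unfolding c_def by (intro onorm onorm_pos_le matrix_vector_mul_bounded_linear)+
  have q_lim: "(\<lambda>n. lsq (q n)) \<longlonglongrightarrow> lsq (\<lambda>x. \<theta> 0 *s rep f x)"
  proof (rule lsq_tendsto_dominated[OF L2q])
    show "L2 (\<lambda>x. \<theta> 0 *s rep f x)" by (rule L2_bounded_vsm(1)[OF \<theta>0m order_refl])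
    show "L2 (\<lambda>x. norm (rep f x) + (\<Sum>k\<in>UNIV. c k * B k) *\<^sub>R norm (rep w x))"
      by (intro L2_add L2_scaleR L2_norm_fun L2_rep)
    show "AE x in lborel. norm (q n x) \<le> norm (norm (rep f x) + (\<Sum>k\<in>UNIV. c k * B k) *\<^sub>R norm (rep w x))" for n
    proof (intro always_eventually allI)
      fix x
      have 1: "norm (A k *v (E n k x *s rep w x)) \<le> c k * B k * norm (rep w x)" for k
      proof -
        have "norm (A k *v (E n k x *s rep w x)) \<le> c k * (norm (E n k x) * norm (rep w x))"
          using c(1)[of k "E n k x *s rep w x"] by simp
        also have "\<dots> \<le> c k * (B k * norm (rep w x))"
          by (intro mult_left_mono mult_right_mono E_B c) auto
        finally show ?thesis by (simp add: mult.assoc)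
      qed
      have "norm (q n x) \<le> norm (\<eta> n x) * norm (rep f x) + norm (\<Sum>k\<in>UNIV. A k *v (E n k x *s rep w x))"
        unfolding q_def using norm_triangle_ineq[of "\<eta> n x *s rep f x"] by simp
      also have "\<dots> \<le> 1 * norm (rep f x) + (\<Sum>k\<in>UNIV. c k * B k * norm (rep w x))"
        by (intro add_mono mult_right_mono \<eta>1 sum_norm_le 1) auto
      also have "\<dots> = norm (rep f x) + (\<Sum>k\<in>UNIV. c k * B k) *\<^sub>R norm (rep w x)"
        by (simp add: sum_distrib_right)
      finally show "norm (q n x) \<le> norm (norm (rep f x) + (\<Sum>k\<in>UNIV. c k * B k) *\<^sub>R norm (rep w x))"
        by simp
    qed
    show "AE x in lborel. (\<lambda>n. q n x) \<longlonglongrightarrow> \<theta> 0 *s rep f x"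
    proof (intro always_eventually allI)
      fix x
      have "(\<lambda>n. q n x) \<longlonglongrightarrow> \<theta> 0 *s rep f x + (\<Sum>k\<in>UNIV. A k *v (0 *s rep w x))"
        unfolding q_def
        by (intro tendsto_add tendsto_sum bounded_linear.tendsto[OF matrix_vector_mul_bounded_linear] vsm.tendsto \<eta>_lim E_0 tendsto_const)
      then show "(\<lambda>n. q n x) \<longlonglongrightarrow> \<theta> 0 *s rep f x" by simp
    qed
  qed
  have norm0: "norm (lsq (\<lambda>x. \<theta> 0 *s rep u x)) = norm (\<theta> 0) * norm u" for u :: "(real ^ 'd, complex ^ 'n) lsq"
  proof -
    have "L2 (\<lambda>x. \<theta> 0 *s rep u x)" by (rule L2_bounded_vsm(1)[OF \<theta>0m order_refl])
    then have "norm (lsq (\<lambda>x. \<theta> 0 *s rep u x)) = L2_norm (\<lambda>x. \<theta> 0 *s rep u x)" by (rule norm_lsq)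
    then show ?thesis
      unfolding norm_lsq_eq[of u] by (simp add: L2_norm_def power_mult_distrib real_sqrt_mult)
  qed
  have "norm (lsq (\<lambda>x. \<theta> 0 *s rep g x)) \<le> C * norm (lsq (\<lambda>x. \<theta> 0 *s rep f x))"
    by (rule LIMSEQ_le[OF tendsto_norm[OF p_lim] tendsto_mult_left[OF tendsto_norm[OF q_lim]]])
      (use est in \<open>simp add: norm_lsq L2p L2q\<close>)
  then have "norm (\<theta> 0) * norm g \<le> norm (\<theta> 0) * (C * norm f)" by (simp add: norm0 mult_ac)
  then show ?thesis using \<theta>0 by simp
qed

section \<open>Regularity by averaging translates\<close>

lemma average_tendsto:
  fixes \<phi> :: "real \<Rightarrow> 'x::banach"
  assumes "continuous_on UNIV \<phi>" and a: "\<And>n. 0 < a n" "a \<longlonglongrightarrow> 0"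
  shows "(\<lambda>n. integral {0..a n} \<phi> /\<^sub>R a n) \<longlonglongrightarrow> \<phi> 0"
proof (rule LIMSEQ_I)
  fix r :: real assume r: "0 < r"
  have "isCont \<phi> 0" using assms(1) by (simp add: continuous_on_eq_continuous_at)
  then obtain d where d: "0 < d" "\<And>s. \<bar>s\<bar> < d \<Longrightarrow> norm (\<phi> s - \<phi> 0) < r / 2"
    unfolding continuous_at_eps_delta dist_norm using r by (metis diff_zero half_gt_zero real_norm_def)
  obtain N where N: "\<And>n. N \<le> n \<Longrightarrow> a n < d"
    using order_tendstoD(2)[OF a(2) d(1)] unfolding eventually_sequentially by blast
  show "\<exists>N. \<forall>n\<ge>N. norm (integral {0..a n} \<phi> /\<^sub>R a n - \<phi> 0) < r"
  proof (intro exI allI impI)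
    fix n assume n: "N \<le> n"
    have c: "continuous_on {0..a n} \<phi>" using assms(1) by (rule continuous_on_subset) simp
    have "norm (integral {0..a n} (\<lambda>s. \<phi> s - \<phi> 0)) \<le> r / 2 * (a n - 0)"
    proof (rule integral_bound)
      show "continuous_on {0..a n} (\<lambda>s. \<phi> s - \<phi> 0)" by (intro continuous_intros c)
      show "norm (\<phi> s - \<phi> 0) \<le> r / 2" if "s \<in> {0..a n}" for s
        using d(2)[of s] N[OF n] that by simp
    qed (use a(1)[of n] in simp)
    moreover have "integral {0..a n} (\<lambda>s. \<phi> s - \<phi> 0) = integral {0..a n} \<phi> - a n *\<^sub>R \<phi> 0"
      using a(1)[of n] by (subst Henstock_Kurzweil_Integration.integral_diff) (auto intro: integrable_continuous_interval c)
    ultimately have le: "norm (integral {0..a n} \<phi> - a n *\<^sub>R \<phi> 0) \<le> r / 2 * a n" by simp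
    have "integral {0..a n} \<phi> /\<^sub>R a n - \<phi> 0 = (integral {0..a n} \<phi> - a n *\<^sub>R \<phi> 0) /\<^sub>R a n"
      using a(1)[of n] by (simp add: scaleR_diff_right)
    then have "norm (integral {0..a n} \<phi> /\<^sub>R a n - \<phi> 0) = norm (integral {0..a n} \<phi> - a n *\<^sub>R \<phi> 0) / a n"
      using a(1)[of n] by (simp add: divide_inverse mult.commute)
    also have "\<dots> \<le> r / 2" using le a(1)[of n] by (simp add: pos_divide_le_eq)
    also have "\<dots> < r" using r by simp
    finally show "norm (integral {0..a n} \<phi> /\<^sub>R a n - \<phi> 0) < r" .
  qed
qed

text \<open>Paired with a test function, the translate by s is differentiable in s, and its
  derivative is the pairing that defines the weak derivative. The fundamental theorem of calculus
  then gives an exact identity, so averages of translates of any \<open>w\<close> have a weak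
  derivative in the direction of the shift.\<close>

lemma wd_translate_average:
  fixes w :: "(real ^ 'd::finite, complex ^ 'm::finite) lsq"
  assumes a: "0 < a"
  shows "(integral {0..a} (\<lambda>s. translate (s *\<^sub>R axis l 1) w), translate (a *\<^sub>R axis l 1) w - w) \<in> wd l"
  unfolding wd_def
proof (clarify)
  fix \<psi> :: "real ^ 'd \<Rightarrow> complex" assume \<psi>: "testfun \<psi>"
  let ?e = "axis l 1 :: real ^ 'd"
  obtain K where K: "compact K" "\<And>x. x \<notin> K \<Longrightarrow> \<psi> x = 0" using testfun_support[OF \<psi>] by metis
  interpret \<psi>: bounded_linear "pair \<psi> :: (real ^ 'd, complex ^ 'm) lsq \<Rightarrow> _" by (rule bounded_linear_pair_testfun[OF \<psi>])
  have bd: "bounded_linear (pair (dd ?e \<psi>) :: (real ^ 'd, complex ^ 'm) lsq \<Rightarrow> _)" by (rule bounded_linear_pair_dd[OF \<psi>])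
  have cont: "continuous_on {0..a} (\<lambda>s. translate (s *\<^sub>R ?e) w)"
    by (intro continuous_on_compose2[OF continuous_on_translate] continuous_intros) auto
  have "((\<lambda>s. - pair (dd ?e \<psi>) (translate (s *\<^sub>R ?e) w)) has_integral
      (pair \<psi> (translate (a *\<^sub>R ?e) w) - pair \<psi> (translate (0 *\<^sub>R ?e) w))) {0..a}"
  proof (rule fundamental_theorem_of_calculus)
    fix s :: real
    \<comment> \<open>A compact set containing the supports of all translates of
      \<open>\<psi>\<close> with parameter within distance 1 of \<open>s\<close>.\<close>
    let ?K = "{x + y | x y. x \<in> K \<and> y \<in> (\<lambda>r. r *\<^sub>R ?e) ` {s - 1..s + 1}}"
    have K': "compact ?K"
      by (intro compact_sums K(1) compact_continuous_image continuous_intros) auto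
    have zero: "\<psi> (x - r *\<^sub>R ?e) = 0" if "r \<in> {s - 1..s + 1}" "x \<notin> ?K" for r x
    proof (rule K(2))
      show "x - r *\<^sub>R ?e \<notin> K"
      proof
        assume *: "x - r *\<^sub>R ?e \<in> K"
        have "x = (x - r *\<^sub>R ?e) + r *\<^sub>R ?e" by simp
        then show False using that * by blast
      qed
    qed
    have der: "((\<lambda>r. \<psi> (x - r *\<^sub>R ?e)) has_vector_derivative - dd ?e \<psi> (x - r *\<^sub>R ?e)) (at r)" for r x
    proof -
      have "((\<lambda>r. x - r *\<^sub>R ?e) has_derivative (\<lambda>h. - (h *\<^sub>R ?e))) (at r)"
        by (auto intro!: derivative_eq_intros)
      then have "((\<lambda>r. \<psi> (x - r *\<^sub>R ?e)) has_derivative (\<lambda>h. dd (- (h *\<^sub>R ?e)) \<psi> (x - r *\<^sub>R ?e))) (at r)"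
        by (rule has_derivative_compose) (rule testfun_has_derivative[OF \<psi>])
      moreover have "linear (\<lambda>b. dd b \<psi> (x - r *\<^sub>R ?e))"
        by (rule has_derivative_linear[OF testfun_has_derivative[OF \<psi>]])
      ultimately show ?thesis
        by (simp add: has_vector_derivative_def linear_neg linear_scale)
    qed
    have c\<psi>: "continuous_on UNIV (\<lambda>x. \<psi> (x - r *\<^sub>R ?e))" for r
      by (intro continuous_on_compose2[OF testfun_continuous[OF \<psi>]] continuous_intros) auto
    have cd: "continuous_on UNIV (\<lambda>z. - dd ?e \<psi> (snd z - fst z *\<^sub>R ?e))"
      by (intro continuous_intros continuous_on_compose2[OF testfun_continuous[OF testfun_dd[OF \<psi>, of ?e]]]) auto
    note D = lsq_has_vector_derivative[of ?K "s - 1" "s + 1" "\<lambda>r x. \<psi> (x - r *\<^sub>R ?e)" s "\<lambda>r x. - dd ?e \<psi> (x - r *\<^sub>R ?e)",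
        OF K' zero _ _ der c\<psi> cd]
    have "((\<lambda>r. pair (rep (lsq (\<lambda>x. \<psi> (x - r *\<^sub>R ?e)))) w) has_vector_derivative
        pair (rep (lsq (\<lambda>x. - dd ?e \<psi> (x - s *\<^sub>R ?e)))) w) (at s)"
      by (rule bounded_linear.has_vector_derivative[OF pair.bounded_linear_left D(1)]) simp_all
    moreover have "pair (rep (lsq (\<lambda>x. \<psi> (x - r *\<^sub>R ?e)))) w = pair \<psi> (translate (r *\<^sub>R ?e) w)" for r
      by (simp add: pair_rep_lsq testfun_L2 testfun_translate \<psi> pair_translate)
    moreover have "pair (rep (lsq (\<lambda>x. - dd ?e \<psi> (x - s *\<^sub>R ?e)))) w = - pair (dd ?e \<psi>) (translate (s *\<^sub>R ?e) w)"
      using testfun_translate[OF testfun_dd[OF \<psi>, of ?e], of "s *\<^sub>R ?e"]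
      by (simp add: pair_rep_lsq testfun_L2 L2_minus pair_minus_left pair_translate testfun_dd \<psi>)
    ultimately show "((\<lambda>s. pair \<psi> (translate (s *\<^sub>R ?e) w)) has_vector_derivative - pair (dd ?e \<psi>) (translate (s *\<^sub>R ?e) w))
      (at s within {0..a})"
      by (simp add: has_vector_derivative_at_within)
  qed (use a in simp)
  then have "integral {0..a} (\<lambda>s. - pair (dd ?e \<psi>) (translate (s *\<^sub>R ?e) w)) = pair \<psi> (translate (a *\<^sub>R ?e) w - w)"
    unfolding \<psi>.diff by (simp only: integral_unique scaleR_zero_left translate_0)
  then show "- pair (dd ?e \<psi>) (integral {0..a} (\<lambda>s. translate (s *\<^sub>R ?e) w)) = pair \<psi> (translate (a *\<^sub>R ?e) w - w)"
    using integral_linear[OF integrable_continuous_interval[OF cont] bd] by (simp add: o_def)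
qed

text \<open>Averages of translates of \<open>w\<close> in direction \<open>l\<close> do have a
  derivative in that direction. Constant coefficients commute with translations, so the averages of
  \<open>f\<close> are their right-hand sides. The a priori estimate for differences makes the
  derivatives a Cauchy sequence, and the limit belongs to the closed graph.\<close>

theorem elliptic_regularity:
  fixes A :: "'d::finite \<Rightarrow> complex ^ 'n::finite ^ 'n"
  assumes A: "elliptic A" and f: "(w, f) \<in> sysop A"
  shows "\<exists>g. (w, g) \<in> wd l"
proof -
  obtain C where C: "0 \<le> C" "\<And>\<xi> v l. \<bar>\<xi> $ l\<bar> * norm v \<le> C * norm ((\<Sum>l\<in>UNIV. (\<xi> $ l) *\<^sub>R A l) *v v)"
    using elliptic_bound[OF A] by blast
  define a where "a n = inverse (real (Suc n))" for n
  have a: "0 < a n" for n by (simp add: a_def)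
  have a0: "a \<longlonglongrightarrow> 0" unfolding a_def by (rule LIMSEQ_inverse_real_of_nat)
  let ?T = "\<lambda>(u :: (real ^ 'd, complex ^ 'n) lsq) s. translate (s *\<^sub>R axis l 1) u"
  have cont: "continuous_on S (?T u)" for u S
    by (intro continuous_on_compose2[OF continuous_on_translate] continuous_intros) auto
  define W where "W u n = integral {0..a n} (?T u) /\<^sub>R a n" for u n
  have W_lim: "W u \<longlonglongrightarrow> u" for u
    using average_tendsto[OF cont a a0, of u] by (simp add: W_def[abs_def])
  define g where "g n = (?T w (a n) - w) /\<^sub>R a n" for n
  have sys: "(W w n, W f n) \<in> sysop A" for n
  proof -
    have "(integral {0..a n} (?T w), integral {0..a n} (?T f)) \<in> sysop A"
      by (intro integral_Pair_in_closed_subspace sysop_closed sysop_subspace cont sysop_translate f)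
    from subspace_scale[OF sysop_subspace this, of "inverse (a n)"] show ?thesis by (simp add: W_def)
  qed
  have wdg: "(W w n, g n) \<in> wd l" for n
    using subspace_scale[OF wd_subspace wd_translate_average[OF a], of "inverse (a n)" n l w]
    by (simp add: W_def g_def)
  have "norm (g m - g n) \<le> C * norm (W f m - W f n)" for m n
  proof (rule elliptic_apriori[OF C(1) C(2)])
    show "(W w m - W w n, W f m - W f n) \<in> sysop A"
      using subspace_diff[OF sysop_subspace sys[of m] sys[of n]] by simp
    show "(W w m - W w n, g m - g n) \<in> wd l"
      using subspace_diff[OF wd_subspace wdg[of m] wdg[of n]] by simp
  qed
  moreover have "Cauchy (W f)" using W_lim LIMSEQ_imp_Cauchy by blast
  ultimately have "Cauchy g"
  proof -
    assume le: "\<And>m n. norm (g m - g n) \<le> C * norm (W f m - W f n)" and c: "Cauchy (W f)"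
    show "Cauchy g"
    proof (rule CauchyI)
      fix e :: real assume "0 < e"
      \<comment> \<open>\<open>C\<close> may be 0, so \<open>C + 1\<close> is used as the
        denominator.\<close>
      then have "0 < e / (C + 1)" using C(1) by simp
      then obtain M where M: "\<And>m n. M \<le> m \<Longrightarrow> M \<le> n \<Longrightarrow> norm (W f m - W f n) < e / (C + 1)"
        using CauchyD[OF c] by blast
      show "\<exists>M. \<forall>m\<ge>M. \<forall>n\<ge>M. norm (g m - g n) < e"
      proof (intro exI allI impI)
        fix m n assume mn: "M \<le> m" "M \<le> n"
        have "norm (g m - g n) \<le> (C + 1) * norm (W f m - W f n)"
          by (rule order_trans[OF le]) (intro mult_right_mono; simp)
        also have "\<dots> < (C + 1) * (e / (C + 1))"
          using M[OF mn] C(1) by (intro mult_strict_left_mono) auto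
        also have "\<dots> = e" using C(1) by simp
        finally show "norm (g m - g n) < e" .
      qed
    qed
  qed
  then obtain g0 where "g \<longlonglongrightarrow> g0" using Cauchy_convergent_iff convergent_def by blast
  then have "(\<lambda>n. (W w n, g n)) \<longlonglongrightarrow> (w, g0)" by (intro tendsto_Pair W_lim)
  then have "(w, g0) \<in> wd l" by (rule closed_sequentially[OF wd_closed wdg])
  then show ?thesis ..
qed

section \<open>Distributional and mild solutions\<close>

lemma real_frechet_has_derivative:
  fixes \<eta> :: "real \<Rightarrow> 'b::real_normed_vector"
  assumes "Ck (Suc k) \<eta>"
  shows "(\<eta> has_vector_derivative frechet_derivative \<eta> (at t) 1) (at t)"
proof -
  have d: "(\<eta> has_derivative frechet_derivative \<eta> (at t)) (at t)" by (rule Ck_Suc_has_derivative[OF assms])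
  have "frechet_derivative \<eta> (at t) = (\<lambda>h. h *\<^sub>R frechet_derivative \<eta> (at t) 1)"
  proof
    fix h
    show "frechet_derivative \<eta> (at t) h = h *\<^sub>R frechet_derivative \<eta> (at t) 1"
      using linear_scale[OF has_derivative_linear[OF d], of h 1] unfolding real_scaleR_def mult_1_right .
  qed
  with d show ?thesis unfolding has_vector_derivative_def by (rule subst[rotated])
qed

text \<open>The mollification \<open>H\<close> is constant, since its derivative at \<open>s\<close>
  is the hypothesis tested with a shifted mollifier, up to sign. It is close to a fixed multiple of
  \<open>h\<close>, so \<open>h\<close> takes equal values at any two positive times; continuity
  extends this to time 0.\<close>

lemma du_bois_reymond:
  fixes h :: "real \<Rightarrow> 'v::banach"
  assumes h: "continuous_on {0..} h"
    and weak: "\<And>\<eta> a b. 0 < a \<Longrightarrow> a < b \<Longrightarrow> (\<And>k. Ck k \<eta>) \<Longrightarrow> (\<And>t. t \<notin> {a<..<b} \<Longrightarrow> \<eta> t = 0) \<Longrightarrow>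
      integral {a..b} (\<lambda>t. frechet_derivative \<eta> (at t) (1::real) *\<^sub>R h t) = 0"
    and t: "0 \<le> t"
  shows "h t = h 0"
proof -
  have cont: "continuous_on {c..d} h" if "0 \<le> c" for c d
    by (rule continuous_on_subset[OF h]) (use that in auto)
  have eq: "h a = h b" if ab: "0 < a" "a < b" for a b
  proof -
    have "norm (h a - h b) \<le> e" if e: "0 < e" for e
    proof -
      have near: "\<exists>d>0. \<forall>s\<in>{c..c+d}. norm (h s - h c) \<le> e / 2" if c: "0 < c" for c
      proof -
        have "\<exists>d>0. \<forall>s\<in>{0..}. dist s c < d \<longrightarrow> dist (h s) (h c) < e / 2"
          using h[unfolded continuous_on_iff, rule_format, of c "e / 2"] c e by auto
        then obtain d where d: "0 < d" "\<And>s. 0 \<le> s \<Longrightarrow> dist s c < d \<Longrightarrow> dist (h s) (h c) < e / 2"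
          by auto
        have "norm (h s - h c) \<le> e / 2" if "s \<in> {c..c + d/2}" for s
          using d(2)[of s] c d(1) that by (auto simp: dist_norm less_imp_le)
        then show ?thesis using d(1) by (intro exI[of _ "d/2"]) simp
      qed
      obtain d1 where d1: "0 < d1" "\<And>s. s \<in> {a..a+d1} \<Longrightarrow> norm (h s - h a) \<le> e / 2" using near[OF ab(1)] by blast
      obtain d2 where d2: "0 < d2" "\<And>s. s \<in> {b..b+d2} \<Longrightarrow> norm (h s - h b) \<le> e / 2" using near[of b] ab by auto
      define d where "d = min d1 d2"
      have d: "0 < d" using d1(1) d2(1) by (simp add: d_def)
      \<comment> \<open>Supported to the right of the origin, so the mollification at
        \<open>s\<close> sees only times in \<open>{s..s+d}\<close>. The mass \<open>M\<close> is
        left unnormalised and divided out at the end.\<close>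
      define \<rho> :: "real \<Rightarrow> real" where "\<rho> = bump 1 0 d"
      have \<rho>_Ck: "Ck k \<rho>" for k unfolding \<rho>_def by (rule Ck_bump)
      have \<rho>_cont: "continuous_on S \<rho>" for S using Ck_continuous[OF \<rho>_Ck[of 0]] by (rule continuous_on_subset) simp
      have \<rho>0: "0 \<le> \<rho> r" for r unfolding \<rho>_def by (rule bump_bounds)
      have \<rho>_out: "\<rho> r = 0" if "r \<notin> {0<..<d}" for r
        unfolding \<rho>_def by (rule bump_outside) (use that in \<open>auto simp: box_real\<close>)
      define \<rho>' where "\<rho>' r = frechet_derivative \<rho> (at r) 1" for r
      have \<rho>'_cont: "continuous_on S \<rho>'" for S
        using Ck_continuous[OF Ck_Suc_dest[OF \<rho>_Ck[of "Suc 0"], of 1]] unfolding \<rho>'_def[abs_def]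
        by (rule continuous_on_subset) auto
      have \<rho>_der: "(\<rho> has_vector_derivative \<rho>' r) (at r)" for r
        unfolding \<rho>'_def by (rule real_frechet_has_derivative[OF \<rho>_Ck])
      \<comment> \<open>The interval \<open>{a..b+d}\<close> contains the supports of all shifts
        with \<open>s\<close> in \<open>{a..b}\<close>; as it does not depend on \<open>s\<close>,
        differentiation under the integral is possible.\<close>
      define H where "H s = integral {a..b+d} (\<lambda>t. \<rho> (t - s) *\<^sub>R h t)" for s
      have c2: "continuous_on {a..b+d} (\<lambda>t. \<rho> (t - s) *\<^sub>R h t)" for s
        using ab by (intro continuous_intros cont continuous_on_compose2[OF \<rho>_cont[of UNIV]]) auto
      have "(H has_vector_derivative 0) (at s within {a..b})" if s: "s \<in> {a..b}" for s
      proof -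
        have "((\<lambda>s. integral (cbox a (b+d)) (\<lambda>t. \<rho> (t - s) *\<^sub>R h t)) has_vector_derivative
           integral (cbox a (b+d)) (\<lambda>t. - \<rho>' (t - s) *\<^sub>R h t)) (at s within {a..b})"
        proof (rule leibniz_rule_vector_derivative)
          fix s t :: real
          have "((\<lambda>s. t - s) has_vector_derivative - 1) (at s)"
            by (auto intro!: derivative_eq_intros)
          from vector_diff_chain_at[OF this \<rho>_der]
          have "((\<lambda>s. \<rho> (t - s)) has_vector_derivative - \<rho>' (t - s)) (at s)" by (simp add: o_def)
          from bounded_linear.has_vector_derivative[OF bounded_linear_scaleR_left this]
          show "((\<lambda>s. \<rho> (t - s) *\<^sub>R h t) has_vector_derivative - \<rho>' (t - s) *\<^sub>R h t) (at s within {a..b})"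
            by (rule has_vector_derivative_at_within)
        next
          show "(\<lambda>t. \<rho> (t - s) *\<^sub>R h t) integrable_on cbox a (b+d)" for s
            using integrable_continuous_interval[OF c2] by simp
          have "continuous_on ({a..b} \<times> {a..b+d}) (\<lambda>z. - \<rho>' (snd z - fst z) *\<^sub>R h (snd z))"
            using ab by (intro continuous_intros continuous_on_compose2[OF \<rho>'_cont[of UNIV]] continuous_on_compose2[OF cont[of a "b+d"]]) auto
          then show "continuous_on ({a..b} \<times> cbox a (b + d)) (\<lambda>(s, t). - \<rho>' (t - s) *\<^sub>R h t)"
            by (simp add: case_prod_beta)
        qed (use s in auto)
        moreover have "integral {a..b+d} (\<lambda>t. \<rho>' (t - s) *\<^sub>R h t) = 0"
        proof -
          have fd: "frechet_derivative (\<lambda>t. \<rho> (t - s)) (at t) 1 = \<rho>' (t - s)" for t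
          proof -
            have "((\<lambda>t. t - s) has_vector_derivative 1) (at t)" by (auto intro!: derivative_eq_intros)
            from vector_diff_chain_at[OF this \<rho>_der]
            have "((\<lambda>t. \<rho> (t - s)) has_derivative (\<lambda>r. r *\<^sub>R \<rho>' (t - s))) (at t)"
              by (simp add: o_def has_vector_derivative_def)
            from frechet_derivative_at[OF this, symmetric] show ?thesis by simp
          qed
          have "integral {a..b+d} (\<lambda>t. frechet_derivative (\<lambda>t. \<rho> (t - s)) (at t) 1 *\<^sub>R h t) = 0"
          proof (rule weak)
            show "Ck k (\<lambda>t. \<rho> (t - s))" for k
              using Ck_compose_affine[OF bounded_linear_ident \<rho>_Ck, where c="- s"] by simp
            show "\<rho> (t - s) = 0" if "t \<notin> {a<..<b + d}" for t
              by (rule \<rho>_out) (use that s in auto)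
          qed (use ab d in auto)
          then show ?thesis by (simp add: fd)
        qed
        ultimately show ?thesis by (simp add: H_def[abs_def])
      qed
      then obtain c where "\<And>s. s \<in> {a..b} \<Longrightarrow> H s = c"
        using has_vector_derivative_zero_constant[of "{a..b}" H] convex_real_interval(5) by blast
      then have Hab: "H a = H b" using ab by simp
      define M where "M = integral {0..d} \<rho>"
      have M: "0 < M"
      proof -
        have "M \<noteq> 0"
        proof
          assume "M = 0"
          then have "\<forall>r\<in>{0..d}. \<rho> r = 0"
            using integral_eq_0_iff[of 0 d \<rho>] \<rho>0 \<rho>_cont d by (simp add: M_def)
          moreover have "0 < \<rho> (d / 2)" unfolding \<rho>_def by (rule bump_pos) (use d in \<open>auto simp: box_real\<close>)
          ultimately show False using d by auto
        qed
        moreover have "0 \<le> M" unfolding M_def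
          by (intro Henstock_Kurzweil_Integration.integral_nonneg integrable_continuous_interval \<rho>_cont \<rho>0)
        ultimately show ?thesis by simp
      qed
      have Ms: "integral {a..b+d} (\<lambda>t. \<rho> (t - s)) = M" if s: "s \<in> {a..b}" for s
      proof -
        have "integral {a..b+d} (\<lambda>t. \<rho> (t - s)) = integral {a - s..b + d - s} \<rho>"
          using integral_shift_real_ivl[of "a - s" "-s" "b + d - s" \<rho>] by simp
        also have "\<dots> = integral {a - s..0} \<rho> + (integral {0..d} \<rho> + integral {d..b + d - s} \<rho>)"
          using s d by (simp add: Henstock_Kurzweil_Integration.integral_combine integrable_continuous_interval \<rho>_cont)
        also have "integral {a - s..0} \<rho> = integral {a - s..0} (\<lambda>_. 0)"
          by (rule Henstock_Kurzweil_Integration.integral_cong) (simp add: \<rho>_out)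
        also have "integral {d..b + d - s} \<rho> = integral {d..b + d - s} (\<lambda>_. 0)"
          by (rule Henstock_Kurzweil_Integration.integral_cong) (simp add: \<rho>_out)
        finally show ?thesis by (simp add: M_def)
      qed
      have est: "norm (H s - M *\<^sub>R h s) \<le> e / 2 * M"
        if s: "s \<in> {a..b}" and near: "\<And>t. t \<in> {s..s+d} \<Longrightarrow> norm (h t - h s) \<le> e / 2" for s
      proof -
        have ci: "continuous_on {a..b+d} (\<lambda>t. \<rho> (t - s))"
          by (intro continuous_on_compose2[OF \<rho>_cont[of UNIV]] continuous_intros) auto
        have "H s - M *\<^sub>R h s = integral {a..b+d} (\<lambda>t. \<rho> (t - s) *\<^sub>R h t - \<rho> (t - s) *\<^sub>R h s)"
        proof (subst Henstock_Kurzweil_Integration.integral_diff)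
          show "H s - M *\<^sub>R h s = integral {a..b+d} (\<lambda>t. \<rho> (t - s) *\<^sub>R h t) - integral {a..b+d} (\<lambda>t. \<rho> (t - s) *\<^sub>R h s)"
            using integral_linear[OF integrable_continuous_interval[OF ci] bounded_linear_scaleR_left[of "h s"]]
            by (simp add: H_def o_def Ms[OF s])
        qed (intro integrable_continuous_interval c2 continuous_on_scaleR ci continuous_on_const)+
        also have "norm \<dots> \<le> integral {a..b+d} (\<lambda>t. \<rho> (t - s) * (e / 2))"
        proof (rule Henstock_Kurzweil_Integration.integral_norm_bound_integral)
          fix t assume "t \<in> {a..b+d}"
          show "norm (\<rho> (t - s) *\<^sub>R h t - \<rho> (t - s) *\<^sub>R h s) \<le> \<rho> (t - s) * (e / 2)"
          proof (cases "t \<in> {s..s+d}")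
            case True
            then show ?thesis
              using mult_left_mono[OF near[OF True] \<rho>0[of "t - s"]] \<rho>0[of "t - s"]
              by (simp add: scaleR_diff_right[symmetric])
          next
            case False
            then have "\<rho> (t - s) = 0" by (intro \<rho>_out) auto
            then show ?thesis by simp
          qed
        qed (intro integrable_continuous_interval c2 continuous_intros ci)+
        also have "\<dots> = e / 2 * M" using Ms[OF s] by simp
        finally show ?thesis .
      qed
      have "M *\<^sub>R (h a - h b) = (H b - M *\<^sub>R h b) - (H a - M *\<^sub>R h a)"
        by (simp add: Hab scaleR_diff_right)
      also have "norm \<dots> \<le> norm (H b - M *\<^sub>R h b) + norm (H a - M *\<^sub>R h a)"
        by (rule norm_triangle_ineq4)
      also have "\<dots> \<le> e / 2 * M + e / 2 * M"
        by (intro add_mono est) (use ab d1 d2 in \<open>auto simp: d_def\<close>)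
      finally have "M * norm (h a - h b) \<le> M * e" using M by (simp add: mult_ac)
      then show ?thesis using M by simp
    qed
    then have "norm (h a - h b) \<le> 0" by (rule field_le_epsilon) simp
    then show ?thesis by simp
  qed
  show ?thesis
  proof (cases "t = 0")
    case False
    then have t0: "0 < t" using t by simp
    \<comment> \<open>The double \<open>Suc\<close> keeps the factor strictly below 1, so each point
      lies strictly between 0 and \<open>t\<close>.\<close>
    have "(\<lambda>n. h (t * inverse (real (Suc (Suc n))))) \<longlonglongrightarrow> h 0"
    proof (rule continuous_on_tendsto_compose[OF h])
      have "(\<lambda>n. inverse (real (Suc (Suc n)))) \<longlonglongrightarrow> 0"
        using LIMSEQ_inverse_real_of_nat by (rule LIMSEQ_Suc)
      from tendsto_mult_left[OF this, of t] show "(\<lambda>n. t * inverse (real (Suc (Suc n)))) \<longlonglongrightarrow> 0" by simp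
    qed (use t0 in auto)
    moreover have "h (t * inverse (real (Suc (Suc n)))) = h t" for n
    proof (rule eq)
      have "0 < inverse (real (Suc (Suc n)))" "inverse (real (Suc (Suc n))) < 1"
        by (simp_all add: inverse_less_1_iff)
      then show "0 < t * inverse (real (Suc (Suc n)))" "t * inverse (real (Suc (Suc n))) < t"
        using t0 mult_strict_left_mono[of "inverse (real (Suc (Suc n)))" 1 t] by simp_all
    qed
    ultimately have "(\<lambda>n::nat. h t) \<longlonglongrightarrow> h 0" by simp
    then show ?thesis by (simp add: LIMSEQ_const_iff)
  qed simp
qed

section \<open>Space-time test functions as curves in L^2\<close>

lemma testfun_slice:
  fixes \<phi> :: "real \<times> 'a::euclidean_space \<Rightarrow> complex"
  assumes \<phi>: "testfun \<phi>"
  shows "testfun (\<lambda>x. \<phi> (t, x))"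
proof -
  obtain K where K: "compact K" "\<And>z. z \<notin> K \<Longrightarrow> \<phi> z = 0" using testfun_support[OF \<phi>] by metis
  show ?thesis
  proof (rule testfunI)
    show "Ck k (\<lambda>x. \<phi> (t, x))" for k
      using Ck_compose_affine[OF bounded_linear_Pair[OF bounded_linear_zero bounded_linear_ident] testfun_Ck[OF \<phi>], where c="(t, 0)"]
      by simp
    show "compact (snd ` K)" using K(1) by (intro compact_continuous_image continuous_intros)
    show "\<phi> (t, x) = 0" if "x \<notin> snd ` K" for x using K(2)[of "(t, x)"] that by (metis image_eqI snd_conv)
  qed
qed

lemma dd_slice:
  fixes \<phi> :: "real \<times> 'a::euclidean_space \<Rightarrow> complex"
  assumes \<phi>: "testfun \<phi>"
  shows "dd b (\<lambda>x. \<phi> (t, x)) x = frechet_derivative \<phi> (at (t, x)) (0, b)"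
proof -
  have "((\<lambda>x. (t, x)) has_derivative (\<lambda>b. (0, b))) (at x)" by (auto intro!: derivative_eq_intros)
  then have "((\<lambda>x. \<phi> (t, x)) has_derivative (\<lambda>b. frechet_derivative \<phi> (at (t, x)) (0, b))) (at x)"
    by (rule has_derivative_compose) (rule testfun_has_derivative[OF \<phi>])
  from frechet_derivative_at[OF this, symmetric] show ?thesis by simp
qed

text \<open>Viewed as a differentiable curve in L^2, a space-time test function can be paired with
  the curve of solution values by the calculus of bilinear maps.\<close>

lemma slice_has_vector_derivative:
  fixes \<phi> :: "real \<times> 'a::euclidean_space \<Rightarrow> complex"
  assumes \<phi>: "testfun \<phi>"
  shows "((\<lambda>t. lsq (\<lambda>x. \<phi> (t, x))) has_vector_derivative lsq (\<lambda>x. dd (1, 0) \<phi> (t, x))) (at t)"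
proof -
  obtain K where K: "compact K" "\<And>z. z \<notin> K \<Longrightarrow> \<phi> z = 0" using testfun_support[OF \<phi>] by metis
  have b: "(1::real, 0::'a) \<in> Basis" by (simp add: Basis_prod_def)
  show ?thesis
  proof (rule lsq_has_vector_derivative(1)[of "snd ` K" "t - 1" "t + 1"])
    show "compact (snd ` K)" using K(1) by (intro compact_continuous_image continuous_intros)
    show "\<phi> (s, x) = 0" if "x \<notin> snd ` K" for s x using K(2)[of "(s, x)"] that by (metis image_eqI snd_conv)
    show "((\<lambda>s. \<phi> (s, x)) has_vector_derivative dd (1, 0) \<phi> (s, x)) (at s)" for s x
    proof -
      have "((\<lambda>s. (s, x)) has_derivative (\<lambda>h. (h, 0))) (at s)" by (auto intro!: derivative_eq_intros)
      then have d: "((\<lambda>s. \<phi> (s, x)) has_derivative (\<lambda>h. frechet_derivative \<phi> (at (s, x)) (h, 0))) (at s)"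
        by (rule has_derivative_compose) (rule testfun_has_derivative[OF \<phi>])
      have "frechet_derivative \<phi> (at (s, x)) (h, 0) = h *\<^sub>R frechet_derivative \<phi> (at (s, x)) (1, 0)" for h
        using linear_scale[OF has_derivative_linear[OF testfun_has_derivative[OF \<phi>]], of "(s, x)" h "(1, 0)"] by simp
      then have eq: "(\<lambda>h. frechet_derivative \<phi> (at (s, x)) (h, 0)) = (\<lambda>h. h *\<^sub>R frechet_derivative \<phi> (at (s, x)) (1, 0))"
        by (rule ext)
      from d show ?thesis unfolding has_vector_derivative_def eq .
    qed
    show "continuous_on UNIV (\<lambda>x. \<phi> (s, x))" for s by (rule testfun_continuous[OF testfun_slice[OF \<phi>]])
    show "continuous_on UNIV (\<lambda>z. dd (1, 0) \<phi> (fst z, snd z))"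
      using testfun_continuous[OF testfun_dd[OF \<phi> b]] by simp
  qed simp_all
qed

lemma continuous_on_slice:
  fixes \<phi> :: "real \<times> 'a::euclidean_space \<Rightarrow> complex"
  assumes "testfun \<phi>" shows "continuous_on S (\<lambda>t. lsq (\<lambda>x. \<phi> (t, x)))"
  by (rule continuous_at_imp_continuous_on)
    (use slice_has_vector_derivative[OF assms] has_vector_derivative_continuous in blast)

text \<open>The spatial integral in \<open>dist_solution\<close>, for classes instead of functions
  and with the matrices pulled out of the pairings. It is continuous in time along a continuous
  curve, so the outer integral reduces to one over a compact interval.\<close>

definition weak_form :: "('d::finite \<Rightarrow> complex ^ 'm::finite ^ 'm) \<Rightarrow> ((real ^ 'd, complex ^ 'm) lsq \<Rightarrow> (real ^ 'd, complex ^ 'm) lsq)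
    \<Rightarrow> (real \<times> (real ^ 'd) \<Rightarrow> complex) \<Rightarrow> (real \<Rightarrow> (real ^ 'd, complex ^ 'm) lsq) \<Rightarrow> real \<Rightarrow> complex ^ 'm" where
  "weak_form A B \<phi> V t = - pair (\<lambda>x. dt \<phi> (t, x)) (V t)
     - (\<Sum>l\<in>UNIV. A l *v pair (dd (axis l 1) (\<lambda>x. \<phi> (t, x))) (V t)) + pair (\<lambda>x. \<phi> (t, x)) (B (V t))"

lemma dt_dd: "dt \<phi> z = dd (1, 0) \<phi> z"
  by (simp add: dt_def)

lemma dx_slice: "testfun \<phi> \<Longrightarrow> dx l \<phi> (t, x) = dd (axis l 1) (\<lambda>x. \<phi> (t, x)) x"
  by (simp add: dx_def dd_slice)

lemma testfun_dt: "testfun \<phi> \<Longrightarrow> testfun (\<lambda>x. dt \<phi> (t, x))"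
  unfolding dt_dd by (intro testfun_slice testfun_dd) (simp_all add: Basis_prod_def)

lemma test_function_testfun: "test_function \<phi> \<Longrightarrow> testfun \<phi>"
  by (simp add: test_function_def testfun_def)

lemma test_function_support:
  fixes \<phi> :: "real \<times> (real ^ 'd::finite) \<Rightarrow> complex"
  assumes "test_function \<phi>"
  obtains a b where "0 < a" "a < b" "\<And>t x. t \<notin> {a<..<b} \<Longrightarrow> \<phi> (t, x) = 0"
proof -
  let ?K = "closure {z. \<phi> z \<noteq> 0}"
  have K: "compact (fst ` ?K)" "fst ` ?K \<subseteq> {0<..}"
    using assms by (auto simp: test_function_def intro!: compact_continuous_image continuous_intros)
  have out: "\<phi> (t, x) = 0" if "t \<notin> fst ` ?K" for t x
  proof (rule ccontr)
    assume "\<phi> (t, x) \<noteq> 0"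
    then have "(t, x) \<in> ?K" using closure_subset[of "{z. \<phi> z \<noteq> 0}"] by auto
    then show False using that by force
  qed
  show thesis
  proof (cases "fst ` ?K = {}")
    case True
    then show thesis using out by (intro that[of 1 2]) auto
  next
    case False
    obtain m where m: "m \<in> fst ` ?K" "\<And>t. t \<in> fst ` ?K \<Longrightarrow> m \<le> t" using compact_attains_inf[OF K(1) False] by blast
    obtain M where M: "M \<in> fst ` ?K" "\<And>t. t \<in> fst ` ?K \<Longrightarrow> t \<le> M" using compact_attains_sup[OF K(1) False] by blast
    have m0: "0 < m" using m(1) K(2) by blast
    show thesis
    proof (rule that[of "m / 2" "M + 1"])
      show "0 < m / 2" "m / 2 < M + 1" using m0 M(2)[OF m(1)] by auto
      show "\<phi> (t, x) = 0" if "t \<notin> {m / 2<..<M + 1}" for t x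
      proof (rule out, rule notI)
        assume "t \<in> fst ` ?K"
        then have "m \<le> t" "t \<le> M" by (rule m(2), rule M(2))
        then show False using that m0 by simp
      qed
    qed
  qed
qed

lemma integral_weak_form:
  fixes u :: "real ^ 'd::finite \<Rightarrow> complex ^ 'm::finite"
  assumes \<phi>: "testfun \<phi>" and u: "L2 u" and M: "pw_bounded (\<lambda>x. (*v) (\<B> x)) C"
  shows "(\<integral>x. - (dt \<phi> (t, x) *s u x) - (\<Sum>l\<in>UNIV. dx l \<phi> (t, x) *s (\<A> l *v u x)) + \<phi> (t, x) *s (\<B> x *v u x) \<partial>lborel)
    = weak_form \<A> (pw (\<lambda>x. (*v) (\<B> x))) \<phi> (\<lambda>_. lsq u) t"
proof -
  let ?d = "\<lambda>l. dd (axis l 1) (\<lambda>x. \<phi> (t, x))"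
  have t: "testfun (\<lambda>x. dt \<phi> (t, x))" "testfun (\<lambda>x. \<phi> (t, x))" "testfun (?d l)" for l
    by (intro testfun_dt testfun_dd testfun_slice \<phi>; simp)+
  have i: "integrable lborel (\<lambda>x. dt \<phi> (t, x) *s u x)" "integrable lborel (\<lambda>x. ?d l x *s u x)" for l
    by (intro L2_integrable_vsm testfun_L2 t u)+
  have LB: "L2 (\<lambda>x. \<B> x *v u x)" by (rule pw_bounded_L2[OF M u])
  have iB: "integrable lborel (\<lambda>x. \<phi> (t, x) *s (\<B> x *v u x))"
    by (intro L2_integrable_vsm testfun_L2 t LB)
  have iA: "integrable lborel (\<lambda>x. \<A> l *v (?d l x *s u x))" for l
    by (rule integrable_bounded_linear[OF matrix_vector_mul_bounded_linear i(2)])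
  have "(\<integral>x. - (dt \<phi> (t, x) *s u x) - (\<Sum>l\<in>UNIV. dx l \<phi> (t, x) *s (\<A> l *v u x)) + \<phi> (t, x) *s (\<B> x *v u x) \<partial>lborel)
    = (\<integral>x. - (dt \<phi> (t, x) *s u x) - (\<Sum>l\<in>UNIV. \<A> l *v (?d l x *s u x)) + \<phi> (t, x) *s (\<B> x *v u x) \<partial>lborel)"
    by (simp add: dx_slice[OF \<phi>] matrix_vector_smult)
  also have "\<dots> = - (\<integral>x. dt \<phi> (t, x) *s u x \<partial>lborel) - (\<Sum>l\<in>UNIV. \<A> l *v (\<integral>x. ?d l x *s u x \<partial>lborel))
      + (\<integral>x. \<phi> (t, x) *s (\<B> x *v u x) \<partial>lborel)"
  proof -
    have 1: "integrable lborel (\<lambda>x. - (dt \<phi> (t, x) *s u x))" using i(1) by (rule integrable_minus)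
    have 2: "integrable lborel (\<lambda>x. \<Sum>l\<in>UNIV. \<A> l *v (?d l x *s u x))" by (intro Bochner_Integration.integrable_sum iA)
    have "(\<integral>x. (\<Sum>l\<in>UNIV. \<A> l *v (?d l x *s u x)) \<partial>lborel) = (\<Sum>l\<in>UNIV. \<A> l *v (\<integral>x. ?d l x *s u x \<partial>lborel))"
      by (simp only: Bochner_Integration.integral_sum[OF iA] integral_bounded_linear[OF matrix_vector_mul_bounded_linear i(2)])
    then show ?thesis
      by (simp only: Bochner_Integration.integral_add[OF Bochner_Integration.integrable_diff[OF 1 2] iB]
          Bochner_Integration.integral_diff[OF 1 2] integral_minus)
  qed
  also have "\<dots> = weak_form \<A> (pw (\<lambda>x. (*v) (\<B> x))) \<phi> (\<lambda>_. lsq u) t"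
    by (simp add: weak_form_def pair_lsq[OF testfun_L2[OF t(1)] u] pair_lsq[OF testfun_L2[OF t(2)] LB]
        pair_lsq[OF testfun_L2[OF t(3)] u] pw_lsq[OF M u])
  finally show ?thesis .
qed

lemma dist_solution_iff:
  fixes U :: "real \<Rightarrow> real ^ 'd::finite \<Rightarrow> complex ^ 'm::finite"
  assumes U: "\<And>t. 0 \<le> t \<Longrightarrow> L2 (U t)" and M: "pw_bounded (\<lambda>x. (*v) (\<B> x)) C"
  shows "dist_solution \<A> \<B> U \<longleftrightarrow> (\<forall>\<phi>. test_function \<phi> \<longrightarrow>
    (LINT t:{0<..}|lborel. weak_form \<A> (pw (\<lambda>x. (*v) (\<B> x))) \<phi> (\<lambda>t. lsq (U t)) t) = 0)"
  unfolding dist_solution_def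
proof (intro iff_allI imp_cong refl)
  fix \<phi> :: "real \<times> (real ^ 'd) \<Rightarrow> complex" assume \<phi>: "test_function \<phi>"
  have "(LINT t:{0<..}|lborel. (\<integral>x. - (dt \<phi> (t, x) *s U t x) - (\<Sum>l\<in>UNIV. dx l \<phi> (t, x) *s (\<A> l *v U t x)) + \<phi> (t, x) *s (\<B> x *v U t x) \<partial>lborel))
    = (LINT t:{0<..}|lborel. weak_form \<A> (pw (\<lambda>x. (*v) (\<B> x))) \<phi> (\<lambda>t. lsq (U t)) t)"
  proof (rule set_lebesgue_integral_cong)
    show "\<forall>t. t \<in> {0<..} \<longrightarrow> (\<integral>x. - (dt \<phi> (t, x) *s U t x) - (\<Sum>l\<in>UNIV. dx l \<phi> (t, x) *s (\<A> l *v U t x)) + \<phi> (t, x) *s (\<B> x *v U t x) \<partial>lborel)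
      = weak_form \<A> (pw (\<lambda>x. (*v) (\<B> x))) \<phi> (\<lambda>t. lsq (U t)) t"
    proof (intro allI impI)
      fix t :: real assume "t \<in> {0<..}"
      then show "(\<integral>x. - (dt \<phi> (t, x) *s U t x) - (\<Sum>l\<in>UNIV. dx l \<phi> (t, x) *s (\<A> l *v U t x)) + \<phi> (t, x) *s (\<B> x *v U t x) \<partial>lborel)
      = weak_form \<A> (pw (\<lambda>x. (*v) (\<B> x))) \<phi> (\<lambda>t. lsq (U t)) t"
        using integral_weak_form[OF test_function_testfun[OF \<phi>] U M, of t t \<A>] by (simp add: weak_form_def)
    qed
  qed simp
  then show "((LINT t:{0<..}|lborel. (\<integral>x. - (dt \<phi> (t, x) *s U t x) - (\<Sum>l\<in>UNIV. dx l \<phi> (t, x) *s (\<A> l *v U t x)) + \<phi> (t, x) *s (\<B> x *v U t x) \<partial>lborel)) = 0)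
    = ((LINT t:{0<..}|lborel. weak_form \<A> (pw (\<lambda>x. (*v) (\<B> x))) \<phi> (\<lambda>t. lsq (U t)) t) = 0)" by simp
qed

text \<open>The bridge from the Lebesgue integral over positive times to the integral on a compact
  interval, for which the fundamental theorem of calculus is available.\<close>

lemma set_integral_compact_support:
  fixes f :: "real \<Rightarrow> 'b::euclidean_space"
  assumes "0 < a" "continuous_on {a..b} f" "\<And>t. 0 < t \<Longrightarrow> t \<notin> {a..b} \<Longrightarrow> f t = 0"
  shows "(LINT t:{0<..}|lborel. f t) = integral {a..b} f"
proof -
  have "(LINT t:{0<..}|lborel. f t) = (LINT t:{a..b}|lborel. f t)"
    unfolding set_lebesgue_integral_def
    by (rule Bochner_Integration.integral_cong) (use assms(1,3) in \<open>auto simp: indicator_def\<close>)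
  then show ?thesis
    using set_borel_integral_eq_integral(2)[OF borel_integrable_atLeastAtMost'[OF assms(2)]] by simp
qed

lemma continuous_on_weak_form:
  assumes \<phi>: "testfun \<phi>" and V: "continuous_on S V" and B: "bounded_linear B"
  shows "continuous_on S (weak_form A B \<phi> V)"
proof -
  have c: "continuous_on S (\<lambda>t. pair (\<lambda>x. \<psi> (t, x)) (W t))" if "testfun \<psi>" "continuous_on S W" for \<psi> W
  proof -
    have "continuous_on S (\<lambda>t. pair (rep (lsq (\<lambda>x. \<psi> (t, x)))) (W t))"
      by (rule pair.continuous_on[OF continuous_on_slice[OF that(1)] that(2)])
    then show ?thesis by (simp add: pair_rep_lsq testfun_L2 testfun_slice that(1))
  qed
  have t: "testfun (\<lambda>z. dd (0, axis l 1) \<phi> z)" "testfun (\<lambda>z. dd (1, 0) \<phi> z)" for l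
    by (intro testfun_dd \<phi>; simp add: Basis_prod_def)+
  have "continuous_on S (\<lambda>s. A l *v pair (\<lambda>x. dd (0, axis l 1) \<phi> (s, x)) (V s))" for l
    by (intro bounded_linear.continuous_on[OF matrix_vector_mul_bounded_linear] c[OF t(1)] V)
  moreover have "continuous_on S (\<lambda>s. pair (\<lambda>x. \<phi> (s, x)) (B (V s)))"
    by (intro c[OF \<phi>] bounded_linear.continuous_on[OF B] V)
  ultimately show ?thesis
    unfolding weak_form_def[abs_def] dt_dd dd_slice[OF \<phi>]
    by (intro continuous_on_add continuous_on_diff continuous_on_minus continuous_on_sum c[OF t(2)] V)
qed

lemma weak_form_outside:
  assumes \<phi>: "testfun \<phi>" and out: "\<And>t x. t \<notin> {a<..<b} \<Longrightarrow> \<phi> (t, x) = 0" and t: "t \<notin> {a..b}"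
  shows "weak_form A B \<phi> V t = 0"
proof -
  have 0: "(\<lambda>x. \<phi> (t, x)) = (\<lambda>x. 0)" using out t by auto
  have "dt \<phi> (t, x) = 0" for x
  proof -
    have "(\<phi> has_derivative (\<lambda>_. 0)) (at (t, x))"
    proof (rule has_derivative_transform_within_open)
      show "((\<lambda>_. 0) has_derivative (\<lambda>_. 0)) (at (t, x))" by simp
      show "open ((- {a..b}) \<times> UNIV)" by (intro open_Times open_Compl) auto
      show "0 = \<phi> z" if "z \<in> (- {a..b}) \<times> UNIV" for z using out[of "fst z" "snd z"] that by auto
    qed (use t in auto)
    from frechet_derivative_at[OF this, symmetric] show ?thesis by (simp add: dt_def)
  qed
  moreover have "dd (axis l 1) (\<lambda>x. \<phi> (t, x)) = (\<lambda>x. 0)" for l by (simp add: 0)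
  ultimately show ?thesis by (simp add: weak_form_def 0 pair_def)
qed

section \<open>Weak and mild solutions coincide\<close>

lemma sysop_iff:
  fixes V :: "real \<Rightarrow> (real ^ 'd::finite, complex ^ 'm::finite) lsq"
  assumes "bounded_linear B" and V: "continuous_on {0..t} V"
  shows "(integral {0..t} V, u - v - integral {0..t} (\<lambda>s. B (V s))) \<in> sysop A \<longleftrightarrow>
    (\<forall>\<psi>. testfun \<psi> \<longrightarrow> pair \<psi> v + (- (\<Sum>l\<in>UNIV. A l *v pair (dd (axis l 1) \<psi>) (integral {0..t} V))
      + pair \<psi> (B (integral {0..t} V))) = pair \<psi> u)"
proof -
  \<comment> \<open>The bounded operator passes through the integral; so the tested equation
    contains \<open>pair \<psi> v\<close> and one bounded linear expression in
    \<open>integral {0..t} V\<close>.\<close>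
  have B: "integral {0..t} (\<lambda>s. B (V s)) = B (integral {0..t} V)"
    using integral_linear[OF integrable_continuous_interval[OF V] assms(1)] by (simp add: o_def)
  have "- X = pair \<psi> (u - v - w) \<longleftrightarrow> pair \<psi> v + (- X + pair \<psi> w) = pair \<psi> u"
    if "testfun \<psi>" for X \<psi> w
  proof -
    interpret bounded_linear "pair \<psi> :: (real ^ 'd, complex ^ 'm) lsq \<Rightarrow> _" by (rule bounded_linear_pair_testfun[OF that])
    show ?thesis by (auto simp: diff add algebra_simps)
  qed
  then show ?thesis by (simp add: sysop_def B)
qed

lemma bounded_linear_weak:
  fixes A :: "'d::finite \<Rightarrow> complex ^ 'm::finite ^ 'm" and \<psi> :: "real ^ 'd \<Rightarrow> complex"
  assumes "testfun \<psi>" "bounded_linear B"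
  shows "bounded_linear (\<lambda>v. - (\<Sum>l\<in>UNIV. A l *v pair (dd (axis l 1) \<psi>) v) + pair \<psi> (B v))"
proof -
  have "bounded_linear (\<lambda>v. A l *v pair (dd (axis l 1) \<psi>) v)" for l
    by (rule bounded_linear_compose[OF matrix_vector_mul_bounded_linear bounded_linear_pair_dd[OF assms(1)]])
  moreover have "bounded_linear (\<lambda>v. pair \<psi> (B v))"
    by (rule bounded_linear_compose[OF bounded_linear_pair_testfun[OF assms(1)] assms(2)])
  ultimately show ?thesis
    by (intro bounded_linear_add bounded_linear_minus bounded_linear_sum)
qed

lemma test_function_product:
  fixes \<eta> :: "real \<Rightarrow> real" and \<psi> :: "real ^ 'd::finite \<Rightarrow> complex"
  assumes \<eta>: "\<And>k. Ck k \<eta>" "\<And>t. t \<notin> {a<..<b} \<Longrightarrow> \<eta> t = 0" and a: "0 < a" and \<psi>: "testfun \<psi>"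
  shows "test_function (\<lambda>z. complex_of_real (\<eta> (fst z)) * \<psi> (snd z))"
proof -
  let ?\<phi> = "\<lambda>z. complex_of_real (\<eta> (fst z)) * \<psi> (snd z)"
  obtain K where K: "compact K" "\<And>x. x \<notin> K \<Longrightarrow> \<psi> x = 0" using testfun_support[OF \<psi>] by metis
  have K': "compact ({a..b} \<times> K)" using K(1) by (intro compact_Times) auto
  have out: "?\<phi> z = 0" if "z \<notin> {a..b} \<times> K" for z
  proof (cases "snd z \<in> K")
    case True
    then have "fst z \<notin> {a<..<b}" using that by (cases z) auto
    then show ?thesis using \<eta>(2) by simp
  qed (use K(2) in simp)
  have "testfun ?\<phi>"
  proof (rule testfunI[OF _ K' out])
    fix k
    have "Ck k (\<lambda>z::real \<times> (real ^ 'd). complex_of_real (\<eta> (fst z + 0)))"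
      by (intro Ck_bounded_linear[OF bounded_linear_of_real] Ck_compose_affine[OF bounded_linear_fst] \<eta>)
    moreover have "Ck k (\<lambda>z::real \<times> (real ^ 'd). \<psi> (snd z + 0))"
      by (intro Ck_compose_affine[OF bounded_linear_snd] testfun_Ck \<psi>)
    ultimately show "Ck k ?\<phi>" using Ck_mult by fastforce
  qed
  moreover have "closure {z. ?\<phi> z \<noteq> 0} \<subseteq> {a..b} \<times> K"
    by (rule closure_minimal) (use out K' compact_imp_closed in blast)+
  then have "closure {z. ?\<phi> z \<noteq> 0} \<subseteq> {0<..} \<times> UNIV" using a by fastforce
  ultimately show ?thesis by (simp add: test_function_def testfun_def)
qed

text \<open>For a product of a function of time and a function of space, the time derivative
  separates from a fixed spatial expression in \<open>V t\<close>.\<close>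

lemma weak_form_product:
  fixes \<eta> :: "real \<Rightarrow> real" and \<psi> :: "real ^ 'd::finite \<Rightarrow> complex"
  assumes \<eta>: "\<And>k. Ck k \<eta>" and \<psi>: "testfun \<psi>"
  shows "weak_form A B (\<lambda>z. complex_of_real (\<eta> (fst z)) * \<psi> (snd z)) V t
    = - (frechet_derivative \<eta> (at t) 1 *\<^sub>R pair \<psi> (V t))
      + \<eta> t *\<^sub>R (- (\<Sum>l\<in>UNIV. A l *v pair (dd (axis l 1) \<psi>) (V t)) + pair \<psi> (B (V t)))"
proof -
  let ?\<phi> = "\<lambda>z. complex_of_real (\<eta> (fst z)) * \<psi> (snd z)"
  have s: "(\<lambda>x. ?\<phi> (t, x)) = (\<lambda>x. \<eta> t *\<^sub>R \<psi> x)" by (simp add: scaleR_conv_of_real)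
  have "dd b (\<lambda>x. \<eta> t *\<^sub>R \<psi> x) x = \<eta> t *\<^sub>R dd b \<psi> x" for b x
  proof -
    have "((\<lambda>x. \<eta> t *\<^sub>R \<psi> x) has_derivative (\<lambda>b. \<eta> t *\<^sub>R dd b \<psi> x)) (at x)"
      by (intro has_derivative_scaleR_right testfun_has_derivative \<psi>)
    from frechet_derivative_at[OF this, symmetric] show ?thesis by simp
  qed
  then have dx: "dd b (\<lambda>x. \<eta> t *\<^sub>R \<psi> x) = (\<lambda>x. \<eta> t *\<^sub>R dd b \<psi> x)" for b by (rule ext)
  have dt: "(\<lambda>x. dt ?\<phi> (t, x)) = (\<lambda>x. frechet_derivative \<eta> (at t) 1 *\<^sub>R \<psi> x)"
  proof
    fix x :: "real ^ 'd"
    have d\<eta>: "(\<eta> has_derivative (\<lambda>h. h * frechet_derivative \<eta> (at t) 1)) (at (fst (t, x)))"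
      using real_frechet_has_derivative[OF \<eta>[of "Suc 0"], of t] by (simp add: has_vector_derivative_def)
    have "((\<lambda>z. \<eta> (fst z)) has_derivative (\<lambda>h. fst h * frechet_derivative \<eta> (at t) 1)) (at (t, x))"
      by (rule has_derivative_compose[OF bounded_linear_imp_has_derivative[OF bounded_linear_fst] d\<eta>])
    moreover have "((\<lambda>z. \<psi> (snd z)) has_derivative (\<lambda>h. dd (snd h) \<psi> x)) (at (t, x))"
      by (rule has_derivative_compose[OF bounded_linear_imp_has_derivative[OF bounded_linear_snd]])
        (use testfun_has_derivative[OF \<psi>] in simp)
    ultimately have "((\<lambda>z. \<eta> (fst z) *\<^sub>R \<psi> (snd z)) has_derivative
        (\<lambda>h. \<eta> (fst (t, x)) *\<^sub>R dd (snd h) \<psi> x + (fst h * frechet_derivative \<eta> (at t) 1) *\<^sub>R \<psi> (snd (t, x)))) (at (t, x))"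
      by (rule has_derivative_scaleR)
    from frechet_derivative_at[OF this, symmetric]
    have "dd (1, 0) (\<lambda>z. \<eta> (fst z) *\<^sub>R \<psi> (snd z)) (t, x) = \<eta> t *\<^sub>R dd 0 \<psi> x + frechet_derivative \<eta> (at t) 1 *\<^sub>R \<psi> x"
      by simp
    moreover have "dd 0 \<psi> x = 0" using linear_0[OF has_derivative_linear[OF testfun_has_derivative[OF \<psi>]]] .
    ultimately show "dt ?\<phi> (t, x) = frechet_derivative \<eta> (at t) 1 *\<^sub>R \<psi> x"
      by (simp add: dt_def scaleR_conv_of_real)
  qed
  have "(\<Sum>l\<in>UNIV. A l *v (\<eta> t *\<^sub>R pair (dd (axis l 1) \<psi>) (V t))) = \<eta> t *\<^sub>R (\<Sum>l\<in>UNIV. A l *v pair (dd (axis l 1) \<psi>) (V t))"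
    by (simp add: scaleR_sum_right linear_scale[OF matrix_vector_mul_linear])
  then show ?thesis
    unfolding weak_form_def dt s dx pair_scaleR_left by (simp add: scaleR_add_right scaleR_diff_right)
qed

text \<open>Testing with products leaves, for each \<open>\<psi>\<close>, a distributional
  differential equation in time for the continuous function \<open>pair \<psi> (V t)\<close>. Its
  integrated form for all \<open>\<psi>\<close> is membership in the graph.\<close>

lemma weak_imp_mild:
  fixes V :: "real \<Rightarrow> (real ^ 'd::finite, complex ^ 'm::finite) lsq"
  assumes V: "continuous_on {0..} V" and B: "bounded_linear B"
    and weak: "\<And>\<phi>. test_function \<phi> \<Longrightarrow> (LINT t:{0<..}|lborel. weak_form A B \<phi> V t) = 0"
  shows "mild (sysop A) B (V 0) V"
  unfolding mild_def
proof (intro conjI allI impI V refl)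
  fix t :: real assume t: "0 \<le> t"
  have Vc: "continuous_on {a..b} V" if "0 \<le> a" for a b
    by (rule continuous_on_subset[OF V]) (use that in auto)
  show "(integral {0..t} V, V 0 - V t - integral {0..t} (\<lambda>s. B (V s))) \<in> sysop A"
    unfolding sysop_iff[OF B Vc[OF order_refl]]
  proof (intro allI impI)
    fix \<psi> :: "real ^ 'd \<Rightarrow> complex" assume \<psi>: "testfun \<psi>"
    define L where "L v = - (\<Sum>l\<in>UNIV. A l *v pair (dd (axis l 1) \<psi>) v) + pair \<psi> (B v)" for v
    have L: "bounded_linear L" unfolding L_def[abs_def] by (rule bounded_linear_weak[OF \<psi> B])
    have Lc: "continuous_on {a..b} (\<lambda>s. L (V s))" if "0 \<le> a" for a b
      by (rule bounded_linear.continuous_on[OF L Vc[OF that]])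
    have yc: "continuous_on {0..} (\<lambda>s. pair \<psi> (V s))"
      by (rule bounded_linear.continuous_on[OF bounded_linear_pair_testfun[OF \<psi>] V])
    let ?K = "\<lambda>t. integral {0..t} (\<lambda>s. L (V s))"
    have Kc: "continuous_on {0..b} ?K" for b
      by (rule indefinite_integral_continuous_1) (intro integrable_continuous_interval Lc order_refl)
    have Kd: "(?K has_vector_derivative L (V t)) (at t within {a..b})" if "t \<in> {a..b}" "0 \<le> a" for t a b
    proof -
      have "(?K has_vector_derivative L (V t)) (at t within {0..b})"
        by (rule integral_has_vector_derivative) (use that in \<open>auto intro: Lc\<close>)
      then show ?thesis by (rule has_vector_derivative_within_subset) (use that in auto)
    qed
    \<comment> \<open>The integrated equation says that this function is constant with value
      \<open>pair \<psi> (V 0)\<close>.\<close>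
    have "(\<lambda>t. pair \<psi> (V t) + ?K t) t = (\<lambda>t. pair \<psi> (V t) + ?K t) 0"
    proof (rule du_bois_reymond[OF _ _ t])
      have "continuous_on {0..} ?K"
        by (intro continuous_on_nonnegI Kc)
      then show "continuous_on {0..} (\<lambda>t. pair \<psi> (V t) + ?K t)" by (intro continuous_on_add yc)
      fix \<eta> :: "real \<Rightarrow> real" and a b
      assume ab: "0 < a" "a < b" and \<eta>: "\<And>k. Ck k \<eta>" and out: "\<And>t. t \<notin> {a<..<b} \<Longrightarrow> \<eta> t = 0"
      let ?\<phi> = "\<lambda>z. complex_of_real (\<eta> (fst z)) * \<psi> (snd z)"
      let ?\<eta>' = "\<lambda>t. frechet_derivative \<eta> (at t) 1"
      have \<phi>: "test_function ?\<phi>" by (rule test_function_product[OF \<eta> out ab(1) \<psi>])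
      have wc: "continuous_on {a..b} (weak_form A B ?\<phi> V)"
        using ab by (intro continuous_on_weak_form test_function_testfun \<phi> Vc B) auto
      have "0 = integral {a..b} (weak_form A B ?\<phi> V)"
        unfolding weak[OF \<phi>, symmetric]
      proof (rule set_integral_compact_support[OF ab(1) wc])
        show "weak_form A B ?\<phi> V t = 0" if "t \<notin> {a..b}" for t
          by (rule weak_form_outside[OF test_function_testfun[OF \<phi>] _ that]) (simp add: out)
      qed
      then have 0: "integral {a..b} (\<lambda>t. - (?\<eta>' t *\<^sub>R pair \<psi> (V t)) + \<eta> t *\<^sub>R L (V t)) = 0"
        unfolding weak_form_product[OF \<eta> \<psi>, abs_def] L_def by simp
      have \<eta>c: "continuous_on {a..b} \<eta>" "continuous_on {a..b} ?\<eta>'"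
        using Ck_continuous[OF \<eta>[of 0]] Ck_continuous[OF Ck_Suc_dest[OF \<eta>[of "Suc 0"], of 1]]
        by (auto intro: continuous_on_subset)
      \<comment> \<open>Integration by parts moves the derivative from \<open>?K\<close> to
        \<open>\<eta>\<close>; the boundary terms vanish because \<open>\<eta>\<close> is 0 at
        \<open>a\<close> and \<open>b\<close>.\<close>
      have F: "((\<lambda>t. \<eta> t *\<^sub>R L (V t) + ?\<eta>' t *\<^sub>R ?K t) has_integral (\<eta> b *\<^sub>R ?K b - \<eta> a *\<^sub>R ?K a)) {a..b}"
      proof (rule fundamental_theorem_of_calculus)
        fix t assume t: "t \<in> {a..b}"
        have "(\<eta> has_field_derivative ?\<eta>' t) (at t within {a..b})"
          using real_frechet_has_derivative[OF \<eta>[of "Suc 0"]]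
          by (simp add: has_real_derivative_iff_has_vector_derivative has_vector_derivative_at_within)
        from has_vector_derivative_scaleR[OF this Kd[OF t less_imp_le[OF ab(1)]]]
        show "((\<lambda>t. \<eta> t *\<^sub>R ?K t) has_vector_derivative \<eta> t *\<^sub>R L (V t) + ?\<eta>' t *\<^sub>R ?K t) (at t within {a..b})" .
      qed (use ab in simp)
      have yc': "continuous_on {a..b} (\<lambda>t. pair \<psi> (V t))" and Kc': "continuous_on {a..b} ?K" and Lc': "continuous_on {a..b} (\<lambda>t. L (V t))"
        using ab by (auto intro: continuous_on_subset[OF yc] continuous_on_subset[OF Kc[of b]] Lc)
      have "(\<lambda>t. ?\<eta>' t *\<^sub>R (pair \<psi> (V t) + ?K t))
        = (\<lambda>t. (\<eta> t *\<^sub>R L (V t) + ?\<eta>' t *\<^sub>R ?K t) - (- (?\<eta>' t *\<^sub>R pair \<psi> (V t)) + \<eta> t *\<^sub>R L (V t)))"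
        by (simp add: fun_eq_iff scaleR_add_right)
      then have "integral {a..b} (\<lambda>t. ?\<eta>' t *\<^sub>R (pair \<psi> (V t) + ?K t))
        = integral {a..b} (\<lambda>t. \<eta> t *\<^sub>R L (V t) + ?\<eta>' t *\<^sub>R ?K t)
          - integral {a..b} (\<lambda>t. - (?\<eta>' t *\<^sub>R pair \<psi> (V t)) + \<eta> t *\<^sub>R L (V t))"
        by (simp only:) (rule Henstock_Kurzweil_Integration.integral_diff;
            intro integrable_continuous_interval continuous_on_add continuous_on_minus continuous_on_scaleR \<eta>c yc' Kc' Lc')
      also have "\<dots> = 0" unfolding 0 integral_unique[OF F] by (simp add: out)
      finally show "integral {a..b} (\<lambda>t. ?\<eta>' t *\<^sub>R (pair \<psi> (V t) + ?K t)) = 0" .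
    qed
    moreover have "?K t = L (integral {0..t} V)"
      using integral_linear[OF integrable_continuous_interval[OF Vc[OF order_refl]] L] by (simp add: o_def)
    ultimately show "pair \<psi> (V t) + (- (\<Sum>l\<in>UNIV. A l *v pair (dd (axis l 1) \<psi>) (integral {0..t} V))
      + pair \<psi> (B (integral {0..t} V))) = pair \<psi> (V 0)"
      by (simp add: L_def)
  qed
qed

text \<open>\<open>V\<close> need not be differentiable in L^2, but by the integrated equation its
  pairing with a fixed test function is. Hence the pairing \<open>z\<close> with the moving slice of
  \<open>\<phi>\<close> has derivative minus the weak form, and \<open>z\<close> vanishes at both
  ends of the time interval.\<close>

lemma mild_imp_weak:
  assumes mild: "mild (sysop A) B u V" and B: "bounded_linear B" and \<phi>: "test_function \<phi>"
  shows "(LINT t:{0<..}|lborel. weak_form A B \<phi> V t) = 0"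
proof -
  note \<phi>' = test_function_testfun[OF \<phi>]
  obtain a b where ab: "0 < a" "a < b" and out: "\<And>t x. t \<notin> {a<..<b} \<Longrightarrow> \<phi> (t, x) = 0"
    using test_function_support[OF \<phi>] by metis
  have V: "continuous_on {0..} V" using mild by (simp add: mild_def)
  have Vc: "continuous_on {c..d} V" if "0 \<le> c" for c d
    by (rule continuous_on_subset[OF V]) (use that in auto)
  define P where "P t = lsq (\<lambda>x. \<phi> (t, x))" for t
  define z where "z t = pair (rep (P t)) (V t)" for t
  have LP: "L2 (\<lambda>x. \<phi> (t, x))" for t by (intro testfun_L2 testfun_slice \<phi>')
  have "((\<lambda>t. - weak_form A B \<phi> V t) has_integral (z b - z a)) {a..b}"
  proof (rule fundamental_theorem_of_calculus)
    fix t assume t: "t \<in> {a..b}"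
    let ?F = "at t within {a..b}"
    let ?\<psi> = "\<lambda>x. \<phi> (t, x)"
    have \<psi>: "testfun ?\<psi>" by (rule testfun_slice[OF \<phi>'])
    define L where "L v = - (\<Sum>l\<in>UNIV. A l *v pair (dd (axis l 1) ?\<psi>) v) + pair ?\<psi> (B v)" for v
    have L: "bounded_linear L" unfolding L_def[abs_def] by (rule bounded_linear_weak[OF \<psi> B])
    have y: "pair ?\<psi> (V s) = pair ?\<psi> u - L (integral {0..s} V)" if "0 \<le> s" for s
    proof -
      have "(integral {0..s} V, u - V s - integral {0..s} (\<lambda>r. B (V r))) \<in> sysop A"
        using mild that by (simp add: mild_def)
      then have "pair ?\<psi> (V s) + L (integral {0..s} V) = pair ?\<psi> u"
        unfolding sysop_iff[OF B Vc[OF order_refl]] L_def using \<psi> by blast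
      then show ?thesis by (simp add: eq_diff_eq)
    qed
    have "((\<lambda>s. integral {0..s} V) has_vector_derivative V t) (at t within {0..b})"
      by (rule integral_has_vector_derivative) (use t ab in \<open>auto intro: Vc\<close>)
    then have "((\<lambda>s. integral {0..s} V) has_vector_derivative V t) ?F"
      by (rule has_vector_derivative_within_subset) (use ab in auto)
    from has_vector_derivative_diff[OF has_vector_derivative_const bounded_linear.has_vector_derivative[OF L this]]
    have "((\<lambda>s. pair ?\<psi> u - L (integral {0..s} V)) has_vector_derivative 0 - L (V t)) ?F" .
    then have "((\<lambda>s. pair ?\<psi> (V s)) has_vector_derivative 0 - L (V t)) ?F"
      by (rule has_vector_derivative_transform[rotated 2]) (use t ab y in auto)
    then have 2: "((\<lambda>s. (pair (rep (P t)) (V s) - pair (rep (P t)) (V t)) /\<^sub>R (s - t)) \<longlongrightarrow> - L (V t)) ?F"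
      unfolding has_vector_derivative_iff_quotient by (simp add: P_def pair_rep_lsq LP)
    have "(P has_vector_derivative lsq (\<lambda>x. dd (1, 0) \<phi> (t, x))) ?F"
      unfolding P_def[abs_def] by (rule has_vector_derivative_at_within[OF slice_has_vector_derivative[OF \<phi>']])
    then have P': "((\<lambda>s. (P s - P t) /\<^sub>R (s - t)) \<longlongrightarrow> lsq (\<lambda>x. dt \<phi> (t, x))) ?F"
      unfolding has_vector_derivative_iff_quotient dt_dd .
    have Vt: "(V \<longlongrightarrow> V t) ?F" using Vc[of a b] ab t by (simp add: continuous_on_def)
    have 1: "((\<lambda>s. pair (rep ((P s - P t) /\<^sub>R (s - t))) (V s)) \<longlongrightarrow> pair (\<lambda>x. dt \<phi> (t, x)) (V t)) ?F"
      using pair.tendsto[OF P' Vt] by (simp add: pair_rep_lsq testfun_L2 testfun_dt \<phi>')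
    \<comment> \<open>Product rule for quotients: the increment of the test function is paired with
      \<open>V s\<close>, for which continuity is enough, and the increment of \<open>V\<close> only
      with the slice frozen at time \<open>t\<close>.\<close>
    have "(z s - z t) /\<^sub>R (s - t) = pair (rep ((P s - P t) /\<^sub>R (s - t))) (V s)
        + (pair (rep (P t)) (V s) - pair (rep (P t)) (V t)) /\<^sub>R (s - t)" for s
      by (simp add: z_def pair.scaleR_left pair.diff_left scaleR_add_right[symmetric])
    then have "((\<lambda>s. (z s - z t) /\<^sub>R (s - t)) \<longlongrightarrow> pair (\<lambda>x. dt \<phi> (t, x)) (V t) + - L (V t)) ?F"
      using tendsto_add[OF 1 2] by simp
    moreover have "pair (\<lambda>x. dt \<phi> (t, x)) (V t) + - L (V t) = - weak_form A B \<phi> V t"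
      by (simp add: weak_form_def L_def)
    ultimately show "(z has_vector_derivative - weak_form A B \<phi> V t) ?F"
      unfolding has_vector_derivative_iff_quotient by simp
  qed (use ab in simp)
  moreover have "z a = 0" "z b = 0"
    by (simp_all add: z_def P_def pair_rep_lsq[OF LP]) (simp_all add: out pair_def)
  ultimately have "integral {a..b} (\<lambda>t. - weak_form A B \<phi> V t) = 0" by (simp only: integral_unique) simp
  then have "integral {a..b} (weak_form A B \<phi> V) = 0" by simp
  moreover have "(LINT t:{0<..}|lborel. weak_form A B \<phi> V t) = integral {a..b} (weak_form A B \<phi> V)"
    by (rule set_integral_compact_support[OF ab(1)])
      (use ab in \<open>auto intro!: continuous_on_weak_form \<phi>' Vc B weak_form_outside[OF \<phi>' out]\<close>)
  ultimately show ?thesis by simp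
qed

section \<open>Transfer between functions and classes\<close>

lemma C0_L2_iff: "C0_L2 U \<longleftrightarrow> (\<forall>t\<ge>0. L2 (U t)) \<and> continuous_on {0..} (\<lambda>t. lsq (U t))"
proof -
  have "((\<lambda>s. L2_norm (\<lambda>x. U s x - U t x)) \<longlongrightarrow> 0) (at t within {0..}) \<longleftrightarrow> ((\<lambda>s. lsq (U s)) \<longlongrightarrow> lsq (U t)) (at t within {0..})"
    if L: "\<forall>t\<ge>0. L2 (U t)" and t: "0 \<le> t" for t
  proof -
    have "\<forall>\<^sub>F s in at t within {0..}. L2_norm (\<lambda>x. U s x - U t x) = norm (lsq (U s) - lsq (U t))"
      unfolding eventually_at_filter
      by (intro always_eventually allI impI) (use L t in \<open>simp add: lsq_diff norm_lsq L2_diff\<close>)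
    then have "((\<lambda>s. L2_norm (\<lambda>x. U s x - U t x)) \<longlongrightarrow> 0) (at t within {0..})
      \<longleftrightarrow> ((\<lambda>s. norm (lsq (U s) - lsq (U t))) \<longlongrightarrow> 0) (at t within {0..})"
      by (rule tendsto_cong)
    then show ?thesis by (simp add: tendsto_norm_zero_iff LIM_zero_iff)
  qed
  then show ?thesis unfolding C0_L2_def continuous_on_def by auto
qed

text \<open>Square integrability of each \<open>U t\<close> stays as a separate condition, because
  \<open>lsq\<close> of a function outside L^2 carries no information.\<close>

lemma cauchy_solution_iff:
  assumes M: "pw_bounded (\<lambda>x. (*v) (\<B> x)) C" and u0: "L2 u0"
  shows "cauchy_solution \<A> \<B> u0 U \<longleftrightarrow>
    (\<forall>t\<ge>0. L2 (U t)) \<and> mild (sysop \<A>) (pw (\<lambda>x. (*v) (\<B> x))) (lsq u0) (\<lambda>t. lsq (U t))"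
proof -
  let ?B = "pw (\<lambda>x. (*v) (\<B> x))"
  have B: "bounded_linear ?B" by (rule bounded_linear_pw[OF M])
  show ?thesis
  proof
    assume c: "cauchy_solution \<A> \<B> u0 U"
    then have L: "\<forall>t\<ge>0. L2 (U t)" and V: "continuous_on {0..} (\<lambda>t. lsq (U t))"
      by (auto simp: cauchy_solution_def C0_L2_iff)
    have "mild (sysop \<A>) ?B (lsq (U 0)) (\<lambda>t. lsq (U t))"
      using c dist_solution_iff[of U \<B> C \<A>, OF _ M] L by (intro weak_imp_mild V B) (auto simp: cauchy_solution_def)
    moreover have "lsq (U 0) = lsq u0"
      using c L u0 by (intro lsq_cong) (auto simp: cauchy_solution_def)
    ultimately show "(\<forall>t\<ge>0. L2 (U t)) \<and> mild (sysop \<A>) ?B (lsq u0) (\<lambda>t. lsq (U t))"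
      using L by simp
  next
    assume m: "(\<forall>t\<ge>0. L2 (U t)) \<and> mild (sysop \<A>) ?B (lsq u0) (\<lambda>t. lsq (U t))"
    then have L: "\<forall>t\<ge>0. L2 (U t)" and m: "mild (sysop \<A>) ?B (lsq u0) (\<lambda>t. lsq (U t))" by auto
    have "dist_solution \<A> \<B> U"
      using dist_solution_iff[of U \<B> C \<A>, OF _ M] L mild_imp_weak[OF m B] by auto
    moreover have "AE x in lborel. U 0 x = u0 x"
      using m L u0 by (simp add: mild_def lsq_eq_iff)
    moreover have "C0_L2 U" using m L by (simp add: C0_L2_iff mild_def)
    ultimately show "cauchy_solution \<A> \<B> u0 U" by (simp add: cauchy_solution_def)
  qed
qed

text \<open>Existence, almost everywhere uniqueness and the bound correspond under
  \<open>lsq\<close> and \<open>rep\<close>. The equivalence is used forwards for the given operator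
  and backwards for the split one.\<close>

theorem strongly_well_posed_iff:
  assumes M: "pw_bounded (\<lambda>x. (*v) (\<B> x)) C"
  shows "strongly_well_posed \<A> \<B> \<longleftrightarrow> mild_wp (sysop \<A>) (pw (\<lambda>x. (*v) (\<B> x)))"
proof
  let ?m = "mild (sysop \<A>) (pw (\<lambda>x. (*v) (\<B> x)))"
  note ci = cauchy_solution_iff[OF M, of _ \<A>]
  have ci': "cauchy_solution \<A> \<B> (rep u) (\<lambda>t. rep (V t)) \<longleftrightarrow> ?m u V" for u V
    by (simp add: ci)
  {
    assume "strongly_well_posed \<A> \<B>"
    then obtain K \<alpha> where K: "0 < K" and ex: "\<And>u0. L2 u0 \<Longrightarrow> \<exists>U. cauchy_solution \<A> \<B> u0 U \<and>
        (\<forall>V. cauchy_solution \<A> \<B> u0 V \<longrightarrow> (\<forall>t\<ge>0. AE x in lborel. V t x = U t x)) \<and>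
        (\<forall>t\<ge>0. L2_norm (U t) \<le> K * exp (\<alpha> * t) * L2_norm (U 0))"
      unfolding strongly_well_posed_def by blast
    have "\<exists>U. ?m u U \<and> (\<forall>V. ?m u V \<longrightarrow> (\<forall>t\<ge>0. V t = U t)) \<and> (\<forall>t\<ge>0. norm (U t) \<le> K * exp (\<alpha> * t) * norm u)" for u
    proof -
      obtain U where U: "cauchy_solution \<A> \<B> (rep u) U"
        and uniq: "\<And>V t. cauchy_solution \<A> \<B> (rep u) V \<Longrightarrow> 0 \<le> t \<Longrightarrow> AE x in lborel. V t x = U t x"
        and bd: "\<And>t. 0 \<le> t \<Longrightarrow> L2_norm (U t) \<le> K * exp (\<alpha> * t) * L2_norm (U 0)"
        using ex[OF L2_rep, of u] by blast
      have L: "\<And>t. 0 \<le> t \<Longrightarrow> L2 (U t)" and m: "?m u (\<lambda>t. lsq (U t))" using U by (simp_all add: ci)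
      show ?thesis
      proof (intro exI conjI allI impI)
        show "?m u (\<lambda>t. lsq (U t))" by (rule m)
        show "V t = lsq (U t)" if "?m u V" "0 \<le> t" for V t
          using lsq_cong[OF L2_rep L[OF that(2)] uniq[of "\<lambda>t. rep (V t)" t]] that by (simp add: ci')
        show "norm (lsq (U t)) \<le> K * exp (\<alpha> * t) * norm u" if "0 \<le> t" for t
        proof -
          have "u = lsq (U 0)" using m by (simp add: mild_def)
          then show ?thesis using bd[OF that] by (simp add: norm_lsq L that)
        qed
      qed
    qed
    then show "mild_wp (sysop \<A>) (pw (\<lambda>x. (*v) (\<B> x)))" unfolding mild_wp_def using K by blast
  }
  assume "mild_wp (sysop \<A>) (pw (\<lambda>x. (*v) (\<B> x)))"
  then obtain K \<alpha> where K: "0 < K" and ex: "\<And>u. \<exists>U. ?m u U \<and> (\<forall>V. ?m u V \<longrightarrow> (\<forall>t\<ge>0. V t = U t)) \<and>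
      (\<forall>t\<ge>0. norm (U t) \<le> K * exp (\<alpha> * t) * norm u)"
    unfolding mild_wp_def by blast
  have "\<exists>U. cauchy_solution \<A> \<B> u0 U \<and>
        (\<forall>V. cauchy_solution \<A> \<B> u0 V \<longrightarrow> (\<forall>t\<ge>0. AE x in lborel. V t x = U t x)) \<and>
        (\<forall>t\<ge>0. L2_norm (U t) \<le> K * exp (\<alpha> * t) * L2_norm (U 0))" if u0: "L2 u0" for u0
  proof -
    obtain U where U: "?m (lsq u0) U" and uniq: "\<And>V t. ?m (lsq u0) V \<Longrightarrow> 0 \<le> t \<Longrightarrow> V t = U t"
      and bd: "\<And>t. 0 \<le> t \<Longrightarrow> norm (U t) \<le> K * exp (\<alpha> * t) * norm (lsq u0)"
      using ex[of "lsq u0"] by blast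
    show ?thesis
    proof (intro exI conjI allI impI)
      show "cauchy_solution \<A> \<B> u0 (\<lambda>t. rep (U t))" using U by (simp add: ci[OF u0])
      show "AE x in lborel. V t x = rep (U t) x" if V: "cauchy_solution \<A> \<B> u0 V" and t: "0 \<le> t" for V t
      proof -
        have L: "L2 (V t)" and "lsq (V t) = U t" using V uniq[of "\<lambda>t. lsq (V t)", OF _ t] t by (simp_all add: ci[OF u0])
        then have "lsq (V t) = lsq (rep (U t))" by simp
        then show ?thesis using L by (simp only: lsq_eq_iff L2_rep)
      qed
      show "L2_norm (rep (U t)) \<le> K * exp (\<alpha> * t) * L2_norm (rep (U 0))" if "0 \<le> t" for t
      proof -
        have "U 0 = lsq u0" using U by (simp add: mild_def)
        then show ?thesis using bd[OF that] by (simp only: norm_lsq_eq)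
      qed
    qed
  qed
  then show "strongly_well_posed \<A> \<B>" unfolding strongly_well_posed_def using K by blast
qed

section \<open>The split system\<close>

definition total :: "complex ^ ('d::finite \<times> 'n::finite) \<Rightarrow> complex ^ 'n" where
  "total v = (\<Sum>j\<in>UNIV. block v j)"

definition inject :: "'d::finite \<Rightarrow> complex ^ 'n::finite \<Rightarrow> complex ^ ('d \<times> 'n)" where
  "inject l w = (\<chi> p. if fst p = l then w $ snd p else 0)"

lemma total_linear: "linear total" "total (c *s v) = c *s total v"
  by (auto intro!: linearI simp: total_def block_def vec_eq_iff sum.distrib scaleR_sum_right sum_distrib_left)

lemma inject_linear: "linear (inject l)" "inject l (c *s w) = c *s inject l w"
  by (auto intro!: linearI simp: inject_def vec_eq_iff)

lemma total_inject: "total (inject l w) = w"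
  by (simp add: total_def block_def inject_def vec_eq_iff)

lemma block_nth: "block v k $ a = v $ (k, a)"
  by (simp add: block_def)

text \<open>The split coefficients factor through the sum of the blocks, so the principal part acts
  on that sum alone.\<close>

lemma split_coeff_total: "split_coeff A l *v v = inject l (A l *v total v)"
  by (simp add: vec_eq_iff split_paired_All block_nth[symmetric] block_split_coeff total_def)
    (simp add: block_nth inject_def)

text \<open>The candidate is written down from the solution for the sum. The point to check is
  \<open>TU\<close>, that its blocks really add up to this solution: only then is \<open>W\<close>
  the time integral of the sum that the split equation demands.\<close>

lemma mild_wp_split:
  fixes A :: "'d::finite \<Rightarrow> complex ^ 'n::finite ^ 'n"
  assumes wp: "mild_wp (sysop A) (\<lambda>_. 0)" and ell: "elliptic A"
  shows "mild_wp (sysop (split_coeff A)) (\<lambda>_. 0)"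
proof -
  define T where "T = (pw (\<lambda>_. total) :: (real ^ 'd, complex ^ ('d \<times> 'n)) lsq \<Rightarrow> _)"
  define J where "J l = (pw (\<lambda>_ w. inject l (A l *v w)) :: (real ^ 'd, complex ^ 'n) lsq \<Rightarrow> _)" for l
  have Jlin: "linear (\<lambda>w. inject l (A l *v w))" for l
    using linear_compose[OF matrix_vector_mul_linear inject_linear(1)] by (simp add: o_def)
  have T: "bounded_linear T" unfolding T_def by (rule bounded_linear_pw[OF pw_bounded_const[OF total_linear(1)]])
  have J: "bounded_linear (J l)" for l unfolding J_def by (rule bounded_linear_pw[OF pw_bounded_const[OF Jlin]])
  have pT: "pair \<psi> (T v) = total (pair \<psi> v)" if "L2 \<psi>" for \<psi> v
    unfolding T_def by (rule pair_pw_const[OF total_linear that])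
  have pJ: "pair \<psi> (J l w) = inject l (A l *v pair \<psi> w)" if "L2 \<psi>" for \<psi> l w
    unfolding J_def by (rule pair_pw_const[OF Jlin _ that]) (simp add: matrix_vector_smult inject_linear)
  interpret T: bounded_linear T by (rule T)
  interpret J: bounded_linear "J l" for l by (rule J)
  have L2dd: "L2 (dd (axis l 1) \<psi>)" if "testfun \<psi>" for \<psi> :: "real ^ 'd \<Rightarrow> complex" and l
    by (intro testfun_L2 testfun_dd that) simp
  \<comment> \<open>Membership depends on \<open>Y\<close> only through \<open>T Y\<close>.\<close>
  have split: "(Y, F) \<in> sysop (split_coeff A) \<longleftrightarrow>
     (\<forall>\<psi>. testfun \<psi> \<longrightarrow> - (\<Sum>l\<in>UNIV. inject l (A l *v pair (dd (axis l 1) \<psi>) (T Y))) = pair \<psi> F)" for Y F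
    by (simp add: sysop_def split_coeff_total pT L2dd)
  have split_total: "(T Y, T F) \<in> sysop A" if "(Y, F) \<in> sysop (split_coeff A)" for Y F
    unfolding sysop_def
  proof (clarify)
    fix \<psi> :: "real ^ 'd \<Rightarrow> complex" assume \<psi>: "testfun \<psi>"
    have "pair \<psi> (T F) = total (- (\<Sum>l\<in>UNIV. inject l (A l *v pair (dd (axis l 1) \<psi>) (T Y))))"
      using that \<psi> by (simp add: split pT testfun_L2)
    also have "\<dots> = - (\<Sum>l\<in>UNIV. A l *v pair (dd (axis l 1) \<psi>) (T Y))"
      by (simp add: linear_neg[OF total_linear(1)] linear_sum[OF total_linear(1)] total_inject)
    finally show "- (\<Sum>l\<in>UNIV. A l *v pair (dd (axis l 1) \<psi>) (T Y)) = pair \<psi> (T F)" ..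
  qed
  \<comment> \<open>The second component is the sum of the \<open>J l (g l)\<close>. It suffices
    that the derivatives of \<open>T Y\<close> exist in L^2; nothing is asked of the single blocks
    of \<open>Y\<close>.\<close>
  have split_wd: "(Y, - (\<Sum>l\<in>UNIV. - J l (g l))) \<in> sysop (split_coeff A)" if "\<And>l. (T Y, g l) \<in> wd l" for Y g
    unfolding split
  proof (intro allI impI)
    fix \<psi> :: "real ^ 'd \<Rightarrow> complex" assume \<psi>: "testfun \<psi>"
    interpret \<psi>: bounded_linear "pair \<psi> :: (real ^ 'd, complex ^ ('d \<times> 'n)) lsq \<Rightarrow> _" by (rule bounded_linear_pair_testfun[OF \<psi>])
    have "pair \<psi> (g l) = - pair (dd (axis l 1) \<psi>) (T Y)" for l
      using that[of l] \<psi> by (simp add: wd_def)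
    then show "- (\<Sum>l\<in>UNIV. inject l (A l *v pair (dd (axis l 1) \<psi>) (T Y))) = pair \<psi> (- (\<Sum>l\<in>UNIV. - J l (g l)))"
      by (simp add: \<psi>.sum \<psi>.neg sum_negf pJ[OF testfun_L2[OF \<psi>]] linear_neg[OF Jlin] linear_neg[OF matrix_vector_mul_linear]
          linear_neg[OF inject_linear(1)])
  qed
  obtain K \<alpha> where K: "0 < K" and ex: "\<And>u. \<exists>U. mild (sysop A) (\<lambda>_. 0) u U \<and>
      (\<forall>V. mild (sysop A) (\<lambda>_. 0) u V \<longrightarrow> (\<forall>t\<ge>0. V t = U t)) \<and> (\<forall>t\<ge>0. norm (U t) \<le> K * exp (\<alpha> * t) * norm u)"
    using wp unfolding mild_wp_def by blast
  obtain S where S: "\<And>u. mild (sysop A) (\<lambda>_. 0) u (S u)"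
      and S_unique: "\<And>u V t. mild (sysop A) (\<lambda>_. 0) u V \<Longrightarrow> 0 \<le> t \<Longrightarrow> V t = S u t"
      and S_bound: "\<And>u t. 0 \<le> t \<Longrightarrow> norm (S u t) \<le> K * exp (\<alpha> * t) * norm u"
    using ex by metis
  obtain C where C: "0 \<le> C" "\<And>\<xi> v l. \<bar>\<xi> $ l\<bar> * norm v \<le> C * norm ((\<Sum>l\<in>UNIV. (\<xi> $ l) *\<^sub>R A l) *v v)"
    using elliptic_bound[OF ell] by blast
  define W where "W u t = integral {0..t} (S (T u))" for u t
  have WG: "(W u t, T u - S (T u) t) \<in> sysop A" if "0 \<le> t" for u t
    using S[of "T u"] that by (simp add: mild_def W_def)
  \<comment> \<open>The derivatives of \<open>W u t\<close> are chosen separately for each time.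
    Continuity in time is no part of the choice; it comes from the a priori estimate for
    differences.\<close>
  define g where "g u t l = (SOME h. (W u t, h) \<in> wd l)" for u t l
  have g: "(W u t, g u t l) \<in> wd l" if "0 \<le> t" for u t l
    unfolding g_def by (rule someI_ex[OF elliptic_regularity[OF ell WG[OF that]]])
  have g_diff: "norm (g u s l - g u t l) \<le> C * norm (S (T u) s - S (T u) t)" if "0 \<le> s" "0 \<le> t" for u s t l
  proof -
    have "norm (g u s l - g u t l) \<le> C * norm ((T u - S (T u) s) - (T u - S (T u) t))"
    proof (rule elliptic_apriori[OF C(1) C(2)])
      show "(W u s - W u t, (T u - S (T u) s) - (T u - S (T u) t)) \<in> sysop A"
        using subspace_diff[OF sysop_subspace WG[OF that(1), of u] WG[OF that(2), of u]] by simp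
      show "(W u s - W u t, g u s l - g u t l) \<in> wd l"
        using subspace_diff[OF wd_subspace g[OF that(1), of u l] g[OF that(2), of u l]] by simp
    qed
    then show ?thesis by (simp add: norm_minus_commute)
  qed
  have g_norm: "norm (g u t l) \<le> C * norm (T u - S (T u) t)" if "0 \<le> t" for u t l
    by (rule elliptic_apriori[OF C(1) C(2) WG[OF that] g[OF that]])
  have S_cont: "continuous_on {0..} (S v)" and S_0: "S v 0 = v" for v using S[of v] by (simp_all add: mild_def)
  have g_cont: "continuous_on {0..} (\<lambda>t. g u t l)" for u l
    unfolding continuous_on_def
  proof
    fix t :: real assume t: "t \<in> {0..}"
    show "((\<lambda>s. g u s l) \<longlongrightarrow> g u t l) (at t within {0..})"
    proof (rule LIM_zero_cancel, rule Lim_null_comparison)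
      show "\<forall>\<^sub>F s in at t within {0..}. norm (g u s l - g u t l) \<le> C * norm (S (T u) s - S (T u) t)"
        unfolding eventually_at_filter using t by (intro always_eventually allI impI g_diff) auto
      have "((\<lambda>s. C * norm (S (T u) s - S (T u) t)) \<longlongrightarrow> C * norm (S (T u) t - S (T u) t)) (at t within {0..})"
        using S_cont[of "T u"] t by (intro tendsto_intros) (simp add: continuous_on_def)
      then show "((\<lambda>s. C * norm (S (T u) s - S (T u) t)) \<longlongrightarrow> 0) (at t within {0..})" by simp
    qed
  qed
  \<comment> \<open>The integrated split equation solved for the value at time \<open>t\<close>;
    \<open>J l\<close> places \<open>A l\<close> applied to the l-th derivative of \<open>W\<close>
    in block \<open>l\<close>.\<close>
  define U where "U u t = u - (\<Sum>l\<in>UNIV. J l (g u t l))" for u t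
  have U_cont: "continuous_on {0..} (U u)" for u
    unfolding U_def[abs_def] by (intro continuous_intros bounded_linear.continuous_on[OF J] g_cont)
  have TJ: "T (J l w) = pw (\<lambda>_. (*v) (A l)) w" for l w
    unfolding T_def J_def
    by (subst pw_pw[OF pw_bounded_const[OF total_linear(1)] pw_bounded_const[OF Jlin]]) (simp add: total_inject)
  have TU: "T (U u t) = S (T u) t" if t: "0 \<le> t" for u t
  proof -
    \<comment> \<open>Summing the blocks of the correction reassembles the full operator applied to
      \<open>W\<close>. Since the graph is single-valued, the sum must equal
      \<open>T u - S (T u) t\<close>.\<close>
    have "(W u t, \<Sum>l\<in>UNIV. T (J l (g u t l))) \<in> sysop A"
      unfolding sysop_def
    proof (clarify)
      fix \<psi> :: "real ^ 'd \<Rightarrow> complex" assume \<psi>: "testfun \<psi>"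
      interpret \<psi>: bounded_linear "pair \<psi> :: (real ^ 'd, complex ^ 'n) lsq \<Rightarrow> _" by (rule bounded_linear_pair_testfun[OF \<psi>])
      have "pair \<psi> (g u t l) = - pair (dd (axis l 1) \<psi>) (W u t)" for l
        using g[OF t, of u l] \<psi> by (simp add: wd_def)
      then show "- (\<Sum>l\<in>UNIV. A l *v pair (dd (axis l 1) \<psi>) (W u t)) = pair \<psi> (\<Sum>l\<in>UNIV. T (J l (g u t l)))"
        by (simp add: \<psi>.sum TJ pair_pw_const[OF matrix_vector_mul_linear matrix_vector_smult testfun_L2[OF \<psi>]]
            linear_neg[OF matrix_vector_mul_linear] sum_negf)
    qed
    from sysop_unique[OF this WG[OF t]] show ?thesis
      by (simp add: U_def T.diff T.sum)
  qed
  have U_mild: "mild (sysop (split_coeff A)) (\<lambda>_. 0) u (U u)" for u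
    unfolding mild_def
  proof (intro conjI allI impI U_cont)
    have "g u 0 l = 0" for l using g_norm[of 0 u l] by (simp add: S_0)
    then show "U u 0 = u" by (simp add: U_def J.zero)
    fix t :: real assume t: "0 \<le> t"
    have "T (integral {0..t} (U u)) = integral {0..t} (\<lambda>s. T (U u s))"
      using integral_linear[OF integrable_continuous_nonneg[OF U_cont[of u] order_refl] T, of t] by (simp add: o_def)
    also have "\<dots> = W u t"
      unfolding W_def by (rule Henstock_Kurzweil_Integration.integral_cong) (simp add: TU)
    finally have "(integral {0..t} (U u), - (\<Sum>l\<in>UNIV. - J l (g u t l))) \<in> sysop (split_coeff A)"
      using g[OF t, of u] by (intro split_wd) simp
    then show "(integral {0..t} (U u), u - U u t - integral {0..t} (\<lambda>s. 0)) \<in> sysop (split_coeff A)"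
      by (simp add: U_def sum_negf)
  qed
  have U_unique: "V t = U u t" if V: "mild (sysop (split_coeff A)) (\<lambda>_. 0) u V" and t: "0 \<le> t" for u V t
  proof -
    define Z where "Z t = V t - U u t" for t
    have Z: "mild (sysop (split_coeff A)) (\<lambda>_. 0) 0 Z"
      using mild_lincomb[OF sysop_subspace bounded_linear_zero V U_mild[of u], of 1 "-1"] by (simp add: Z_def[abs_def])
    then have Zc: "continuous_on {0..} Z" by (simp add: mild_def)
    have TZ: "T (integral {0..t} Z) = integral {0..t} (\<lambda>s. T (Z s))" for t
      using integral_linear[OF integrable_continuous_nonneg[OF Zc order_refl] T, of t] by (simp add: o_def)
    have "mild (sysop A) (\<lambda>_. 0) 0 (\<lambda>t. T (Z t))"
      unfolding mild_def
    proof (intro conjI allI impI)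
      show "continuous_on {0..} (\<lambda>t. T (Z t))" by (rule T.continuous_on[OF Zc])
      show "T (Z 0) = 0" using Z by (simp add: mild_def T.zero)
      fix t :: real assume "0 \<le> t"
      then have "(integral {0..t} Z, - Z t) \<in> sysop (split_coeff A)" using Z by (simp add: mild_def)
      from split_total[OF this]
      show "(integral {0..t} (\<lambda>s. T (Z s)), 0 - T (Z t) - integral {0..t} (\<lambda>s. 0)) \<in> sysop A"
        by (simp add: TZ T.neg)
    qed
    moreover have "mild (sysop A) (\<lambda>_. 0) 0 (\<lambda>t. 0)"
      using subspace_0[OF sysop_subspace[of A]] by (simp add: mild_def zero_prod_def)
    ultimately have TZ0: "T (Z s) = 0" if "0 \<le> s" for s
      using S_unique[OF _ that, of 0] by metis
    have "T (integral {0..t} Z) = integral {0..t} (\<lambda>s. 0)"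
      unfolding TZ by (rule Henstock_Kurzweil_Integration.integral_cong) (simp add: TZ0)
    then have T0: "T (integral {0..t} Z) = 0" by simp
    have G: "(integral {0..t} Z, - Z t) \<in> sysop (split_coeff A)" using Z t by (simp add: mild_def)
    \<comment> \<open>Once the sum vanishes, so does the spatial term of the split equation, and
      each block keeps its initial value 0.\<close>
    have "- Z t = 0"
    proof (rule lsq_eq_0I)
      fix \<psi> :: "real ^ 'd \<Rightarrow> complex" assume \<psi>: "testfun \<psi>"
      have p0: "pair (dd (axis l 1) \<psi>) (0 :: (real ^ 'd, complex ^ 'n) lsq) = 0" for l
        by (rule bounded_linear.linear[OF bounded_linear_pair_dd[OF \<psi>], THEN linear_0])
      have "pair \<psi> (- Z t) = - (\<Sum>l\<in>UNIV. inject l (A l *v pair (dd (axis l 1) \<psi>) (T (integral {0..t} Z))))"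
        using G \<psi> unfolding split by simp
      then show "pair \<psi> (- Z t) = 0"
        by (simp add: T0 p0 linear_0[OF inject_linear(1)])
    qed
    then show ?thesis by (simp add: Z_def)
  qed
  define j where "j = (\<Sum>l\<in>UNIV. onorm (J l))"
  have j: "0 \<le> j" unfolding j_def by (intro sum_nonneg onorm_pos_le J)
  \<comment> \<open>The summand 1 accounts for \<open>u\<close>, the rest for the correction. With
    the absolute value of \<alpha> in the exponent the exponential is at least 1 and can absorb
    \<open>norm u\<close>.\<close>
  have U_bound: "norm (U u t) \<le> (1 + j * C * onorm T * (1 + K)) * exp (\<bar>\<alpha>\<bar> * t) * norm u" if t: "0 \<le> t" for u t
  proof -
    have e: "1 \<le> exp (\<bar>\<alpha>\<bar> * t)" using t by simp
    have "norm (S (T u) t) \<le> K * exp (\<alpha> * t) * norm (T u)" by (rule S_bound[OF t])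
    also have "\<dots> \<le> K * exp (\<bar>\<alpha>\<bar> * t) * norm (T u)"
      using K t by (intro mult_right_mono mult_left_mono) (auto intro: mult_right_mono)
    finally have "norm (T u - S (T u) t) \<le> norm (T u) + K * exp (\<bar>\<alpha>\<bar> * t) * norm (T u)"
      using norm_triangle_ineq4[of "T u" "S (T u) t"] by linarith
    also have "\<dots> \<le> exp (\<bar>\<alpha>\<bar> * t) * norm (T u) + K * exp (\<bar>\<alpha>\<bar> * t) * norm (T u)"
      using mult_right_mono[OF e, of "norm (T u)"] by simp
    also have "\<dots> = (1 + K) * exp (\<bar>\<alpha>\<bar> * t) * norm (T u)" by (simp add: algebra_simps)
    also have "\<dots> \<le> (1 + K) * exp (\<bar>\<alpha>\<bar> * t) * (onorm T * norm u)"
      using K by (intro mult_left_mono onorm[OF T]) auto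
    finally have 1: "norm (T u - S (T u) t) \<le> (1 + K) * exp (\<bar>\<alpha>\<bar> * t) * (onorm T * norm u)" .
    have "norm (\<Sum>l\<in>UNIV. J l (g u t l)) \<le> (\<Sum>l\<in>UNIV. onorm (J l) * (C * norm (T u - S (T u) t)))"
    proof (rule sum_norm_le)
      fix l
      have "norm (J l (g u t l)) \<le> onorm (J l) * norm (g u t l)" by (rule onorm[OF J])
      also have "\<dots> \<le> onorm (J l) * (C * norm (T u - S (T u) t))"
        by (intro mult_left_mono g_norm t onorm_pos_le J)
      finally show "norm (J l (g u t l)) \<le> onorm (J l) * (C * norm (T u - S (T u) t))" .
    qed
    also have "\<dots> = j * C * norm (T u - S (T u) t)" by (simp add: j_def sum_distrib_right mult.assoc)
    also have "\<dots> \<le> j * C * ((1 + K) * exp (\<bar>\<alpha>\<bar> * t) * (onorm T * norm u))"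
      using j C(1) by (intro mult_left_mono 1) auto
    also have "\<dots> = j * C * onorm T * (1 + K) * exp (\<bar>\<alpha>\<bar> * t) * norm u" by (simp only: mult_ac)
    finally have "norm (U u t) \<le> norm u + j * C * onorm T * (1 + K) * exp (\<bar>\<alpha>\<bar> * t) * norm u"
      using norm_triangle_ineq4[of u "\<Sum>l\<in>UNIV. J l (g u t l)"] unfolding U_def by linarith
    also have "\<dots> \<le> exp (\<bar>\<alpha>\<bar> * t) * norm u + j * C * onorm T * (1 + K) * exp (\<bar>\<alpha>\<bar> * t) * norm u"
      using mult_right_mono[OF e, of "norm u"] by simp
    also have "\<dots> = (1 + j * C * onorm T * (1 + K)) * exp (\<bar>\<alpha>\<bar> * t) * norm u" by (simp only: distrib_right mult_1)
    finally show ?thesis .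
  qed
  show ?thesis
    unfolding mild_wp_def
  proof (intro exI conjI allI impI)
    have "0 \<le> j * C * onorm T * (1 + K)"
      using j C(1) K by (intro mult_nonneg_nonneg onorm_pos_le T) auto
    then show "0 < 1 + j * C * onorm T * (1 + K)" by simp
    show "mild (sysop (split_coeff A)) (\<lambda>_. 0) u (U u)" for u by (rule U_mild)
    show "V t = U u t" if "mild (sysop (split_coeff A)) (\<lambda>_. 0) u V" "0 \<le> t" for u V t using that by (rule U_unique)
    show "norm (U u t) \<le> (1 + j * C * onorm T * (1 + K)) * exp (\<bar>\<alpha>\<bar> * t) * norm u" if "0 \<le> t" for u t
      using that by (rule U_bound)
  qed
qed

text \<open>The cylinder over a null set of the line is a null set: the integral of its indicator
  factors over the coordinates. One factor is 0 and the others are infinite, but in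
  \<open>ennreal\<close> a product with a factor 0 is 0.\<close>

lemma AE_lborel_component:
  assumes "AE s in lborel. P s"
  shows "AE x in (lborel :: (real ^ 'd::finite) measure). P (x $ l)"
proof -
  obtain N where N: "{s \<in> space lborel. \<not> P s} \<subseteq> N" "emeasure lborel N = 0" "N \<in> sets lborel"
    by (rule AE_E[OF assms])
  have [measurable]: "N \<in> sets borel" using N(3) by simp
  let ?e = "axis l 1 :: real ^ 'd"
  define f where "f b s = (if b = ?e then indicator N s else 1 :: real)" for b :: "real ^ 'd" and s
  have "(\<integral>\<^sup>+x. ennreal (\<Prod>b\<in>Basis. f b (x \<bullet> b)) \<partial>lborel) = (\<Prod>b\<in>Basis. \<integral>\<^sup>+s. ennreal (f b s) \<partial>lborel)"
  proof -
    have "(\<integral>\<^sup>+x. (\<Prod>b\<in>Basis. ennreal (f b (x \<bullet> b))) \<partial>lborel) = (\<Prod>b\<in>Basis. \<integral>\<^sup>+s. ennreal (f b s) \<partial>lborel)"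
      by (rule nn_integral_lborel_prod) (auto simp: f_def)
    moreover have "(\<Prod>b\<in>Basis. ennreal (f b (x \<bullet> b))) = ennreal (\<Prod>b\<in>Basis. f b (x \<bullet> b))" for x
      by (rule prod_ennreal) (simp add: f_def)
    ultimately show ?thesis by simp
  qed
  also have "\<dots> = 0"
  proof (rule prod_zero)
    have "(\<integral>\<^sup>+s. ennreal (f ?e s) \<partial>lborel) = emeasure lborel N"
      by (simp add: f_def ennreal_indicator)
    then show "\<exists>b\<in>Basis. (\<integral>\<^sup>+s. ennreal (f b s) \<partial>lborel) = 0"
      using N(2) by (intro bexI[of _ ?e]) auto
  qed simp
  finally have "(\<integral>\<^sup>+x. ennreal (\<Prod>b\<in>Basis. f b (x \<bullet> b)) \<partial>lborel) = 0" .
  moreover have [measurable]: "f b \<in> borel_measurable borel" for b by (auto simp: f_def[abs_def])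
  ultimately have "AE x in lborel. ennreal (\<Prod>b\<in>Basis. f b (x \<bullet> b)) = 0"
    by (subst (asm) nn_integral_0_iff_AE) auto
  then show ?thesis
  proof eventually_elim
    case (elim x)
    have "0 \<le> (\<Prod>b\<in>Basis. f b (x \<bullet> b))" by (intro prod_nonneg) (simp add: f_def)
    with elim have "(\<Prod>b\<in>Basis. f b (x \<bullet> b)) = 0" by simp
    then obtain b where b: "b \<in> Basis" "f b (x \<bullet> b) = 0" by (auto simp: prod_zero_iff)
    then have "b = ?e" "x \<bullet> b \<notin> N" by (auto simp: f_def split: if_splits)
    then have "x $ l \<notin> N" by (simp add: inner_axis)
    then show ?case using N(1) by auto
  qed
qed

text \<open>The absorption acts diagonally, and each essential bound on the line passes to almost
  every point of space by \<open>AE_lborel_component\<close>; only finitely many exceptional sets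
  are involved.\<close>

lemma pw_bounded_split_absorption:
  fixes \<sigma> :: "'d::finite \<Rightarrow> real \<Rightarrow> complex"
  assumes "\<And>l. Linfty (\<sigma> l)"
  obtains C where "pw_bounded (\<lambda>x. (*v) (split_absorption \<sigma> x :: complex ^ ('d \<times> 'n::finite) ^ ('d \<times> 'n))) C"
proof -
  have [measurable]: "\<sigma> l \<in> borel_measurable borel" for l using assms by (simp add: Linfty_def)
  obtain c where c: "\<And>l. AE s in lborel. norm (\<sigma> l s) \<le> c l" using assms unfolding Linfty_def by metis
  \<comment> \<open>Absolute values make all summands nonnegative, so each bound \<open>c l\<close>
    is at most the sum.\<close>
  define C where "C = (\<Sum>l\<in>UNIV. \<bar>c l\<bar>)"
  have sv: "(split_absorption \<sigma> x *v v) $ p = \<sigma> (fst p) (x $ fst p) * v $ p" for x p and v :: "complex ^ ('d \<times> 'n)"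
    using block_split_absorption[of \<sigma> x v "fst p"] by (cases p) (simp add: vec_eq_iff block_def)
  have "pw_bounded (\<lambda>x. (*v) (split_absorption \<sigma> x :: complex ^ ('d \<times> 'n) ^ ('d \<times> 'n))) C"
    unfolding pw_bounded_def
  proof (intro conjI allI)
    show "0 \<le> C" by (simp add: C_def sum_nonneg)
    show "linear ((*v) (split_absorption \<sigma> x :: complex ^ ('d \<times> 'n) ^ ('d \<times> 'n)))" for x by simp
    show "(\<lambda>x. split_absorption \<sigma> x *v v) \<in> borel_measurable borel" for v :: "complex ^ ('d \<times> 'n)"
      unfolding borel_measurable_euclidean_space[where 'c="complex ^ ('d \<times> 'n)"]
    proof
      fix i :: "complex ^ ('d \<times> 'n)" assume "i \<in> Basis"
      then obtain p b where i: "i = axis p b" by (auto simp: Basis_vec_def)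
      have m: "(\<lambda>x::real^'d. x $ fst p) \<in> borel_measurable borel"
        by (intro borel_measurable_continuous_onI continuous_intros)
      have "(\<lambda>x. \<sigma> (fst p) (x $ fst p) * v $ p) \<in> borel_measurable borel"
        using measurable_compose[OF m, of "\<sigma> (fst p)" borel] by simp
      then have "(\<lambda>x. inner (\<sigma> (fst p) (x $ fst p) * v $ p) b) \<in> borel_measurable borel" by simp
      then show "(\<lambda>x. (split_absorption \<sigma> x *v v) \<bullet> i) \<in> borel_measurable borel"
        by (simp add: i inner_axis sv)
    qed
    have "AE x in (lborel :: (real ^ 'd) measure). \<forall>l. norm (\<sigma> l (x $ l)) \<le> c l"
      by (rule AE_finite_allI[of UNIV, simplified]) (simp_all add: AE_lborel_component[OF c])
    then show "AE x in lborel. \<forall>v. norm ((split_absorption \<sigma> x :: complex ^ ('d \<times> 'n) ^ ('d \<times> 'n)) *v v) \<le> C * norm v"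
    proof eventually_elim
      case (elim x)
      have cC: "norm (\<sigma> l (x $ l)) \<le> C" for l
      proof -
        have "norm (\<sigma> l (x $ l)) \<le> \<bar>c l\<bar>" using elim[rule_format, of l] by linarith
        also have "\<dots> \<le> C" unfolding C_def by (rule member_le_sum) auto
        finally show ?thesis .
      qed
      show ?case
      proof
        fix v :: "complex ^ ('d \<times> 'n)"
        have "norm (split_absorption \<sigma> x *v v) \<le> norm (C *\<^sub>R v)"
        proof (rule norm_le_componentwise_cart)
          fix p
          show "norm ((split_absorption \<sigma> x *v v) $ p) \<le> norm ((C *\<^sub>R v) $ p)"
            using mult_right_mono[OF order_trans[OF cC abs_ge_self], of "norm (v $ p)"] by (simp add: sv norm_mult)
        qed
        then show "norm ((split_absorption \<sigma> x :: complex ^ ('d \<times> 'n) ^ ('d \<times> 'n)) *v v) \<le> C * norm v"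
          by (simp add: C_def sum_nonneg)
      qed
    qed
  qed
  then show thesis by (rule that)
qed

lemma pw_zero: "pw (\<lambda>x. (*v) 0) = (\<lambda>_. 0)"
  by (simp add: pw_def[abs_def] zero_lsq_def)

theorem theorem3p2:
  fixes A :: "'d::finite \<Rightarrow> complex ^ 'n::finite ^ 'n"
  assumes "strongly_well_posed A (\<lambda>x. 0)"
    and "elliptic A"
  shows "\<forall>\<sigma> :: 'd \<Rightarrow> real \<Rightarrow> complex. (\<forall>l. Linfty (\<sigma> l)) \<longrightarrow>
           strongly_well_posed (split_coeff A) (split_absorption \<sigma>)"
proof (intro allI impI)
  fix \<sigma> :: "'d \<Rightarrow> real \<Rightarrow> complex" assume \<sigma>: "\<forall>l. Linfty (\<sigma> l)"
  have "pw_bounded (\<lambda>x::real^'d. (*v) (0 :: complex ^ 'n ^ 'n)) 0"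
    by (simp add: pw_bounded_def)
  from strongly_well_posed_iff[OF this] assms(1) have "mild_wp (sysop A) (\<lambda>_. 0)"
    by (simp add: pw_zero)
  then have wp: "mild_wp (sysop (split_coeff A)) (\<lambda>_. 0)" using assms(2) by (rule mild_wp_split)
  obtain C where C: "pw_bounded (\<lambda>x. (*v) (split_absorption \<sigma> x :: complex ^ ('d \<times> 'n) ^ ('d \<times> 'n))) C"
    using pw_bounded_split_absorption \<sigma> by blast
  show "strongly_well_posed (split_coeff A) (split_absorption \<sigma>)"
    unfolding strongly_well_posed_iff[OF C]
    by (rule mild_wp_bounded_perturbation[OF sysop_closed sysop_subspace bounded_linear_pw[OF C] wp])
qed

end
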